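(* For any $t_0>0$, integer $K_1\ge2$, and all $x\in\mathbb Z$ and $t\ge t_0$, we have $$\nabla\mathbf v(x,t)=\nabla\Omega(x)+g\!\left(\frac{x}{\sqrt t}\right)+\frac{1}{2\sqrt t}\,h\!\left(\frac{x}{\sqrt t}\right)+\sum_{n=2}^{K_1}\frac{1}{t^{n/2}}\,g_n\!\left(\frac{x}{\sqrt t}\right)+\hat{\mathbf r}_{\mathbf v}(K_1;x,t)\quad\text{for }x\ge0,$$ $$\nabla\mathbf v(x,t)=-\nabla\mathbf v(-(x+1),t)\quad\text{for }x\le-1,$$ where $$\Omega(x)=\frac1{2\pi}\left(\int_{-\pi}^{\pi}\left(\frac{\cos(x\xi)}{A(\xi)}-\frac1{\xi^2}\right)d\xi-\frac2\pi\right)+\frac x2,$$ $$|\hat{\mathbf r}_{\mathbf v}(K_1;x,t)|\le\frac{\hat R_{\mathbf v}(K_1,t_0)}{t^{(K_1+1)/2}},$$ and $\hat R_{\mathbf v}(K_1,t_0)\ge0$ does not depend on $t\ge t_0$ and $x\ge0$. Moreover, if $N=1$, then $\nabla\Omega(x)=0$ for all integers $x\ge0$.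
   Context: Fix $N\in\mathbb N$. Let $a_1,\dots,a_N\in\mathbb R$ be the unique solution of $\sum_{\nu=1}^Na_\nu\nu^2=1$, $\sum_{\nu=1}^Na_\nu\nu^{2m}=0$ for $m=2,\dots,N$. For functions $\mathbf u$ on $\mathbb Z$ let $\boldsymbol\Delta_1\mathbf u(x)=\sum_{\nu=1}^Na_\nu(\mathbf u(x-\nu)-2\mathbf u(x)+\mathbf u(x+\nu))$, and let $A(\theta)=2\sum_{\nu=1}^Na_\nu(1-\cos\nu\theta)$ be the symbol of $-\boldsymbol\Delta_1$. The gradient is $\nabla\mathbf v(x,t)=\mathbf v(x+1,t)-\mathbf v(x,t)$, and likewise $\nabla\Omega(x)=\Omega(x+1)-\Omega(x)$. Second discrete Green function: $\mathbf v(x,t)$, $x\in\mathbb Z$, $t\ge0$, is the function that is rapidly decreasing in $x$, $C^1$ in $t\in[0,\infty)$, and satisfies $\dot{\mathbf v}-\boldsymbol\Delta_1\mathbf v=\boldsymbol\delta$ for $t>0$, $\mathbf v(x,0)=0$, where $\boldsymbol\delta(0)=1$ and $\boldsymbol\delta(x)=0$ for $x\neq0$. It is given by $\mathbf v(x,t)=\frac1{2\pi}\int_{-\pi}^\pi\frac{1-e^{-tA(\theta)}}{A(\theta)}e^{ix\theta}\,d\theta$. Let $h(y)=\frac{1}{2\sqrt\pi}e^{-y^2/4}$. For $n\ge N$ set $$b_n=\frac{2(-1)^{n+1}}{(2(n+1))!}\sum_{\nu=1}^Na_\nu\nu^{2(n+1)},\quad c_{nm}=\sum_{\substack{l_1,\dots,l_m\ge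 N\\l_1+\dots+l_m=n}}b_{l_1}\cdots b_{l_m}\ (m\ge1),\quad \mathcal P_n(\xi)=\sum_{1\le m\le n/N}\frac{c_{nm}\xi^{2(n+m)}}{m!},$$ and $h_{0n}(y)=\mathcal P_n\!\left(-i\frac{d}{dy}\right)h(y)$. For $y\ge0$ set $$f_0(y)=2y\int_y^\infty\rho^{-2}h(\rho)\,d\rho,\qquad f_n(y)=-\frac{2}{y^{2n-1}}\int_0^y\rho^{2n-2}h_{0n}(\rho)\,d\rho\quad(n\ge N),$$ with the values at $y=0$ understood as the limits $y\to0+$ (these functions are real analytic on $[0,\infty)$; derivatives at $0$ are one-sided). Set $g(y)=f_0'(y)$ and, for $n\ge2$, $y\ge0$, $$g_n(y)=\frac{1}{(n+1)!}f_0^{(n+1)}(y)+\sum_{\substack{s\ge N,\ j\ge1\\2s+j-1=n}}\frac1{j!}f_s^{(j)}(y)$$ (empty sums are zero). *)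

theory Defs
  imports "HOL-Analysis.Analysis" "HOL-Computational_Algebra.Polynomial"
begin

text \<open>The linear system that determines the stencil coefficients \<open>a 1, \<dots>, a N\<close> uniquely
  (a Vandermonde system in \<open>\<nu>\<^sup>2\<close>).  The other values of \<open>a\<close> are never used.\<close>

definition stencil_coeffs :: "nat \<Rightarrow> (nat \<Rightarrow> real) \<Rightarrow> bool" where
  "stencil_coeffs N a \<longleftrightarrow>
     (\<Sum>\<nu>=1..N. a \<nu> * real \<nu> ^ 2) = 1 \<and>
     (\<forall>m\<in>{2..N}. (\<Sum>\<nu>=1..N. a \<nu> * real \<nu> ^ (2 * m)) = 0)"

definition discrete_laplacian :: "nat \<Rightarrow> (nat \<Rightarrow> real) \<Rightarrow> (int \<Rightarrow> real) \<Rightarrow> int \<Rightarrow> real" where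
  "discrete_laplacian N a u x =
     (\<Sum>\<nu>=1..N. a \<nu> * (u (x - int \<nu>) - 2 * u x + u (x + int \<nu>)))"

definition symb :: "nat \<Rightarrow> (nat \<Rightarrow> real) \<Rightarrow> real \<Rightarrow> real" where
  "symb N a \<theta> = 2 * (\<Sum>\<nu>=1..N. a \<nu> * (1 - cos (real \<nu> * \<theta>)))"

definition grad :: "(int \<Rightarrow> real) \<Rightarrow> int \<Rightarrow> real" where
  "grad u x = u (x + 1) - u x"

definition discrete_delta :: "int \<Rightarrow> real" where
  "discrete_delta x = (if x = 0 then 1 else 0)"

definition rapidly_decreasing :: "(int \<Rightarrow> real) \<Rightarrow> bool" where
  "rapidly_decreasing u \<longleftrightarrow> (\<forall>k::nat. \<exists>C. \<forall>x. \<bar>real_of_int x\<bar> ^ k * \<bar>u x\<bar> \<le> C)"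

text \<open>Continuous differentiability on the closed half-line, with the one-sided derivative at \<open>0\<close>
  (the library's \<open>C1_differentiable_on\<close> asks for two-sided derivatives).\<close>

definition C1_on_halfline :: "(real \<Rightarrow> real) \<Rightarrow> bool" where
  "C1_on_halfline f \<longleftrightarrow>
     (\<exists>D. continuous_on {0..} D \<and>
        (\<forall>t\<ge>0. (f has_real_derivative D t) (at t within {0..})))"

definition second_green_function :: "nat \<Rightarrow> (nat \<Rightarrow> real) \<Rightarrow> (int \<Rightarrow> real \<Rightarrow> real) \<Rightarrow> bool" where
  "second_green_function N a v \<longleftrightarrow>
     (\<forall>t\<ge>0. rapidly_decreasing (\<lambda>x. v x t)) \<and>
     (\<forall>x. C1_on_halfline (v x)) \<and>
     (\<forall>x. \<forall>t>0. deriv (v x) t - discrete_laplacian N a (\<lambda>y. v y t) x = discrete_delta x) \<and>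
     (\<forall>x. v x 0 = 0)"

definition heat_profile :: "real \<Rightarrow> real" where
  "heat_profile y = 1 / (2 * sqrt pi) * exp (- (y ^ 2) / 4)"

definition b_coeff :: "nat \<Rightarrow> (nat \<Rightarrow> real) \<Rightarrow> nat \<Rightarrow> real" where
  "b_coeff N a n = 2 * (-1) ^ (n + 1) / fact (2 * (n + 1)) * (\<Sum>\<nu>=1..N. a \<nu> * real \<nu> ^ (2 * (n + 1)))"

text \<open>The tuples \<open>(l\<^sub>1, \<dots>, l\<^sub>m)\<close> are lists of length \<open>m\<close>.\<close>

definition c_coeff :: "nat \<Rightarrow> (nat \<Rightarrow> real) \<Rightarrow> nat \<Rightarrow> nat \<Rightarrow> real" where
  "c_coeff N a n m =
     (\<Sum>ls\<in>{ls. length ls = m \<and> (\<forall>l\<in>set ls. N \<le> l) \<and> sum_list ls = n}. prod_list (map (b_coeff N a) ls))"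

definition P_poly :: "nat \<Rightarrow> (nat \<Rightarrow> real) \<Rightarrow> nat \<Rightarrow> real poly" where
  "P_poly N a n = (\<Sum>m\<in>{m. 1 \<le> m \<and> real m \<le> real n / real N}. monom (c_coeff N a n m / fact m) (2 * (n + m)))"

text \<open>The operator \<open>p(-i d/dy)\<close> for a polynomial \<open>p\<close>.\<close>

definition poly_D :: "real poly \<Rightarrow> (real \<Rightarrow> real) \<Rightarrow> real \<Rightarrow> complex" where
  "poly_D p u y =
     (\<Sum>k\<le>degree p. complex_of_real (coeff p k) * (- \<i>) ^ k * complex_of_real ((deriv ^^ k) u y))"

text \<open>Since \<open>P_poly N a n\<close> contains only even powers, the value below is real and \<open>Re\<close> merely
  changes the type.\<close>

definition h0_fun :: "nat \<Rightarrow> (nat \<Rightarrow> real) \<Rightarrow> nat \<Rightarrow> real \<Rightarrow> real" where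
  "h0_fun N a n y = Re (poly_D (P_poly N a n) heat_profile y)"

text \<open>Extension to \<open>y = 0\<close> by the limit from the right; only values at \<open>y \<ge> 0\<close> are used.\<close>

definition extend_at_0 :: "(real \<Rightarrow> real) \<Rightarrow> real \<Rightarrow> real" where
  "extend_at_0 F y = (if y = 0 then Lim (at_right 0) F else F y)"

definition f0_fun :: "real \<Rightarrow> real" where
  "f0_fun = extend_at_0 (\<lambda>y. 2 * y * integral {y..} (\<lambda>\<rho>. heat_profile \<rho> / \<rho> ^ 2))"

text \<open>The functions \<open>f\<^sub>n\<close> for \<open>n \<ge> N \<ge> 1\<close>, so the subtractions on exponents do not truncate.\<close>

definition f_fun :: "nat \<Rightarrow> (nat \<Rightarrow> real) \<Rightarrow> nat \<Rightarrow> real \<Rightarrow> real" where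
  "f_fun N a n =
     extend_at_0 (\<lambda>y. - (2 / y ^ (2 * n - 1)) * integral {0..y} (\<lambda>\<rho>. \<rho> ^ (2 * n - 2) * h0_fun N a n \<rho>))"

text \<open>Iterated derivative on \<open>[0, \<infinity>)\<close>: one-sided at \<open>0\<close>, the ordinary one at \<open>y > 0\<close>.\<close>

definition hderiv :: "nat \<Rightarrow> (real \<Rightarrow> real) \<Rightarrow> real \<Rightarrow> real" where
  "hderiv j = (\<lambda>F y. vector_derivative F (at y within {0..})) ^^ j"

definition g0_fun :: "real \<Rightarrow> real" where
  "g0_fun = hderiv 1 f0_fun"

definition g_fun :: "nat \<Rightarrow> (nat \<Rightarrow> real) \<Rightarrow> nat \<Rightarrow> real \<Rightarrow> real" where
  "g_fun N a n y =
     1 / fact (n + 1) * hderiv (n + 1) f0_fun y +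
     (\<Sum>(s, j)\<in>{(s, j). s \<ge> N \<and> j \<ge> 1 \<and> 2 * s + j - 1 = n}. 1 / fact j * hderiv j (f_fun N a s) y)"

definition Omega :: "nat \<Rightarrow> (nat \<Rightarrow> real) \<Rightarrow> int \<Rightarrow> real" where
  "Omega N a x =
     1 / (2 * pi) *
       (integral {-pi..pi} (\<lambda>\<xi>. cos (real_of_int x * \<xi>) / symb N a \<xi> - 1 / \<xi> ^ 2) - 2 / pi) +
     real_of_int x / 2"

end

theory Submission
  imports Defs "HOL-Probability.Probability" "HOL-Real_Asymp.Real_Asymp"
begin

text \<open>
  By uniqueness, \<open>v x t = \<integral>\<^sub>0\<^sup>t u x s ds\<close> with the lattice heat kernel
  \<open>u x t = 1/(2 \<pi>) \<integral> e\<^bsup>-t A(\<theta>)\<^esup> cos (x \<theta>) d\<theta>\<close>.  Rescaling \<open>\<theta> = \<xi> / sqrt t\<close> and expanding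
  \<open>e\<^bsup>-t A\<^esup>\<close> around \<open>e\<^bsup>-\<xi>\<^sup>2\<^esup>\<close> gives
  \<open>u = t\<^bsup>-1/2\<^esup> (h + \<Sum>\<^sub>n t\<^bsup>-n\<^esup> h\<^sub>0\<^sub>n)(x / sqrt t)\<close> up to an error that is integrable in \<open>t\<close> at infinity.
  The functions \<open>t\<^bsup>1/2-n\<^esup> f\<^sub>n (x / sqrt t)\<close> have the terms of this expansion as \<open>t\<close>-derivatives, so
  \<open>v\<close> minus these functions converges as \<open>t \<rightarrow> \<infinity>\<close> with a rate, and on the level of gradients the limit is
  \<open>\<nabla>\<Omega>\<close>.  Taylor expansion of the profiles with step \<open>1 / sqrt t\<close> yields the functions \<open>g\<^sub>n\<close>.
\<close>

section \<open>Uniqueness for the discrete heat equation\<close>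

text \<open>For fixed \<open>x\<close>, \<open>green x t\<close> grows like \<open>sqrt t\<close>,
  so a limit exists only after differences in \<open>x\<close> are taken. A difference of two
  cosines cancels the double zero of the symbol at frequency 0, which makes
  \<open>grad_kernel\<close> bounded. The leading profile survives in the limit: its gradient tends
  to the one-sided slope -1/2 of f0 at 0, and this is where the summand \<open>x / 2\<close> of
  \<open>Omega\<close> comes from.

  The restriction to nonnegative \<open>x\<close> has the same origin. The Green function is even in
  \<open>x\<close>, but \<open>f0_deriv 0\<close>, the smooth continuation of f0 to the real line,
  satisfies f0(-y) = f0(y) + y. The even profile thus has a kink at 0 that no Taylor expansion may
  cross; negative \<open>x\<close> is reached by reflection.

  On the Fourier side everything rests on \<open>c * \<theta>^2 \<le> symb N a \<theta>\<close> over
  the whole period. The linear system for the coefficients does not show this bound; it is extracted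
  from the fact that 2 minus the second derivative of the symbol is a multiple of
  \<open>(1 - cos \<theta>) ^ N\<close>.\<close>

lemma discrete_laplacian_bound:
  assumes "\<And>x. \<bar>u x\<bar> \<le> K"
  shows "\<bar>discrete_laplacian N a u x\<bar> \<le> 4 * (\<Sum>\<nu>=1..N. \<bar>a \<nu>\<bar>) * K"
proof -
  have "\<bar>discrete_laplacian N a u x\<bar> \<le> (\<Sum>\<nu>=1..N. \<bar>a \<nu> * (u (x - int \<nu>) - 2 * u x + u (x + int \<nu>))\<bar>)"
    unfolding discrete_laplacian_def by (rule sum_abs)
  also have "\<dots> \<le> (\<Sum>\<nu>=1..N. \<bar>a \<nu>\<bar> * (4 * K))"
  proof (rule sum_mono)
    fix \<nu>
    have "\<bar>u (x - int \<nu>) - 2 * u x + u (x + int \<nu>)\<bar> \<le> 4 * K"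
      using assms[of "x - int \<nu>"] assms[of x] assms[of "x + int \<nu>"] by linarith
    then show "\<bar>a \<nu> * (u (x - int \<nu>) - 2 * u x + u (x + int \<nu>))\<bar> \<le> \<bar>a \<nu>\<bar> * (4 * K)"
      by (simp add: abs_mult mult_left_mono)
  qed
  also have "\<dots> = 4 * (\<Sum>\<nu>=1..N. \<bar>a \<nu>\<bar>) * K"
    by (simp add: sum_distrib_right sum_distrib_left mult_ac)
  finally show ?thesis .
qed

text \<open>
  The bound on \<open>w\<close> is only assumed at each time separately.  The generator is a bounded operator on
  bounded sequences, so a solution that is bounded locally uniformly in time vanishes; Baire's
  theorem shows that the set of times where local uniformity fails is empty.
\<close>

locale homogeneous_solution =
  fixes N :: nat and a :: "nat \<Rightarrow> real" and w :: "int \<Rightarrow> real \<Rightarrow> real"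
  assumes cont: "\<And>x. continuous_on {0..} (w x)"
    and deriv: "\<And>x t. t > 0 \<Longrightarrow> (w x has_real_derivative discrete_laplacian N a (\<lambda>y. w y t) x) (at t)"
    and bounded: "\<And>t. t \<ge> 0 \<Longrightarrow> \<exists>K. \<forall>x. \<bar>w x t\<bar> \<le> K"
    and initial: "\<And>x. w x 0 = 0"
begin

definition bdd :: "real set \<Rightarrow> bool" where
  "bdd S \<longleftrightarrow> (\<exists>K. \<forall>t\<in>S. \<forall>x. \<bar>w x t\<bar> \<le> K)"

text \<open>The first summand bounds the operator norm of the discrete Laplacian on bounded
  sequences. The added 1 keeps the rate positive, so that the time step
  \<open>1 / (2 * rate)\<close> is always meaningful.\<close>

definition rate :: real where
  "rate = 4 * (\<Sum>\<nu>=1..N. \<bar>a \<nu>\<bar>) + 1"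

lemma rate_pos: "rate > 0"
  by (simp add: rate_def add_nonneg_pos sum_nonneg)

lemma bdd_Un: "bdd S \<Longrightarrow> bdd T \<Longrightarrow> bdd (S \<union> T)"
  unfolding bdd_def by (metis Un_iff dual_order.trans linorder_linear)

lemma bdd_subset: "bdd T \<Longrightarrow> S \<subseteq> T \<Longrightarrow> bdd S"
  unfolding bdd_def by blast

text \<open>By the mean value theorem \<open>w x\<close> moves by at most \<open>rate * K\<close>
  times the elapsed time, hence by at most \<open>K / 2\<close> on such a short interval. The time
  \<open>s\<close> may lie on either side of \<open>t\<close>.\<close>

lemma halving_step:
  assumes pq: "0 \<le> p" "q - p \<le> 1 / (2 * rate)"
    and K: "\<And>t x. t \<in> {p..q} \<Longrightarrow> \<bar>w x t\<bar> \<le> K"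
    and s: "s \<in> {p..q}" and c: "\<And>x. \<bar>w x s\<bar> \<le> c" and t: "t \<in> {p..q}"
  shows "\<bar>w x t\<bar> \<le> c + K / 2"
proof -
  have K0: "K \<ge> 0" using K[OF s, of 0] by linarith
  have main: "\<bar>w x e - w x d\<bar> \<le> K / 2" if de: "d \<in> {p..q}" "e \<in> {p..q}" "d < e" for d e
  proof -
    have "\<exists>l z. d < z \<and> z < e \<and> (w x has_real_derivative l) (at z) \<and> w x e - w x d = (e - d) * l"
    proof (rule MVT[OF \<open>d < e\<close>])
      show "continuous_on {d..e} (w x)"
        by (rule continuous_on_subset[OF cont]) (use de pq in auto)
      show "w x differentiable at z" if "d < z" "z < e" for z
        using deriv[of z x] that de pq by (auto simp: real_differentiable_def)
    qed
    then obtain l z where z: "d < z" "z < e" "(w x has_real_derivative l) (at z)"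
      "w x e - w x d = (e - d) * l" by blast
    have "z > 0" using z de pq by auto
    then have "l = discrete_laplacian N a (\<lambda>y. w y z) x"
      using deriv z(3) DERIV_unique by blast
    moreover have "\<bar>discrete_laplacian N a (\<lambda>y. w y z) x\<bar> \<le> 4 * (\<Sum>\<nu>=1..N. \<bar>a \<nu>\<bar>) * K"
      by (rule discrete_laplacian_bound, rule K) (use z de in auto)
    ultimately have "\<bar>l\<bar> \<le> rate * K" using K0 by (simp add: rate_def algebra_simps)
    moreover have "e - d \<le> 1 / (2 * rate)" using de pq by auto
    ultimately have "(e - d) * \<bar>l\<bar> \<le> 1 / (2 * rate) * (rate * K)"
      using de by (intro mult_mono) (auto simp: rate_pos less_imp_le)
    then show ?thesis using z rate_pos by (simp add: abs_mult)
  qed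
  consider "s = t" | "s < t" | "t < s" by linarith
  then show ?thesis
    using main[of s t] main[of t s] s t c[of x] K0 by cases (simp, linarith+)
qed

text \<open>Iterating \<open>K \<mapsto> c + K / 2\<close> from any bound \<open>K\<close> converges
  to the fixed point \<open>2 * c\<close>, in which \<open>K\<close> no longer occurs. A bound at
  one time thus controls a whole short interval, forwards and backwards, as soon as some uniform
  bound exists there.\<close>

lemma doubling:
  assumes pq: "0 \<le> p" "q - p \<le> 1 / (2 * rate)" and b: "bdd {p..q}"
    and s: "s \<in> {p..q}" and c: "\<And>x. \<bar>w x s\<bar> \<le> c" and t: "t \<in> {p..q}"
  shows "\<bar>w x t\<bar> \<le> 2 * c"
proof -
  obtain K where K: "\<And>t x. t \<in> {p..q} \<Longrightarrow> \<bar>w x t\<bar> \<le> K" using b unfolding bdd_def by blast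
  have c0: "c \<ge> 0" using c[of 0] by linarith
  have step: "\<forall>t\<in>{p..q}. \<forall>x. \<bar>w x t\<bar> \<le> 2 * c + K / 2 ^ n" for n
  proof (induction n)
    case 0
    have "\<bar>w x t\<bar> \<le> 2 * c + K" if "t \<in> {p..q}" for x t using K[OF that, of x] c0 by linarith
    then show ?case by simp
  next
    case (Suc n)
    then show ?case using halving_step[OF pq _ s c, of "2 * c + K / 2 ^ n"] 
      by (auto simp: field_simps)
  qed
  have "(\<lambda>n. 2 * c + K / 2 ^ n) \<longlonglongrightarrow> 2 * c + 0"
    by (intro tendsto_add tendsto_const LIMSEQ_divide_realpow_zero) simp
  then show ?thesis
    using LIMSEQ_le_const[of "\<lambda>n. 2 * c + K / 2 ^ n" "2 * c" "\<bar>w x t\<bar>"] step t by force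
qed

text \<open>Compactness of the interval in the form of bisection: bounds on adjoining pieces
  combine, and sufficiently short pieces around each point are bounded.\<close>

lemma locally_bdd_imp_bdd:
  assumes "0 \<le> p" "p \<le> q" and loc: "\<And>t. t \<in> {p..q} \<Longrightarrow> \<exists>r>0. bdd ({0..} \<inter> ball t r)"
  shows "bdd {p..q}"
proof -
  define P where "P c d \<longleftrightarrow> bdd ({p..q} \<inter> {c..d})" for c d
  have "P p q" using \<open>p \<le> q\<close>
  proof (induction rule: Bolzano)
    case (trans c d e)
    then have "bdd (({p..q} \<inter> {c..d}) \<union> ({p..q} \<inter> {d..e}))" unfolding P_def by (intro bdd_Un)
    then show ?case unfolding P_def by (rule bdd_subset) auto
  next
    case (local t)
    then obtain r where r: "r > 0" "bdd ({0..} \<inter> ball t r)" using loc[of t] by auto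
    have "P c d" if "c \<le> t" "t \<le> d" "d - c < r" for c d
      unfolding P_def by (rule bdd_subset[OF r(2)]) (use that \<open>0 \<le> p\<close> in \<open>auto simp: dist_real_def\<close>)
    then show ?case using r(1) by blast
  qed
  then show ?thesis by (simp add: P_def)
qed

section \<open>Times without a locally uniform bound, and Baire's theorem\<close>

definition bad :: "real set" where
  "bad = {t. t \<ge> 0 \<and> (\<forall>r>0. \<not> bdd ({0..} \<inter> ball t r))}"

lemma closed_bad: "closed bad"
proof -
  have "closed ({0..} - {t. \<exists>r>0. bdd ({0..} \<inter> ball t r)})"
  proof (intro closed_Diff)
    show "open {t. \<exists>r>0. bdd ({0..} \<inter> ball t r)}"
    proof (subst open_contains_ball, safe)
      fix t r :: real assume r: "r > 0" "bdd ({0..} \<inter> ball t r)"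
      have "\<exists>r'>0. bdd ({0..} \<inter> ball s r')" if "s \<in> ball t (r/2)" for s
      proof (intro exI conjI)
        show "r / 2 > 0" using r by simp
        show "bdd ({0..} \<inter> ball s (r/2))"
          proof (rule bdd_subset[OF r(2)], safe)
          fix y assume "y \<in> ball s (r/2)"
          then show "y \<in> ball t r" using that unfolding mem_ball dist_real_def by linarith
        qed
      qed
      then show "\<exists>e>0. ball t e \<subseteq> {t. \<exists>r>0. bdd ({0..} \<inter> ball t r)}"
        using r by (intro exI[of _ "r/2"]) auto
    qed
  qed auto
  also have "{0..} - {t. \<exists>r>0. bdd ({0..} \<inter> ball t r)} = bad" by (auto simp: bad_def)
  finally show ?thesis .
qed

text \<open>The closed set \<open>bad\<close> is the union over \<open>n\<close> of the sets
  \<open>F n\<close> of times with bound \<open>n\<close>, each closed because every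
  \<open>w x\<close> is continuous. If none of them contained a relatively open piece of
  \<open>bad\<close>, their complements would be open and dense with empty intersection, against
  Baire.\<close>

lemma bad_uniform:
  assumes "bad \<noteq> {}"
  shows "\<exists>e r n. e \<in> bad \<and> r > 0 \<and> (\<forall>t\<in>bad. \<bar>t - e\<bar> < r \<longrightarrow> (\<forall>x. \<bar>w x t\<bar> \<le> real n))"
proof -
  define F where "F n = {t\<in>bad. \<forall>x. \<bar>w x t\<bar> \<le> real n}" for n :: nat
  have clF: "closedin (top_of_set bad) (F n)" for n
  proof -
    have "continuous_on bad (w x)" for x
      by (rule continuous_on_subset[OF cont]) (auto simp: bad_def)
    then have "closedin (top_of_set bad) (bad \<inter> w x -` {- real n..real n})" for x
      by (intro continuous_closedin_preimage) auto
    then have "closedin (top_of_set bad) (\<Inter>x. bad \<inter> w x -` {- real n..real n})"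
      by (intro closedin_Inter) auto
    moreover have "F n = (\<Inter>x. bad \<inter> w x -` {- real n..real n})" by (auto simp: F_def abs_le_iff minus_le_iff)
    ultimately show ?thesis by auto
  qed
  show ?thesis
  proof (rule ccontr)
    assume asm: "\<not> ?thesis"
    then have no: "\<not> (\<forall>t\<in>bad. \<bar>t - e\<bar> < r \<longrightarrow> (\<forall>x. \<bar>w x t\<bar> \<le> real n))" if "e \<in> bad" "r > 0" for e r n
      using that asm by blast
    have "bad \<subseteq> closure (\<Inter>(range (\<lambda>n. bad - F n)))"
    proof (rule Baire[OF closed_bad])
      fix T assume "T \<in> range (\<lambda>n. bad - F n)"
      then obtain n where T: "T = bad - F n" by auto
      have "bad \<subseteq> closure (bad - F n)"
      proof
        fix e assume e: "e \<in> bad"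
        show "e \<in> closure (bad - F n)"
          unfolding closure_approachable
        proof (intro allI impI)
          fix r :: real assume "r > 0"
          from no[OF e this, of n] show "\<exists>y\<in>bad - F n. dist y e < r"
            by (auto simp: F_def dist_real_def)
        qed
      qed
      then show "openin (top_of_set bad) T \<and> bad \<subseteq> closure T"
        using clF[of n] T by (simp add: openin_diff)
    qed auto
    moreover have "\<Inter>(range (\<lambda>n. bad - F n)) = {}"
    proof -
      have "\<exists>n. t \<in> F n" if tb: "t \<in> bad" for t
      proof -
        obtain K where "\<forall>x. \<bar>w x t\<bar> \<le> K" using bounded[of t] tb by (auto simp: bad_def)
        moreover obtain n :: nat where "K \<le> real n" using real_arch_simple by blast
        ultimately show ?thesis using tb by (intro exI[of _ n]) (auto simp: F_def intro: order_trans)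
      qed
      then show ?thesis by blast
    qed
    ultimately show False using assms by (metis closure_empty subset_empty)
  qed
qed

text \<open>Near the point \<open>e\<close> supplied by Baire all bad times share the bound
  \<open>n\<close>. Any other nearby time \<open>s\<close> is joined to the nearest bad time
  \<open>\<alpha>\<close> by a segment whose only bad point is \<open>\<alpha>\<close>, and
  \<open>doubling\<close> carries the bound from \<open>\<alpha>\<close> to \<open>s\<close>. So
  \<open>e\<close> has a bounded neighbourhood after all.\<close>

lemma bad_empty: "bad = {}"
proof (rule ccontr)
  assume ne: "bad \<noteq> {}"
  then obtain e r0 n where e: "e \<in> bad" and r0: "r0 > 0"
    and n: "\<And>t x. t \<in> bad \<Longrightarrow> \<bar>t - e\<bar> < r0 \<Longrightarrow> \<bar>w x t\<bar> \<le> real n"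
    using bad_uniform[OF ne] by blast
  \<comment> \<open>The half of \<open>r0\<close> is needed because \<open>\<alpha>\<close> is
    within \<open>r\<close> of \<open>s\<close> and \<open>s\<close> within \<open>r\<close> of
    \<open>e\<close>; the second entry makes the segment from \<open>s\<close> to
    \<open>\<alpha>\<close> short enough for \<open>doubling\<close>.\<close>
  define r where "r = min (r0 / 2) (1 / (2 * rate))"
  have r: "r > 0" using r0 rate_pos by (simp add: r_def)
  have "\<bar>w x s\<bar> \<le> 2 * real n" if s: "s \<ge> 0" "\<bar>s - e\<bar> < r" for s x
  proof -
    obtain \<alpha> where \<alpha>: "\<alpha> \<in> bad" "\<And>y. y \<in> bad \<Longrightarrow> dist s \<alpha> \<le> dist s y"
      using distance_attains_inf[OF closed_bad ne, of s] by blast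
    have near: "\<bar>s - \<alpha>\<bar> < r" using \<alpha>(2)[OF e] s by (simp add: dist_real_def)
    then have "\<bar>\<alpha> - e\<bar> < r0" using s unfolding r_def by linarith
    then have wa: "\<bar>w x \<alpha>\<bar> \<le> real n" for x using n \<alpha> by blast
    define p q where "p = min s \<alpha>" and "q = max s \<alpha>"
    have pq: "0 \<le> p" "q - p \<le> 1 / (2 * rate)"
      using s \<alpha>(1) near by (auto simp: p_def q_def bad_def r_def)
    obtain c where c: "\<And>x. \<bar>w x s\<bar> \<le> c" using bounded[OF s(1)] by blast
    \<comment> \<open>Compactness bounds each segment from \<open>s\<close> to \<open>t\<close>, but
      these bounds might blow up as \<open>t\<close> approaches \<open>\<alpha>\<close>. Applying
      \<open>doubling\<close> from \<open>s\<close> replaces them all by \<open>2 * c\<close>; the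
      end point \<open>\<alpha>\<close> is covered by \<open>n\<close>.\<close>
    have "\<bar>w x t\<bar> \<le> max (real n) (2 * c)" if t: "t \<in> {p..q}" for t x
    proof (cases "t = \<alpha>")
      case True
      then show ?thesis using wa[of x] by simp
    next
      case False
      define p' q' where "p' = min s t" and "q' = max s t"
      have "y \<notin> bad" if "y \<in> {p'..q'}" for y
        using \<alpha>(2)[of y] that t False by (auto simp: dist_real_def p'_def q'_def p_def q_def)
      moreover have "0 \<le> p'" using pq t by (auto simp: p'_def p_def)
      ultimately have "bdd {p'..q'}"
        by (intro locally_bdd_imp_bdd) (auto simp: bad_def p'_def q'_def)
      then have "\<bar>w x t\<bar> \<le> 2 * c"
        by (intro doubling[of p' q' s c t]) (use pq t c \<open>0 \<le> p'\<close> in \<open>auto simp: p'_def q'_def p_def q_def\<close>)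
      then show ?thesis by simp
    qed
    then have "bdd {p..q}" unfolding bdd_def by blast
    then show ?thesis
      by (rule doubling[OF pq _ _ wa]) (auto simp: p_def q_def)
  qed
  then have "bdd ({0..} \<inter> ball e r)" unfolding bdd_def
    by (intro exI[of _ "2 * real n"]) (auto simp: dist_real_def abs_minus_commute)
  then show False using e r by (auto simp: bad_def)
qed

text \<open>Compact intervals are bounded because \<open>bad\<close> is empty, so
  \<open>doubling\<close> with \<open>c = 0\<close> propagates vanishing over one time step of
  length \<open>1 / (2 * rate)\<close> after another.\<close>

lemma solution_zero:
  assumes "t \<ge> 0" shows "w x t = 0"
proof -
  have bd: "bdd {p..q}" if "0 \<le> p" "p \<le> q" for p q
    using that bad_empty by (intro locally_bdd_imp_bdd) (auto simp: bad_def)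
  define \<delta> where "\<delta> = 1 / (2 * rate)"
  have \<delta>: "\<delta> > 0" using rate_pos by (simp add: \<delta>_def)
  have "\<forall>t\<in>{0..real k * \<delta>}. \<forall>x. w x t = 0" for k
  proof (induction k)
    case 0
    then show ?case using initial by simp
  next
    case (Suc k)
    have "w x t = 0" if "t \<in> {real k * \<delta>..real (Suc k) * \<delta>}" for t x
    proof -
      have "\<bar>w x t\<bar> \<le> 2 * 0"
      proof (rule doubling[of "real k * \<delta>" "real (Suc k) * \<delta>" "real k * \<delta>"])
        show "bdd {real k * \<delta>..real (Suc k) * \<delta>}" using \<delta> by (intro bd) (auto simp: algebra_simps)
        show "\<bar>w x (real k * \<delta>)\<bar> \<le> 0" for x using Suc \<delta> by simp
        show "real (Suc k) * \<delta> - real k * \<delta> \<le> 1 / (2 * rate)"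
          by (simp add: \<delta>_def[symmetric] algebra_simps)
      qed (use that \<delta> in \<open>auto simp: algebra_simps\<close>)
      then show ?thesis by simp
    qed
    then show ?case using Suc by (metis atLeastAtMost_iff linorder_linear)
  qed
  moreover obtain k where "t \<le> real k * \<delta>"
    using reals_Archimedean3[OF \<delta>] by (meson less_imp_le)
  ultimately show ?thesis using assms by auto
qed

end

section \<open>The symbol\<close>

text \<open>The tail is \<open>z ^ M\<close> times the shifted series, which is again entire and
  hence bounded on a compact interval.\<close>

lemma eval_fps_tail_bound:
  fixes F :: "real fps"
  assumes "fps_conv_radius F = \<infinity>"
  shows "\<exists>C\<ge>0. \<forall>z. \<bar>z\<bar> \<le> R \<longrightarrow> \<bar>eval_fps F z - (\<Sum>n<M. fps_nth F n * z ^ n)\<bar> \<le> C * \<bar>z\<bar> ^ M"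
proof -
  let ?G = "fps_shift M F"
  have "continuous_on {-R..R} (eval_fps ?G)"
    by (rule continuous_on_subset[OF continuous_on_eval_fps]) (auto simp: assms)
  then have "bounded (eval_fps ?G ` {-R..R})"
    by (intro compact_imp_bounded compact_continuous_image) auto
  then obtain C where C: "C > 0" "\<And>z. z \<in> {-R..R} \<Longrightarrow> \<bar>eval_fps ?G z\<bar> \<le> C"
    unfolding bounded_pos by auto
  have "\<bar>eval_fps F z - (\<Sum>n<M. fps_nth F n * z ^ n)\<bar> \<le> C * \<bar>z\<bar> ^ M" if z: "\<bar>z\<bar> \<le> R" for z
  proof -
    have "(\<lambda>n. fps_nth F n * z ^ n) sums eval_fps F z"
      by (rule sums_eval_fps) (simp add: assms)
    then have 1: "(\<lambda>n. fps_nth F (n + M) * z ^ (n + M)) sums (eval_fps F z - (\<Sum>n<M. fps_nth F n * z ^ n))"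
      by (subst sums_iff_shift) simp
    have "(\<lambda>n. fps_nth ?G n * z ^ n) sums eval_fps ?G z"
      by (rule sums_eval_fps) (simp add: assms)
    then have 2: "(\<lambda>n. z ^ M * (fps_nth ?G n * z ^ n)) sums (z ^ M * eval_fps ?G z)"
      by (rule sums_mult)
    have "eval_fps F z - (\<Sum>n<M. fps_nth F n * z ^ n) = z ^ M * eval_fps ?G z"
      by (rule sums_unique2[OF 1]) (use 2 in \<open>simp add: power_add mult_ac\<close>)
    then have "\<bar>eval_fps F z - (\<Sum>n<M. fps_nth F n * z ^ n)\<bar> = \<bar>z\<bar> ^ M * \<bar>eval_fps ?G z\<bar>"
      by (simp add: abs_mult power_abs)
    also have "\<dots> \<le> \<bar>z\<bar> ^ M * C" using z by (intro mult_left_mono C) auto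
    finally show ?thesis by (simp add: mult.commute)
  qed
  then show ?thesis using C(1) by (intro exI[of _ C]) auto
qed

section \<open>Cosine sums as power series in the squared variable\<close>

definition cos_fps :: "nat \<Rightarrow> (nat \<Rightarrow> real) \<Rightarrow> real fps" where
  "cos_fps N d = Abs_fps (\<lambda>k. (-1) ^ k / fact (2 * k) * (\<Sum>\<nu>=1..N. d \<nu> * real \<nu> ^ (2 * k)))"

lemma cos_fps_sums: "(\<lambda>k. fps_nth (cos_fps N d) k * (\<theta>\<^sup>2) ^ k) sums (\<Sum>\<nu>=1..N. d \<nu> * cos (real \<nu> * \<theta>))"
proof -
  have "(\<lambda>k. \<Sum>\<nu>=1..N. d \<nu> * ((-1) ^ k / fact (2 * k) * (real \<nu> * \<theta>) ^ (2 * k))) sums (\<Sum>\<nu>=1..N. d \<nu> * cos (real \<nu> * \<theta>))"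
    by (intro sums_sum sums_mult cos_paired)
  also have "(\<lambda>k. \<Sum>\<nu>=1..N. d \<nu> * ((-1) ^ k / fact (2 * k) * (real \<nu> * \<theta>) ^ (2 * k)))
      = (\<lambda>k. fps_nth (cos_fps N d) k * (\<theta>\<^sup>2) ^ k)"
    by (simp add: cos_fps_def fun_eq_iff sum_distrib_left sum_distrib_right power_mult_distrib mult_ac flip: power_mult)
  finally show ?thesis .
qed

text \<open>Convergence at the point \<open>\<bar>r\<bar>\<close> is the cosine series at
  \<open>sqrt \<bar>r\<bar>\<close>. Only nonnegative points are squares, but they already determine
  the radius.\<close>

lemma fps_conv_radius_cos_fps: "fps_conv_radius (cos_fps N d) = \<infinity>"
proof -
  have "ereal r \<le> fps_conv_radius (cos_fps N d)" for r
  proof -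
    have "summable (\<lambda>k. fps_nth (cos_fps N d) k * \<bar>r\<bar> ^ k)"
      using sums_summable[OF cos_fps_sums[of N d "sqrt \<bar>r\<bar>"]] by simp
    then have "ereal (norm \<bar>r\<bar>) \<le> fps_conv_radius (cos_fps N d)"
      unfolding fps_conv_radius_def by (rule conv_radius_geI)
    then show ?thesis by (rule order_trans[rotated]) simp
  qed
  then show ?thesis by (intro ereal_top) auto
qed

lemma eval_cos_fps: "eval_fps (cos_fps N d) (\<theta>\<^sup>2) = (\<Sum>\<nu>=1..N. d \<nu> * cos (real \<nu> * \<theta>))"
  by (rule sums_unique2[OF sums_eval_fps cos_fps_sums]) (simp add: fps_conv_radius_cos_fps)

text \<open>These are the Chebyshev polynomials of the first kind, built by their three-term
  recurrence.\<close>

lemma cos_multiple_poly: "\<exists>p :: real poly. degree p \<le> \<nu> \<and> (\<forall>\<theta>. poly p (cos \<theta>) = cos (real \<nu> * \<theta>))"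
proof (induction \<nu> rule: induct_nat_012)
  case 0
  show ?case by (intro exI[of _ 1]) simp
next
  case 1
  show ?case by (intro exI[of _ "[:0, 1:]"]) simp
next
  case (ge2 \<nu>)
  then obtain p q where p: "degree p \<le> \<nu>" "\<And>\<theta>. poly p (cos \<theta>) = cos (real \<nu> * \<theta>)"
    and q: "degree q \<le> Suc \<nu>" "\<And>\<theta>. poly q (cos \<theta>) = cos (real (Suc \<nu>) * \<theta>)" by blast
  have "degree ([:0, 2:] * q - p) \<le> Suc (Suc \<nu>)"
    using degree_mult_le[of "[:0, 2:]" q] p q by (intro degree_diff_le) auto
  moreover have "poly ([:0, 2:] * q - p) (cos \<theta>) = cos (real (Suc (Suc \<nu>)) * \<theta>)" for \<theta>
  proof -
    have "cos (real (Suc \<nu>) * \<theta> + \<theta>) + cos (real (Suc \<nu>) * \<theta> - \<theta>) = 2 * cos \<theta> * cos (real (Suc \<nu>) * \<theta>)"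
      by (simp only: cos_add cos_diff) simp
    then show ?thesis using p(2)[of \<theta>] q(2)[of \<theta>] by (simp add: algebra_simps)
  qed
  ultimately show ?case by blast
qed

text \<open>Since \<open>1 - cos \<theta>\<close> behaves like \<open>\<theta>^2 / 2\<close>, a zero
  of \<open>q\<close> of order \<open>k\<close> at 1 makes \<open>poly q (cos \<theta>)\<close>
  vanish to order exactly \<open>2 * k\<close>. The hypothesis forces order at least
  \<open>N\<close>, and the degree leaves room for nothing but a constant factor.\<close>

lemma cos_poly_vanishing_order:
  fixes q :: "real poly"
  assumes deg: "degree q \<le> N" and small: "\<And>\<theta>. \<bar>\<theta>\<bar> \<le> 1 \<Longrightarrow> \<bar>poly q (cos \<theta>)\<bar> \<le> C * \<theta> ^ (2 * N)"
  shows "\<exists>\<kappa>. \<forall>x. poly q x = \<kappa> * (1 - x) ^ N"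
proof (cases "q = 0")
  case True
  then show ?thesis by (intro exI[of _ 0]) simp
next
  case False
  define k where "k = order 1 q"
  obtain r where r: "q = [:-1, 1:] ^ k * r" "\<not> [:-1, 1:] dvd r"
    using order_decomp[OF False, of 1] by (auto simp: k_def)
  have r1: "poly r 1 \<noteq> 0" using r(2) by (simp add: poly_eq_0_iff_dvd)
  have "k \<ge> N"
  proof (rule ccontr)
    assume "\<not> k \<ge> N"
    then have kN: "k < N" by simp
    \<comment> \<open>If \<open>k < N\<close>, dividing the assumed bound by
      \<open>(1 - cos \<theta>) ^ k\<close> leaves the surplus factor
      \<open>\<theta> ^ (2 * (N - k))\<close>, so the cofactor \<open>r\<close> would vanish at
      1.\<close>
    have lim0: "((\<lambda>\<theta>::real. \<theta>\<^sup>2 / (1 - cos \<theta>)) \<longlongrightarrow> 2) (at_right 0)" by real_asymp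
    have "((\<lambda>\<theta>. C * ((\<theta>\<^sup>2 / (1 - cos \<theta>)) ^ k * \<theta> ^ (2 * (N - k)))) \<longlongrightarrow> C * (2 ^ k * 0 ^ (2 * (N - k)))) (at_right 0)"
      by (intro tendsto_mult tendsto_power tendsto_const lim0 tendsto_ident_at)
    then have "((\<lambda>\<theta>. C * ((\<theta>\<^sup>2 / (1 - cos \<theta>)) ^ k * \<theta> ^ (2 * (N - k)))) \<longlongrightarrow> 0) (at_right 0)"
      using kN by (simp add: power_0_left)
    moreover have "\<forall>\<^sub>F \<theta> in at_right 0. norm (poly r (cos \<theta>)) \<le> C * ((\<theta>\<^sup>2 / (1 - cos \<theta>)) ^ k * \<theta> ^ (2 * (N - k)))"
      unfolding eventually_at_right_field
    proof (intro exI[of _ 1] conjI allI impI)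
      fix \<theta> :: real assume \<theta>: "0 < \<theta>" "\<theta> < 1"
      have c: "1 - cos \<theta> > 0"
        using \<theta> cos_monotone_0_pi[of 0 \<theta>] pi_gt3 by simp
      have "(1 - cos \<theta>) ^ k * \<bar>poly r (cos \<theta>)\<bar> = \<bar>poly q (cos \<theta>)\<bar>"
        using c by (simp add: r(1) abs_mult poly_power power_abs)
      also have "\<dots> \<le> C * \<theta> ^ (2 * N)" using \<theta> by (intro small) auto
      also have "\<theta> ^ (2 * N) = (\<theta>\<^sup>2) ^ k * \<theta> ^ (2 * (N - k))"
        using kN by (simp flip: power_mult power_add add: algebra_simps)
      finally show "norm (poly r (cos \<theta>)) \<le> C * ((\<theta>\<^sup>2 / (1 - cos \<theta>)) ^ k * \<theta> ^ (2 * (N - k)))"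
        using c by (simp add: power_divide field_simps)
    qed simp
    ultimately have "((\<lambda>\<theta>. poly r (cos \<theta>)) \<longlongrightarrow> 0) (at_right 0)"
      by (rule Lim_null_comparison[rotated])
    moreover have "((\<lambda>\<theta>. poly r (cos \<theta>)) \<longlongrightarrow> poly r (cos 0)) (at_right 0)"
      by (intro tendsto_intros)
    ultimately have "poly r (cos 0) = 0"
      using tendsto_unique trivial_limit_at_right_real by blast
    then show False using r1 by simp
  qed
  moreover have "r \<noteq> 0" using r1 by auto
  then have "degree q = k + degree r"
    unfolding r(1) by (subst degree_mult_eq) (auto simp: degree_power_eq)
  ultimately have k: "k = N" "degree r = 0" using deg by auto
  then obtain \<rho> where \<rho>: "r = [:\<rho>:]" by (meson degree_eq_zeroE)
  have "poly q x = \<rho> * (-1) ^ N * (1 - x) ^ N" for x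
    by (simp add: r(1) k \<rho> poly_power flip: power_mult_distrib)
  then show ?thesis by blast
qed

section \<open>Power series, monotonicity and lower bound of the symbol\<close>

locale stencil =
  fixes N :: nat and a :: "nat \<Rightarrow> real"
  assumes N_pos: "N \<ge> 1" and coeffs: "stencil_coeffs N a"
begin

lemma moment_2: "(\<Sum>\<nu>=1..N. a \<nu> * real \<nu> ^ 2) = 1"
  using coeffs by (simp add: stencil_coeffs_def)

lemma moment_0: "2 \<le> m \<Longrightarrow> m \<le> N \<Longrightarrow> (\<Sum>\<nu>=1..N. a \<nu> * real \<nu> ^ (2 * m)) = 0"
  using coeffs by (simp add: stencil_coeffs_def)

text \<open>This is the series E in
  \<open>symb N a \<theta> = \<theta>^2 * (1 - E(\<theta>^2))\<close>, the relative deviation of the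
  symbol from that of the continuous Laplacian.\<close>

definition symb_fps :: "real fps" where
  "symb_fps = Abs_fps (\<lambda>n. if N \<le> n then b_coeff N a n else 0)"

text \<open>The formula for \<open>b_coeff\<close> reproduces the shifted cosine coefficients at
  every index. By the moment conditions they equal -1 at index 0 and 0 at the indices 1 to
  \<open>N - 1\<close>, so adding 1 leaves exactly the part from \<open>N\<close> on.\<close>

lemma symb_fps_eq: "symb_fps = fps_shift 1 (fps_const 2 * cos_fps N a) + 1"
proof (rule fps_ext)
  fix n
  have 0: "b_coeff N a n = fps_nth (fps_shift 1 (fps_const 2 * cos_fps N a)) n"
    by (simp add: b_coeff_def cos_fps_def)
  have "b_coeff N a 0 = -1" using moment_2 by (simp add: b_coeff_def)
  moreover have "b_coeff N a n = 0" if "n < N" "n \<noteq> 0"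
    using moment_0[of "n + 1"] that by (simp add: b_coeff_def)
  ultimately show "fps_nth symb_fps n = fps_nth (fps_shift 1 (fps_const 2 * cos_fps N a) + 1) n"
    using N_pos unfolding fps_add_nth 0[symmetric] by (auto simp: symb_fps_def)
qed

lemma fps_conv_radius_symb_fps: "fps_conv_radius symb_fps = \<infinity>"
proof -
  have "fps_conv_radius (fps_shift 1 (fps_const 2 * cos_fps N a)) = \<infinity>"
    using fps_conv_radius_mult[of "fps_const 2" "cos_fps N a"]
    by (simp add: fps_conv_radius_cos_fps fps_conv_radius_cmult_left)
  then show ?thesis
    using fps_conv_radius_add[of "fps_shift 1 (fps_const 2 * cos_fps N a)" 1] by (simp add: symb_fps_eq)
qed

lemma symb_eq: "symb N a \<theta> = \<theta>\<^sup>2 - \<theta>\<^sup>2 * eval_fps symb_fps (\<theta>\<^sup>2)"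
proof -
  let ?F = "fps_const 2 * cos_fps N a"
  have rad: "fps_conv_radius ?F = \<infinity>" by (simp add: fps_conv_radius_cos_fps fps_conv_radius_cmult_left)
  have "(\<lambda>n. fps_nth ?F n * (\<theta>\<^sup>2) ^ n) sums eval_fps ?F (\<theta>\<^sup>2)"
    by (rule sums_eval_fps) (simp add: rad)
  then have "(\<lambda>n. fps_nth ?F (Suc n) * (\<theta>\<^sup>2) ^ Suc n) sums (eval_fps ?F (\<theta>\<^sup>2) - fps_nth ?F 0)"
    by (subst sums_Suc_iff) simp
  moreover have "(\<lambda>n. \<theta>\<^sup>2 * (fps_nth (fps_shift 1 ?F) n * (\<theta>\<^sup>2) ^ n)) sums (\<theta>\<^sup>2 * eval_fps (fps_shift 1 ?F) (\<theta>\<^sup>2))"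
    by (intro sums_mult sums_eval_fps) (simp add: rad)
  then have "(\<lambda>n. fps_nth ?F (Suc n) * (\<theta>\<^sup>2) ^ Suc n) sums (\<theta>\<^sup>2 * eval_fps (fps_shift 1 ?F) (\<theta>\<^sup>2))"
    by (simp add: mult_ac)
  ultimately have "\<theta>\<^sup>2 * eval_fps (fps_shift 1 ?F) (\<theta>\<^sup>2) = eval_fps ?F (\<theta>\<^sup>2) - fps_nth ?F 0"
    by (rule sums_unique2[rotated])
  also have "eval_fps ?F (\<theta>\<^sup>2) = 2 * (\<Sum>\<nu>=1..N. a \<nu> * cos (real \<nu> * \<theta>))"
    by (simp add: eval_fps_mult fps_conv_radius_cos_fps eval_cos_fps)
  also have "fps_nth ?F 0 = 2 * (\<Sum>\<nu>=1..N. a \<nu>)" by (simp add: cos_fps_def)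
  finally have "\<theta>\<^sup>2 * eval_fps (fps_shift 1 ?F) (\<theta>\<^sup>2) = - symb N a \<theta>"
    by (simp add: symb_def right_diff_distrib sum_subtractf)
  moreover have "eval_fps symb_fps (\<theta>\<^sup>2) = eval_fps (fps_shift 1 ?F) (\<theta>\<^sup>2) + 1"
    unfolding symb_fps_eq by (subst eval_fps_add) (auto simp: rad)
  ultimately show ?thesis by (simp add: algebra_simps)
qed

text \<open>The Cauchy product for a power sums over all tuples with total \<open>n\<close>. A tuple
  with an entry below \<open>N\<close> contributes a zero factor, so restricting to the tuples of
  \<open>c_coeff\<close> changes nothing.\<close>

lemma c_coeff_eq: "c_coeff N a n m = fps_nth (symb_fps ^ m) n"
proof -
  have "fps_nth (symb_fps ^ m) n = (\<Sum>ls\<in>natpermute n m. prod_list (map (fps_nth symb_fps) ls))"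
  proof (cases m)
    case 0
    moreover have "natpermute n 0 = (if n = 0 then {[]} else {})" by (auto simp: natpermute_def)
    ultimately show ?thesis by simp
  next
    case (Suc k)
    have "fps_nth (symb_fps ^ m) n = (\<Sum>v\<in>natpermute n m. \<Prod>j = 0..k. fps_nth symb_fps (v ! j))"
      unfolding Suc by (subst fps_power_nth_Suc) simp
    also have "\<dots> = (\<Sum>ls\<in>natpermute n m. prod_list (map (fps_nth symb_fps) ls))"
      by (intro sum.cong refl)
         (auto simp: natpermute_def Suc prod.list_conv_set_nth atLeastLessThanSuc_atLeastAtMost intro!: prod.cong)
    finally show ?thesis .
  qed
  also have "\<dots> = (\<Sum>ls\<in>{ls. length ls = m \<and> (\<forall>l\<in>set ls. N \<le> l) \<and> sum_list ls = n}. prod_list (map (b_coeff N a) ls))"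
  proof (rule sum.mono_neutral_cong_right)
    show "finite (natpermute n m)" by (rule natpermute_finite)
    show "{ls. length ls = m \<and> (\<forall>l\<in>set ls. N \<le> l) \<and> sum_list ls = n} \<subseteq> natpermute n m"
      by (auto simp: natpermute_def)
    show "\<forall>ls\<in>natpermute n m - {ls. length ls = m \<and> (\<forall>l\<in>set ls. N \<le> l) \<and> sum_list ls = n}.
       prod_list (map (fps_nth symb_fps) ls) = 0"
      by (auto simp: natpermute_def prod_list_zero_iff symb_fps_def not_le image_iff)
    show "prod_list (map (fps_nth symb_fps) ls) = prod_list (map (b_coeff N a) ls)"
      if "ls \<in> {ls. length ls = m \<and> (\<forall>l\<in>set ls. N \<le> l) \<and> sum_list ls = n}" for ls
      using that by (intro arg_cong[where f = prod_list] map_cong) (auto simp: symb_fps_def)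
  qed
  finally show ?thesis by (simp add: c_coeff_def)
qed

lemma c_coeff_eq_0: "n < m * N \<Longrightarrow> c_coeff N a n m = 0"
proof -
  assume n: "n < m * N"
  have "length ls * N \<le> sum_list ls" if "\<forall>l\<in>set ls. N \<le> l" for ls :: "nat list"
    using that by (induction ls) auto
  then have "{ls. length ls = m \<and> (\<forall>l\<in>set ls. N \<le> l) \<and> sum_list ls = n} = {}"
    using n by fastforce
  then show ?thesis unfolding c_coeff_def by (simp only: sum.empty)
qed

lemma symb_minus: "symb N a (- \<theta>) = symb N a \<theta>"
  by (simp add: symb_def)

lemma symb_0 [simp]: "symb N a 0 = 0"
  by (simp add: symb_def)

lemma symb_continuous: "continuous_on S (symb N a)"
  unfolding symb_def by (intro continuous_intros)

lemma symb_near_0: "\<exists>C\<ge>0. \<forall>\<theta>. \<bar>\<theta>\<bar> \<le> pi \<longrightarrow> \<bar>eval_fps symb_fps (\<theta>\<^sup>2)\<bar> \<le> C * \<theta>\<^sup>2"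
proof -
  obtain C where C: "C \<ge> 0" "\<And>z. \<bar>z\<bar> \<le> pi\<^sup>2 \<Longrightarrow> \<bar>eval_fps symb_fps z - (\<Sum>n<1. fps_nth symb_fps n * z ^ n)\<bar> \<le> C * \<bar>z\<bar> ^ 1"
    using eval_fps_tail_bound[OF fps_conv_radius_symb_fps] by blast
  have "fps_nth symb_fps 0 = 0" using N_pos by (simp add: symb_fps_def)
  then have "\<bar>eval_fps symb_fps (\<theta>\<^sup>2)\<bar> \<le> C * \<theta>\<^sup>2" if "\<bar>\<theta>\<bar> \<le> pi" for \<theta>
    using C(2)[of "\<theta>\<^sup>2"] that abs_le_square_iff[of \<theta> pi] by simp
  then show ?thesis using C(1) by blast
qed

definition symb' :: "real \<Rightarrow> real" where
  "symb' \<theta> = 2 * (\<Sum>\<nu>=1..N. a \<nu> * real \<nu> * sin (real \<nu> * \<theta>))"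

definition symb'' :: "real \<Rightarrow> real" where
  "symb'' \<theta> = 2 * (\<Sum>\<nu>=1..N. a \<nu> * real \<nu> ^ 2 * cos (real \<nu> * \<theta>))"

lemma symb_deriv: "(symb N a has_real_derivative symb' \<theta>) (at \<theta>)"
  unfolding symb_def[abs_def] symb'_def
  by (auto intro!: derivative_eq_intros sum.cong simp: algebra_simps)

lemma symb'_deriv: "(symb' has_real_derivative symb'' \<theta>) (at \<theta>)"
  unfolding symb'_def[abs_def] symb''_def
  by (auto intro!: derivative_eq_intros sum.cong simp: algebra_simps power2_eq_square)

text \<open>\<open>2 - symb''\<close> is a polynomial of degree at most \<open>N\<close> in \<open>cos \<theta>\<close> and vanishes to order \<open>2 N\<close> at \<open>0\<close>.\<close>

lemma symb''_eq: "\<exists>\<kappa>. \<forall>\<theta>. symb'' \<theta> = 2 - \<kappa> * (1 - cos \<theta>) ^ N"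
proof -
  obtain T :: "nat \<Rightarrow> real poly" where T: "\<And>\<nu>. degree (T \<nu>) \<le> \<nu>" "\<And>\<nu> \<theta>. poly (T \<nu>) (cos \<theta>) = cos (real \<nu> * \<theta>)"
    using cos_multiple_poly by metis
  define q where "q = [:2:] - (\<Sum>\<nu>=1..N. smult (2 * a \<nu> * real \<nu> ^ 2) (T \<nu>))"
  have q: "poly q (cos \<theta>) = 2 - symb'' \<theta>" for \<theta>
    by (simp add: q_def poly_sum T symb''_def sum_distrib_left mult_ac)
  define F where "F = cos_fps N (\<lambda>\<nu>. 2 * a \<nu> * real \<nu> ^ 2)"
  obtain C where C: "\<And>z. \<bar>z\<bar> \<le> 1 \<Longrightarrow> \<bar>eval_fps F z - (\<Sum>n<N. fps_nth F n * z ^ n)\<bar> \<le> C * \<bar>z\<bar> ^ N"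
    using eval_fps_tail_bound[of F 1 N] by (auto simp: F_def fps_conv_radius_cos_fps)
  \<comment> \<open>The weight \<open>\<nu>^2\<close> shifts the moments by one: coefficient 0 is
    twice the second moment, and the coefficients 1 to \<open>N - 1\<close> are multiples of the
    vanishing moments of orders 4 to \<open>2 * N\<close>.\<close>
  have "(\<Sum>n<N. fps_nth F n * z ^ n) = (\<Sum>n<N. if n = 0 then 2 else 0)" for z
  proof (intro sum.cong refl)
    fix n assume "n \<in> {..<N}"
    moreover have "(\<Sum>\<nu>=1..N. 2 * a \<nu> * real \<nu> ^ 2 * real \<nu> ^ (2 * n)) = 2 * (\<Sum>\<nu>=1..N. a \<nu> * real \<nu> ^ (2 * (n + 1)))"
    proof -
      have "real \<nu> ^ (2 * (n + 1)) = real \<nu> ^ 2 * real \<nu> ^ (2 * n)" for \<nu> by (simp flip: power_add)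
      then show ?thesis by (simp only: sum_distrib_left mult.assoc)
    qed
    ultimately show "fps_nth F n * z ^ n = (if n = 0 then 2 else 0)"
      using moment_0[of "n + 1"] moment_2 by (cases "n = 0") (simp_all add: F_def cos_fps_def)
  qed
  then have sum: "(\<Sum>n<N. fps_nth F n * z ^ n) = 2" for z using N_pos by (simp add: sum.delta)
  have "eval_fps F (\<theta>\<^sup>2) = symb'' \<theta>" for \<theta>
    unfolding F_def eval_cos_fps by (simp add: symb''_def sum_distrib_left mult_ac)
  then have "\<bar>poly q (cos \<theta>)\<bar> \<le> C * \<theta> ^ (2 * N)" if "\<bar>\<theta>\<bar> \<le> 1" for \<theta>
    using C[of "\<theta>\<^sup>2"] that by (simp add: sum q power_mult abs_minus_commute abs_square_le_1)
  moreover have "degree q \<le> N"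
    unfolding q_def by (intro degree_diff_le degree_sum_le) (auto intro: order_trans[OF degree_smult_le] order_trans[OF T(1)])
  ultimately obtain \<kappa> where "\<forall>x. poly q x = \<kappa> * (1 - x) ^ N"
    using cos_poly_vanishing_order by blast
  then have "symb'' \<theta> = 2 - \<kappa> * (1 - cos \<theta>) ^ N" for \<theta> using q[of \<theta>] by simp
  then show ?thesis by blast
qed

text \<open>\<open>symb'\<close> is concave on \<open>[0, \<pi>]\<close> and vanishes at both ends.\<close>

lemma symb'_nonneg:
  assumes "0 \<le> \<theta>" "\<theta> \<le> pi" shows "symb' \<theta> \<ge> 0"
proof -
  obtain \<kappa> where \<kappa>: "\<And>\<theta>. symb'' \<theta> = 2 - \<kappa> * (1 - cos \<theta>) ^ N" using symb''_eq by blast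
  have ends: "symb' 0 = 0" "symb' pi = 0" by (simp_all add: symb'_def)
  \<comment> \<open>Otherwise \<open>symb''\<close> is positive everywhere and \<open>symb'\<close>
    increases strictly between its two zeros 0 and \<open>pi\<close>.\<close>
  have "\<kappa> > 0"
  proof (rule ccontr)
    assume "\<not> \<kappa> > 0"
    then have "symb'' \<theta> > 0" for \<theta>
      using mult_nonneg_nonneg[of "- \<kappa>" "(1 - cos \<theta>) ^ N"] by (simp add: \<kappa>)
    then have "symb' 0 < symb' pi"
      by (intro DERIV_pos_imp_increasing[OF pi_gt_zero]) (meson symb'_deriv)
    then show False using ends by simp
  qed
  have "convex_on {0..pi} (\<lambda>\<theta>. - symb' \<theta>)"
  proof (rule f''_ge0_imp_convex)
    show "((\<lambda>\<theta>. - symb' \<theta>) has_real_derivative - symb'' \<theta>) (at \<theta>)" for \<theta>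
      by (intro DERIV_minus symb'_deriv)
    show "((\<lambda>\<theta>. - symb'' \<theta>) has_real_derivative \<kappa> * (real N * (1 - cos \<theta>) ^ (N - 1) * sin \<theta>)) (at \<theta>)" for \<theta>
      unfolding \<kappa> by (auto intro!: derivative_eq_intros)
    show "\<kappa> * (real N * (1 - cos \<theta>) ^ (N - 1) * sin \<theta>) \<ge> 0" if "\<theta> \<in> {0..pi}" for \<theta>
      using that \<open>\<kappa> > 0\<close> by (intro mult_nonneg_nonneg) (auto intro: sin_ge_zero)
  qed simp
  from convex_onD[OF this, of "\<theta> / pi" 0 pi] assms ends show ?thesis by simp
qed

lemma symb_mono:
  assumes "0 \<le> \<theta>" "\<theta> \<le> \<theta>'" "\<theta>' \<le> pi" shows "symb N a \<theta> \<le> symb N a \<theta>'"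
  by (rule DERIV_nonneg_imp_nondecreasing[OF assms(2)])
     (use assms in \<open>auto intro!: exI[of _ "symb' _"] symb_deriv symb'_nonneg\<close>)

text \<open>Close to 0 the relative deviation of the symbol from \<open>\<theta>^2\<close> is at
  most 1/2. Beyond \<open>\<delta>\<close> monotonicity keeps the symbol above its value at
  \<open>\<delta>\<close>, while \<open>\<theta>^2\<close> stays below \<open>pi^2\<close>. The
  bound \<open>c \<le> 1\<close> is recorded so that \<open>exp (- \<xi>^2)\<close> is also
  dominated by \<open>exp (- c * \<xi>^2)\<close>.\<close>

lemma symb_lower_bound: "\<exists>c>0. c \<le> 1 \<and> (\<forall>\<theta>. \<bar>\<theta>\<bar> \<le> pi \<longrightarrow> c * \<theta>\<^sup>2 \<le> symb N a \<theta>)"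
proof -
  obtain C where C: "C \<ge> 0" "\<And>\<theta>. \<bar>\<theta>\<bar> \<le> pi \<Longrightarrow> \<bar>eval_fps symb_fps (\<theta>\<^sup>2)\<bar> \<le> C * \<theta>\<^sup>2"
    using symb_near_0 by blast
  \<comment> \<open>Chosen to make \<open>C * \<delta>^2 \<le> 1 / 2\<close>; the 1 added to
    \<open>C\<close> avoids a division by zero.\<close>
  define \<delta> where "\<delta> = min pi (sqrt (1 / (2 * (C + 1))))"
  have \<delta>: "\<delta> > 0" "\<delta> \<le> pi" using C(1) by (auto simp: \<delta>_def)
  have "\<delta>\<^sup>2 \<le> (sqrt (1 / (2 * (C + 1))))\<^sup>2" using \<delta> by (intro power_mono) (auto simp: \<delta>_def)
  then have \<delta>2: "\<delta>\<^sup>2 \<le> 1 / (2 * (C + 1))" using C(1) by simp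
  have near: "\<theta>\<^sup>2 / 2 \<le> symb N a \<theta>" if "0 \<le> \<theta>" "\<theta> \<le> \<delta>" for \<theta>
  proof -
    have "\<bar>eval_fps symb_fps (\<theta>\<^sup>2)\<bar> \<le> C * \<theta>\<^sup>2" using that \<delta> by (intro C) auto
    also have "\<dots> \<le> C * (1 / (2 * (C + 1)))"
      using power_mono[OF that(2,1), of 2] \<delta>2 C(1) by (intro mult_left_mono) auto
    also have "\<dots> \<le> 1 / 2" using C(1) by (simp add: field_simps)
    finally have "\<theta>\<^sup>2 * eval_fps symb_fps (\<theta>\<^sup>2) \<le> \<theta>\<^sup>2 * (1 / 2)" by (intro mult_left_mono) auto
    then show ?thesis by (simp add: symb_eq)
  qed
  define c where "c = min (1 / 2) (\<delta>\<^sup>2 / (2 * pi\<^sup>2))"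
  have pos: "c * \<theta>\<^sup>2 \<le> symb N a \<theta>" if "0 \<le> \<theta>" "\<theta> \<le> pi" for \<theta>
  proof (cases "\<theta> \<le> \<delta>")
    case True
    have "c * \<theta>\<^sup>2 \<le> 1 / 2 * \<theta>\<^sup>2" by (intro mult_right_mono) (auto simp: c_def)
    then show ?thesis using near[OF that(1) True] by simp
  next
    case False
    have "c * \<theta>\<^sup>2 \<le> \<delta>\<^sup>2 / (2 * pi\<^sup>2) * pi\<^sup>2"
      using that by (intro mult_mono power_mono) (auto simp: c_def)
    also have "\<dots> = \<delta>\<^sup>2 / 2" by simp
    also have "\<dots> \<le> symb N a \<delta>" using \<delta> by (intro near) auto
    also have "\<dots> \<le> symb N a \<theta>" using \<delta> False that by (intro symb_mono) auto
    finally show ?thesis .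
  qed
  have "c * \<theta>\<^sup>2 \<le> symb N a \<theta>" if "\<bar>\<theta>\<bar> \<le> pi" for \<theta>
    using pos[of "\<bar>\<theta>\<bar>"] that symb_minus[of \<theta>] by (cases "\<theta> \<ge> 0") auto
  moreover have "c > 0" using \<delta> by (auto simp: c_def)
  moreover have "c \<le> 1 / 2" unfolding c_def by (rule min.cobounded1)
  then have "c \<le> 1" by simp
  ultimately show ?thesis by blast
qed

end

section \<open>Gaussian integrals and profile functions\<close>

text \<open>A remainder of size \<open>(z - y)^2 * B x\<close> integrates to a multiple of
  \<open>(z - y)^2\<close>, so the difference quotient is off by
  \<open>O(\<bar>z - y\<bar>)\<close>. Working within \<open>S\<close> gives one-sided derivatives
  as well, as needed at time 0.\<close>

lemma has_derivative_integral_quadratic: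
  fixes f :: "real \<Rightarrow> 'a \<Rightarrow> real"
  assumes int: "\<And>y. y \<in> S \<Longrightarrow> integrable M (f y)" and "integrable M g" "integrable M B" and y: "y \<in> S"
    and le: "\<And>z x. z \<in> S \<Longrightarrow> x \<in> space M \<Longrightarrow> \<bar>f z x - f y x - (z - y) * g x\<bar> \<le> (z - y)^2 * B x"
  shows "((\<lambda>y. \<integral>x. f y x \<partial>M) has_real_derivative (\<integral>x. g x \<partial>M)) (at y within S)"
proof -
  define C where "C = (\<integral>x. B x \<partial>M)"
  have le': "\<bar>(\<integral>x. f z x \<partial>M) - (\<integral>x. f y x \<partial>M) - (z - y) * (\<integral>x. g x \<partial>M)\<bar> \<le> (z - y)^2 * C"
    if z: "z \<in> S" for z
  proof -
    have "\<bar>\<integral>x. f z x - f y x - (z - y) * g x \<partial>M\<bar> \<le> (\<integral>x. (z - y)^2 * B x \<partial>M)"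
    proof (rule order_trans[OF integral_abs_bound integral_mono])
      show "integrable M (\<lambda>x. \<bar>f z x - f y x - (z - y) * g x\<bar>)"
        using int[OF z] int[OF y] assms(2) by simp
    qed (use le z assms(3) in auto)
    then show ?thesis using int[OF z] int[OF y] assms(2,3) by (simp add: C_def)
  qed
  have "((\<lambda>z. ((\<integral>x. f z x \<partial>M) - (\<integral>x. f y x \<partial>M)) / (z - y)) \<longlongrightarrow> (\<integral>x. g x \<partial>M)) (at y within S)"
  proof (rule LIM_zero_cancel, rule tendsto_rabs_zero_cancel, rule tendsto_sandwich)
    show "\<forall>\<^sub>F z in at y within S. 0 \<le> \<bar>((\<integral>x. f z x \<partial>M) - (\<integral>x. f y x \<partial>M)) / (z - y) - (\<integral>x. g x \<partial>M)\<bar>"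
      by simp
    show "\<forall>\<^sub>F z in at y within S. \<bar>((\<integral>x. f z x \<partial>M) - (\<integral>x. f y x \<partial>M)) / (z - y) - (\<integral>x. g x \<partial>M)\<bar> \<le> \<bar>z - y\<bar> * C"
      unfolding eventually_at_topological
    proof (intro exI[of _ UNIV] conjI ballI impI)
      fix z assume z: "z \<noteq> y" "z \<in> S"
      have "\<bar>((\<integral>x. f z x \<partial>M) - (\<integral>x. f y x \<partial>M)) / (z - y) - (\<integral>x. g x \<partial>M)\<bar>
          = \<bar>((\<integral>x. f z x \<partial>M) - (\<integral>x. f y x \<partial>M)) - (z - y) * (\<integral>x. g x \<partial>M)\<bar> / \<bar>z - y\<bar>"
        using z by (simp add: diff_divide_distrib flip: abs_divide)
      also have "\<dots> \<le> (z - y)^2 * C / \<bar>z - y\<bar>"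
        using le'[OF z(2)] by (intro divide_right_mono) auto
      also have "\<dots> = \<bar>z - y\<bar> * C" using z by (simp add: power2_eq_square field_simps abs_if)
      finally show "\<bar>((\<integral>x. f z x \<partial>M) - (\<integral>x. f y x \<partial>M)) / (z - y) - (\<integral>x. g x \<partial>M)\<bar> \<le> \<bar>z - y\<bar> * C" .
    qed auto
    have "((\<lambda>z. \<bar>z - y\<bar> * C) \<longlongrightarrow> \<bar>y - y\<bar> * C) (at y within S)" by (intro tendsto_intros)
    then show "((\<lambda>z. \<bar>z - y\<bar> * C) \<longlongrightarrow> 0) (at y within S)" by simp
  qed auto
  then show ?thesis by (simp add: has_field_derivative_iff)
qed

lemma cos_quadratic_bound: "\<bar>cos (x + d) - cos x + d * sin x\<bar> \<le> d\<^sup>2" for x d :: real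
proof -
  have "norm (cos (x + d + real 0 * (pi / 2)) - (\<Sum>i\<le>1. cos (x + real i * (pi / 2)) * ((x + d) - x) ^ i / fact i))
      \<le> 1 * norm ((x + d) - x) ^ Suc 1 / fact 1"
    by (rule field_Taylor[where f = "\<lambda>i x. cos (x + real i * (pi / 2))" and S = UNIV])
       (auto intro!: derivative_eq_intros simp: minus_sin_cos_eq algebra_simps add_divide_distrib)
  then show ?thesis by (simp add: power2_eq_square cos_add algebra_simps)
qed

section \<open>Gaussian Fourier integrals\<close>

lemma integrable_gaussian_moment:
  assumes "c > 0" shows "integrable lborel (\<lambda>\<xi>::real. \<xi> ^ k * exp (- c * \<xi>\<^sup>2))"
proof -
  have "integrable lborel (\<lambda>x. normal_density 0 (1 / sqrt (2 * c)) x * (x - 0) ^ k)"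
    using assms by (intro integrable_normal_moment) auto
  then have "integrable lborel (\<lambda>x. sqrt (pi / c) * (normal_density 0 (1 / sqrt (2 * c)) x * (x - 0) ^ k))"
    by (rule integrable_mult_right)
  moreover have "sqrt (pi / c) * (normal_density 0 (1 / sqrt (2 * c)) x * (x - 0) ^ k) = x ^ k * exp (- c * x\<^sup>2)" for x
  proof -
    have "sqrt (pi / c) * normal_density 0 (1 / sqrt (2 * c)) x = exp (- c * x\<^sup>2)"
      using assms by (simp add: normal_density_def power_divide real_sqrt_divide mult_ac)
    then show ?thesis by (simp add: mult_ac)
  qed
  ultimately show ?thesis by (simp only:)
qed

lemma integrable_poly_gaussian:
  assumes "c > 0" shows "integrable lborel (\<lambda>\<xi>::real. poly p \<xi> * exp (- c * \<xi>\<^sup>2))"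
proof -
  have "integrable lborel (\<lambda>\<xi>. \<Sum>i\<le>degree p. coeff p i * (\<xi> ^ i * exp (- c * \<xi>\<^sup>2)))"
    by (intro Bochner_Integration.integrable_sum integrable_mult_right integrable_gaussian_moment assms)
  then show ?thesis by (simp add: poly_altdef sum_distrib_right mult.assoc)
qed

text \<open>The characteristic function of the standard normal law at \<open>y / sqrt 2\<close>;
  scaling the variable by \<open>sqrt 2\<close> turns the normal density into
  \<open>exp (- x^2)\<close>.\<close>

lemma gaussian_fourier:
  "(\<integral>\<xi>. exp (- \<xi>\<^sup>2) * cos (y * \<xi>) \<partial>lborel) = sqrt pi * exp (- (y\<^sup>2) / 4)"
proof -
  define t where "t = y / sqrt 2"
  have "integrable std_normal_distribution (\<lambda>x. iexp (t * x))"
    using real_dist_normal_dist by (intro prob_space.integrable_iexp) (auto simp: real_distribution_def)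
  then have "(\<integral>x. Re (iexp (t * x)) \<partial>std_normal_distribution) = Re (char std_normal_distribution t)"
    unfolding char_def by simp
  also have "Re (char std_normal_distribution t) = exp (- (t^2) / 2)"
    unfolding char_std_normal_distribution by simp
  also have "(\<integral>x. Re (iexp (t * x)) \<partial>std_normal_distribution) = (\<integral>x. std_normal_density x * cos (t * x) \<partial>lborel)"
    by (subst integral_density) (auto simp: Re_exp)
  also have "\<dots> = sqrt 2 * (\<integral>x. std_normal_density (sqrt 2 * x) * cos (y * x) \<partial>lborel)"
    by (subst lborel_integral_real_affine[of "sqrt 2" _ 0]) (auto simp: t_def)
  also have "\<dots> = (\<integral>x. exp (- x\<^sup>2) * cos (y * x) \<partial>lborel) / sqrt pi"
    by (simp add: normal_density_def power_mult_distrib real_sqrt_mult flip: integral_divide_zero integral_mult_right_zero)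
  finally show ?thesis by (simp add: t_def power_divide field_simps)
qed

text \<open>The \<open>j\<close>-th derivative of the inverse Fourier transform of
  \<open>p(\<xi>) * exp (- \<xi>^2)\<close> for even \<open>p\<close>. Each derivative in
  \<open>y\<close> brings down a factor \<open>\<xi>\<close> and advances the phase by
  \<open>pi / 2\<close>, so one formula covers all derivatives without alternating signs, sines and
  cosines.\<close>

definition gauss_int :: "real poly \<Rightarrow> nat \<Rightarrow> real \<Rightarrow> real" where
  "gauss_int p j y = 1 / (2 * pi) * (\<integral>\<xi>. poly p \<xi> * \<xi> ^ j * exp (- \<xi>\<^sup>2) * cos (y * \<xi> + real j * (pi / 2)) \<partial>lborel)"

lemma integrable_gauss_weight: "integrable lborel (\<lambda>\<xi>. poly p \<xi> * \<xi> ^ j * exp (- \<xi>\<^sup>2) :: real)"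
  using integrable_poly_gaussian[of 1 "p * monom 1 j"] by (simp add: poly_monom)

lemma integrable_gauss_int:
  "integrable lborel (\<lambda>\<xi>. poly p \<xi> * \<xi> ^ j * exp (- \<xi>\<^sup>2) * cos (y * \<xi> + b) :: real)"
  by (rule Bochner_Integration.integrable_bound[OF integrable_gauss_weight[of p j]])
     (auto simp: abs_mult intro!: mult_left_le borel_measurable_continuous_onI continuous_intros)

lemma gauss_int_bound: "\<exists>C. \<forall>y. \<bar>gauss_int p j y\<bar> \<le> C"
proof (intro exI allI)
  fix y
  have "\<bar>\<integral>\<xi>. poly p \<xi> * \<xi> ^ j * exp (- \<xi>\<^sup>2) * cos (y * \<xi> + real j * (pi / 2)) \<partial>lborel\<bar>
      \<le> (\<integral>\<xi>. \<bar>poly p \<xi> * \<xi> ^ j * exp (- \<xi>\<^sup>2)\<bar> \<partial>lborel)"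
    by (rule order_trans[OF integral_abs_bound integral_mono[OF integrable_abs[OF integrable_gauss_int]
          integrable_abs[OF integrable_gauss_weight]]])
       (auto simp: abs_mult mult_left_le)
  then show "\<bar>gauss_int p j y\<bar> \<le> 1 / (2 * pi) * (\<integral>\<xi>. \<bar>poly p \<xi> * \<xi> ^ j * exp (- \<xi>\<^sup>2)\<bar> \<partial>lborel)"
    by (simp add: gauss_int_def abs_mult divide_right_mono)
qed

lemma gauss_int_deriv: "(gauss_int p j has_real_derivative gauss_int p (Suc j) y) (at y)"
proof -
  have "((\<lambda>y. \<integral>\<xi>. poly p \<xi> * \<xi> ^ j * exp (- \<xi>\<^sup>2) * cos (y * \<xi> + real j * (pi / 2)) \<partial>lborel) has_real_derivative
     (\<integral>\<xi>. poly p \<xi> * \<xi> ^ Suc j * exp (- \<xi>\<^sup>2) * cos (y * \<xi> + real (Suc j) * (pi / 2)) \<partial>lborel)) (at y within UNIV)"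
  proof (rule has_derivative_integral_quadratic)
    show "integrable lborel (\<lambda>\<xi>. \<bar>poly p \<xi> * \<xi> ^ (j + 2) * exp (- \<xi>\<^sup>2)\<bar>)"
      by (intro integrable_abs integrable_gauss_weight)
    fix z \<xi> :: real
    let ?P = "poly p \<xi> * \<xi> ^ j * exp (- \<xi>\<^sup>2)" and ?x = "y * \<xi> + real j * (pi / 2)" and ?d = "(z - y) * \<xi>"
    have "\<bar>?P * (cos (?x + ?d) - cos ?x + ?d * sin ?x)\<bar> \<le> \<bar>?P\<bar> * ?d^2"
      unfolding abs_mult by (intro mult_left_mono cos_quadratic_bound) auto
    also have "?x + ?d = z * \<xi> + real j * (pi / 2)" by (simp add: algebra_simps)
    also have "sin ?x = - cos (y * \<xi> + real (Suc j) * (pi / 2))"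
      using cos_add[of ?x "pi / 2"] by (simp add: distrib_right add.assoc add_divide_distrib add.commute[of "pi / 2"])
    also have "\<bar>?P\<bar> * ?d^2 = (z - y)\<^sup>2 * \<bar>poly p \<xi> * \<xi> ^ (j + 2) * exp (- \<xi>\<^sup>2)\<bar>"
      by (simp add: abs_mult power_mult_distrib power2_eq_square)
    finally show "\<bar>poly p \<xi> * \<xi> ^ j * exp (- \<xi>\<^sup>2) * cos (z * \<xi> + real j * (pi / 2)) -
        poly p \<xi> * \<xi> ^ j * exp (- \<xi>\<^sup>2) * cos (y * \<xi> + real j * (pi / 2)) -
        (z - y) * (poly p \<xi> * \<xi> ^ Suc j * exp (- \<xi>\<^sup>2) * cos (y * \<xi> + real (Suc j) * (pi / 2)))\<bar>
       \<le> (z - y)\<^sup>2 * \<bar>poly p \<xi> * \<xi> ^ (j + 2) * exp (- \<xi>\<^sup>2)\<bar>"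
      by (simp add: algebra_simps)
  qed (auto simp only: integrable_gauss_int UNIV_I)
  then show ?thesis unfolding gauss_int_def[abs_def] by (intro DERIV_cmult) simp
qed

lemma heat_profile_eq_gauss_int: "heat_profile = gauss_int 1 0"
proof
  fix y
  show "heat_profile y = gauss_int 1 0 y"
    using gaussian_fourier[of y] by (simp add: heat_profile_def gauss_int_def field_simps)
qed

lemma higher_deriv_heat_profile: "(deriv ^^ k) heat_profile = gauss_int 1 k"
  by (induction k) (auto simp: heat_profile_eq_gauss_int intro!: ext DERIV_imp_deriv gauss_int_deriv)

text \<open>The phase advance of \<open>k\<close> derivatives corresponds to the factor
  \<open>\<i> ^ k\<close>, which \<open>(- \<i>) ^ k\<close> undoes. For odd \<open>k\<close> the
  factor is purely imaginary and has no real part.\<close>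

lemma Re_minus_ii_power_times_cos:
  "Re ((- \<i>) ^ k) * cos (x + real k * (pi / 2)) = (if even k then cos x else 0)"
proof (cases "even k")
  case True
  then obtain j where k: "k = 2 * j" by (elim evenE)
  have "cos (x + real j * pi) = (-1) ^ j * cos x" by (simp add: cos_add)
  moreover have "(- \<i>) ^ k = complex_of_real ((-1) ^ j)" by (simp add: k power_mult)
  ultimately show ?thesis using k by (simp flip: power_mult_distrib)
next
  case False
  then obtain j where k: "k = 2 * j + 1" by (elim oddE)
  have "(- \<i>) ^ k = complex_of_real ((-1) ^ j) * (- \<i>)" by (simp add: k power_mult)
  then show ?thesis using False by simp
qed

text \<open>On the Fourier side -i d/dy is multiplication by \<open>\<xi>\<close>, so the operator
  places the polynomial in front of the Gaussian.\<close>

lemma poly_D_heat_profile: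
  assumes "\<And>k. odd k \<Longrightarrow> coeff p k = 0"
  shows "Re (poly_D p heat_profile y) = gauss_int p 0 y"
proof -
  have "Re (poly_D p heat_profile y) = (\<Sum>k\<le>degree p. coeff p k * (Re ((- \<i>) ^ k) * gauss_int 1 k y))"
    by (simp add: poly_D_def higher_deriv_heat_profile mult.assoc)
  also have "\<dots> = (\<Sum>k\<le>degree p. 1 / (2 * pi) * (\<integral>\<xi>. coeff p k * \<xi> ^ k * exp (- \<xi>\<^sup>2) * cos (y * \<xi>) \<partial>lborel))"
  proof (rule sum.cong[OF refl])
    fix k
    have "coeff p k * Re ((- \<i>) ^ k) * cos (y * \<xi> + real k * (pi / 2)) = coeff p k * cos (y * \<xi>)" for \<xi>
      using assms[of k] Re_minus_ii_power_times_cos[of k "y * \<xi>"] by (auto simp: mult.assoc)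
    then have eq: "\<xi> ^ k * exp (- \<xi>\<^sup>2) * (coeff p k * Re ((- \<i>) ^ k) * cos (y * \<xi> + real k * (pi / 2)))
      = \<xi> ^ k * exp (- \<xi>\<^sup>2) * (coeff p k * cos (y * \<xi>))" for \<xi> by simp
    have "coeff p k * (Re ((- \<i>) ^ k) * gauss_int 1 k y) =
       1 / (2 * pi) * (\<integral>\<xi>. \<xi> ^ k * exp (- \<xi>\<^sup>2) * (coeff p k * Re ((- \<i>) ^ k) * cos (y * \<xi> + real k * (pi / 2))) \<partial>lborel)"
      unfolding gauss_int_def by (simp add: mult_ac flip: integral_mult_right_zero)
    then show "coeff p k * (Re ((- \<i>) ^ k) * gauss_int 1 k y) =
        1 / (2 * pi) * (\<integral>\<xi>. coeff p k * \<xi> ^ k * exp (- \<xi>\<^sup>2) * cos (y * \<xi>) \<partial>lborel)"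
      unfolding eq by (simp add: mult_ac)
  qed
  also have "\<dots> = 1 / (2 * pi) * (\<integral>\<xi>. (\<Sum>k\<le>degree p. coeff p k * \<xi> ^ k * exp (- \<xi>\<^sup>2) * cos (y * \<xi>)) \<partial>lborel)"
  proof -
    have "integrable lborel (\<lambda>\<xi>. coeff p k * \<xi> ^ k * exp (- \<xi>\<^sup>2) * cos (y * \<xi>))" for k
      using integrable_gauss_int[of "[:coeff p k:]" k y 0] by simp
    then show ?thesis by (subst Bochner_Integration.integral_sum) (auto simp: sum_distrib_left)
  qed
  also have "\<dots> = gauss_int p 0 y"
    by (simp add: gauss_int_def poly_altdef sum_distrib_right)
  finally show ?thesis .
qed

lemma coeff_P_poly_odd: "odd k \<Longrightarrow> coeff (P_poly N a n) k = 0"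
  by (auto simp: P_poly_def coeff_sum intro!: sum.neutral)

lemma h0_fun_eq_gauss_int: "h0_fun N a n = gauss_int (P_poly N a n) 0"
  by (simp add: h0_fun_def fun_eq_iff poly_D_heat_profile coeff_P_poly_odd)

lemma gauss_int_continuous: "continuous_on S (gauss_int p j)"
  by (rule DERIV_continuous_on) (auto intro: has_field_derivative_at_within gauss_int_deriv)

section \<open>One-sided derivatives and the continuation to 0\<close>

lemma hderiv_eq:
  fixes F :: "nat \<Rightarrow> real \<Rightarrow> real"
  assumes eq: "\<And>y. y \<ge> 0 \<Longrightarrow> f y = F 0 y"
    and F: "\<And>i y. y \<ge> 0 \<Longrightarrow> (F i has_real_derivative F (Suc i) y) (at y within {0..})"
    and y: "y \<ge> 0"
  shows "hderiv j f y = F j y"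
  using y
proof (induction j arbitrary: y)
  case 0
  then show ?case using eq by (simp add: hderiv_def)
next
  case (Suc j)
  have "(F j has_vector_derivative F (Suc j) y) (at y within {0..})"
    using F[OF Suc.prems, of j] by (simp add: has_real_derivative_iff_has_vector_derivative)
  then have "(hderiv j f has_vector_derivative F (Suc j) y) (at y within {0..})"
    by (rule has_vector_derivative_transform[rotated 2]) (use Suc in auto)
  \<comment> \<open>The one-sided derivative is unique only because \<open>{0..}\<close> accumulates
    at \<open>y\<close>, which includes the end point 0.\<close>
  moreover have "at y within {0..} \<noteq> bot"
    using at_le[of "{y<..}" "{0..}" y] Suc.prems trivial_limit_at_right_real[of y]
    by (auto simp: bot_unique subset_eq)
  ultimately have "vector_derivative (hderiv j f) (at y within {0..}) = F (Suc j) y"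
    by (intro vector_derivative_within)
  then show ?case by (simp add: hderiv_def)
qed

text \<open>A continuous \<open>G\<close> that agrees with \<open>F\<close> for positive
  \<open>y\<close> supplies the limit at 0 by which the extension is defined.\<close>

lemma extend_at_0_eq:
  assumes "\<And>y. y > 0 \<Longrightarrow> F y = G y" "continuous_on {0..} G" "y \<ge> 0"
  shows "extend_at_0 F y = G y"
proof (cases "y = 0")
  case True
  have "(G \<longlongrightarrow> G 0) (at 0 within {0..})"
    using assms(2) by (simp add: continuous_on_def)
  then have "(G \<longlongrightarrow> G 0) (at_right 0)"
    by (rule tendsto_within_subset) auto
  then have "(F \<longlongrightarrow> G 0) (at_right 0)"
    by (rule tendsto_cong[THEN iffD2, rotated]) (auto simp: eventually_at_filter assms(1))
  then show ?thesis using True by (auto simp: extend_at_0_def intro: tendsto_Lim)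
next
  case False
  then show ?thesis using assms by (simp add: extend_at_0_def)
qed

lemma has_integral_FTC_real:
  fixes F f :: "real \<Rightarrow> real"
  assumes "a \<le> b" "\<And>x. a \<le> x \<Longrightarrow> (F has_real_derivative f x) (at x)"
  shows "(f has_integral (F b - F a)) {a..b}"
proof (rule fundamental_theorem_of_calculus[OF assms(1)])
  fix x assume "x \<in> {a..b}"
  then have "(F has_real_derivative f x) (at x within {a..b})"
    using assms(2)[of x] by (simp add: has_field_derivative_at_within)
  then show "(F has_vector_derivative f x) (at x within {a..b})"
    by (simp only: has_real_derivative_iff_has_vector_derivative)
qed

section \<open>The profile functions and their derivatives\<close>

definition heat_tail :: "real \<Rightarrow> real" where
  "heat_tail y = 1 / 2 - (LBINT \<rho>=0..y. heat_profile \<rho>)"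

text \<open>Integrating \<open>heat_profile \<rho> / \<rho>^2\<close> by parts, with h' = -(y/2) h,
  removes the singularity: f0 = 2 h - y H, where H = \<open>heat_tail\<close> is the integral of h
  from y to infinity. Then f0' = -H and f0'' = h, so all higher derivatives are of the form
  \<open>gauss_int\<close>.\<close>

fun f0_deriv :: "nat \<Rightarrow> real \<Rightarrow> real" where
  "f0_deriv 0 y = 2 * heat_profile y - y * heat_tail y"
| "f0_deriv (Suc 0) y = - heat_tail y"
| "f0_deriv (Suc (Suc j)) y = gauss_int 1 j y"

lemma heat_profile_deriv: "(heat_profile has_real_derivative - y / 2 * heat_profile y) (at y)"
  unfolding heat_profile_def[abs_def] by (auto intro!: derivative_eq_intros simp: field_simps)

lemma heat_profile_continuous: "continuous_on S heat_profile"
  unfolding heat_profile_def[abs_def] by (intro continuous_intros) auto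

lemma heat_tail_deriv: "(heat_tail has_real_derivative - heat_profile y) (at y)"
proof -
  have "((\<lambda>y. LBINT \<rho>=ereal 0..ereal y. heat_profile \<rho>) has_vector_derivative heat_profile y)
      (at y within {- \<bar>y\<bar> - 1..\<bar>y\<bar> + 1})"
    by (rule interval_integral_FTC2) (auto intro: heat_profile_continuous)
  also have "at y within {- \<bar>y\<bar> - 1..\<bar>y\<bar> + 1} = at y"
    by (intro at_within_interior) (auto simp: interior_atLeastAtMost_real)
  finally have "((\<lambda>y. LBINT \<rho>=0..ereal y. heat_profile \<rho>) has_real_derivative heat_profile y) (at y)"
    by (simp add: has_real_derivative_iff_has_vector_derivative zero_ereal_def)
  then show ?thesis unfolding heat_tail_def[abs_def] zero_ereal_def by (auto intro!: derivative_eq_intros)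
qed

lemma f0_deriv_deriv: "(f0_deriv j has_real_derivative f0_deriv (Suc j) y) (at y)"
proof -
  consider "j = 0" | "j = 1" | i where "j = Suc (Suc i)" by (metis One_nat_def not0_implies_Suc)
  then show ?thesis
  proof cases
    case 1
    have "((\<lambda>y. 2 * heat_profile y - y * heat_tail y) has_real_derivative - heat_tail y) (at y)"
      by (auto intro!: derivative_eq_intros heat_profile_deriv heat_tail_deriv)
    moreover have "f0_deriv 0 = (\<lambda>y. 2 * heat_profile y - y * heat_tail y)" by (simp add: fun_eq_iff)
    ultimately show ?thesis using 1 by simp
  next
    case 2
    have "((\<lambda>y. - heat_tail y) has_real_derivative heat_profile y) (at y)"
      by (auto intro!: derivative_eq_intros heat_tail_deriv)
    moreover have "f0_deriv (Suc 0) = (\<lambda>y. - heat_tail y)" by (simp add: fun_eq_iff)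
    ultimately show ?thesis using 2 by (simp add: heat_profile_eq_gauss_int)
  next
    case 3
    have "f0_deriv (Suc (Suc i)) = gauss_int 1 i" by (simp add: fun_eq_iff)
    then show ?thesis using 3 gauss_int_deriv[of 1 i y] by simp
  qed
qed

lemma heat_tail_tendsto: "(heat_tail \<longlongrightarrow> 0) at_top"
proof -
  \<comment> \<open>Scaling by 2 turns \<open>heat_profile\<close> into a multiple of
    \<open>exp (- x^2)\<close>, whose integral over the half-line is
    \<open>sqrt pi / 2\<close>.\<close>
  have "has_bochner_integral lborel (\<lambda>x. indicator {0..} (0 + 2 * x) *\<^sub>R heat_profile (0 + 2 * x))
      (1 / (2 * sqrt pi) * (sqrt pi / 2))"
    by (rule has_bochner_integral_cong[THEN iffD1, OF refl _ refl has_bochner_integral_mult_right[OF gaussian_moment_0]])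
       (auto simp: heat_profile_def indicator_def power2_eq_square)
  then have "has_bochner_integral lborel (\<lambda>x. indicator {0..} x *\<^sub>R heat_profile x) (1 / 2)"
    using lborel_has_bochner_integral_real_affine_iff[of 2 "\<lambda>x. indicator {0..} x *\<^sub>R heat_profile x" "1 / 2" 0]
    by simp
  then have int: "set_integrable lborel {0..} heat_profile" "set_lebesgue_integral lborel {0..} heat_profile = 1 / 2"
    by (auto simp: has_bochner_integral_iff set_integrable_def set_lebesgue_integral_def)
  have "((\<lambda>y. 1 / 2 - set_lebesgue_integral lborel {0..y} heat_profile) \<longlongrightarrow> 1 / 2 - 1 / 2) at_top"
    using tendsto_set_lebesgue_integral_at_top[OF _ int(1)] int(2) by (intro tendsto_intros) auto
  then have "((\<lambda>y. 1 / 2 - set_lebesgue_integral lborel {0..y} heat_profile) \<longlongrightarrow> 0) at_top" by simp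
  moreover have "\<forall>\<^sub>F y in at_top. 1 / 2 - set_lebesgue_integral lborel {0..y} heat_profile = heat_tail y"
    using eventually_ge_at_top[of 0]
    by eventually_elim (simp add: heat_tail_def interval_integral_Icc zero_ereal_def)
  ultimately show ?thesis by (rule Lim_transform_eventually)
qed

lemma f0_integral:
  assumes "y > 0"
  shows "2 * y * integral {y..} (\<lambda>\<rho>. heat_profile \<rho> / \<rho>\<^sup>2) = f0_deriv 0 y"
proof -
  \<comment> \<open>The antiderivative from integration by parts, normalised to vanish at
    infinity.\<close>
  define G where "G \<rho> = - heat_profile \<rho> / \<rho> + heat_tail \<rho> / 2" for \<rho>
  have G: "(G has_real_derivative heat_profile \<rho> / \<rho>\<^sup>2) (at \<rho>)" if "\<rho> \<ge> y" for \<rho>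
  proof -
    have "\<rho> \<noteq> 0" using that assms by simp
    have "((\<lambda>\<rho>. - heat_profile \<rho> / \<rho> + heat_tail \<rho> / 2) has_real_derivative
       ((- (- \<rho> / 2 * heat_profile \<rho>)) * \<rho> - (- heat_profile \<rho>) * 1) / (\<rho> * \<rho>) + (- heat_profile \<rho>) / 2) (at \<rho>)"
      by (rule DERIV_add[OF DERIV_divide[OF DERIV_minus[OF heat_profile_deriv] DERIV_ident \<open>\<rho> \<noteq> 0\<close>]
            DERIV_cdivide[OF heat_tail_deriv]])
    then show ?thesis
      unfolding G_def[abs_def] by (rule DERIV_cong) (use \<open>\<rho> \<noteq> 0\<close> in \<open>simp add: power2_eq_square add_divide_distrib\<close>)
  qed
  have FTC: "((\<lambda>\<rho>. heat_profile \<rho> / \<rho>\<^sup>2) has_integral (G z - G y)) {y..z}" if "y \<le> z" for z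
    by (rule has_integral_FTC_real[OF that G])
  have h0: "(heat_profile \<longlongrightarrow> 0) at_top"
  proof -
    have "((\<lambda>y::real. exp (- (y\<^sup>2) / 4)) \<longlongrightarrow> 0) at_top" by real_asymp
    from tendsto_mult_left[OF this, of "1 / (2 * sqrt pi)"] show ?thesis
      by (simp add: heat_profile_def[abs_def])
  qed
  have "((\<lambda>\<rho>. heat_profile \<rho> / \<rho>\<^sup>2) has_integral (0 - G y)) {y..}"
  proof (rule has_integral_to_inf)
    show "(\<lambda>\<rho>. heat_profile \<rho> / \<rho>\<^sup>2) integrable_on {y..z}" for z
      by (cases "y \<le> z") (auto intro: has_integral_integrable[OF FTC])
    have "((\<lambda>\<rho>. - (heat_profile \<rho> * inverse \<rho>) + heat_tail \<rho> * (1 / 2)) \<longlongrightarrow> - (0 * 0) + 0 * (1 / 2)) at_top"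
      by (rule tendsto_add[OF tendsto_minus[OF tendsto_mult[OF h0 tendsto_inverse_0_at_top[OF filterlim_ident]]]
            tendsto_mult_right[OF heat_tail_tendsto]])
    moreover have "(\<lambda>\<rho>. - (heat_profile \<rho> * inverse \<rho>) + heat_tail \<rho> * (1 / 2)) = G"
      by (rule ext) (simp add: G_def field_simps)
    ultimately have "(G \<longlongrightarrow> 0) at_top" by simp
    then have "((\<lambda>z. G z - G y) \<longlongrightarrow> 0 - G y) at_top" by (intro tendsto_diff tendsto_const)
    moreover have "\<forall>\<^sub>F z in at_top. G z - G y = integral {y..z} (\<lambda>\<rho>. heat_profile \<rho> / \<rho>\<^sup>2)"
      using eventually_ge_at_top[of y] by eventually_elim (simp add: integral_unique[OF FTC])
    ultimately show "((\<lambda>z. integral {y..z} (\<lambda>\<rho>. heat_profile \<rho> / \<rho>\<^sup>2)) \<longlongrightarrow> 0 - G y) at_top"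
      by (rule Lim_transform_eventually)
  qed (simp add: heat_profile_def)
  then have "integral {y..} (\<lambda>\<rho>. heat_profile \<rho> / \<rho>\<^sup>2) = - G y"
    by (simp add: integral_unique)
  then show ?thesis using assms by (simp add: G_def field_simps)
qed

lemma f0_fun_eq: "y \<ge> 0 \<Longrightarrow> f0_fun y = f0_deriv 0 y"
  unfolding f0_fun_def
  by (rule extend_at_0_eq)
     (auto simp: f0_integral intro!: DERIV_continuous_on has_field_derivative_at_within[OF f0_deriv_deriv] simp del: f0_deriv.simps)

lemma hderiv_f0_fun: "y \<ge> 0 \<Longrightarrow> hderiv j f0_fun y = f0_deriv j y"
  by (rule hderiv_eq) (auto simp: f0_fun_eq intro: has_field_derivative_at_within[OF f0_deriv_deriv] simp del: f0_deriv.simps)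

lemma g0_fun_eq: "y \<ge> 0 \<Longrightarrow> g0_fun y = - heat_tail y"
  using hderiv_f0_fun[of y 1] by (simp add: g0_fun_def)

text \<open>The substitution \<open>\<rho> = y \<sigma>\<close> removes the singularity of \<open>f_fun\<close> at \<open>0\<close>.\<close>

definition f_deriv :: "real poly \<Rightarrow> nat \<Rightarrow> nat \<Rightarrow> real \<Rightarrow> real" where
  "f_deriv p n j y = - 2 * integral {0..1} (\<lambda>\<sigma>. \<sigma> ^ (2 * n - 2 + j) * gauss_int p j (y * \<sigma>))"

lemma f_deriv_integrable: "(\<lambda>\<sigma>. \<sigma> ^ k * gauss_int p j (y * \<sigma>)) integrable_on {a..b}"
  by (intro integrable_continuous_real continuous_intros continuous_on_compose2[OF gauss_int_continuous]) auto

lemma f_deriv_deriv: "(f_deriv p n j has_real_derivative f_deriv p n (Suc j) y) (at y)"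
proof -
  have "((\<lambda>y. integral (cbox 0 1) (\<lambda>\<sigma>. \<sigma> ^ (2 * n - 2 + j) * gauss_int p j (y * \<sigma>))) has_field_derivative
      integral (cbox 0 1) (\<lambda>\<sigma>. \<sigma> ^ (2 * n - 2 + Suc j) * gauss_int p (Suc j) (y * \<sigma>))) (at y within UNIV)"
  proof (rule leibniz_rule_field_derivative)
    show "((\<lambda>y. \<sigma> ^ (2 * n - 2 + j) * gauss_int p j (y * \<sigma>)) has_real_derivative
        \<sigma> ^ (2 * n - 2 + Suc j) * gauss_int p (Suc j) (y * \<sigma>)) (at y within UNIV)" for y \<sigma>
    proof -
      have "((\<lambda>y. y * \<sigma>) has_real_derivative \<sigma>) (at y)" by (auto intro!: derivative_eq_intros)
      from DERIV_cmult[OF DERIV_chain2[OF gauss_int_deriv this], of "\<sigma> ^ (2 * n - 2 + j)"]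
      show ?thesis by (simp add: mult_ac)
    qed
    show "continuous_on (UNIV \<times> cbox 0 1) (\<lambda>(y, \<sigma>). \<sigma> ^ (2 * n - 2 + Suc j) * gauss_int p (Suc j) (y * \<sigma>))"
      unfolding split_def by (intro continuous_intros continuous_on_compose2[OF gauss_int_continuous[of UNIV]]) auto
  qed (auto simp: f_deriv_integrable)
  then show ?thesis unfolding f_deriv_def[abs_def] by (intro DERIV_cmult) simp
qed

lemma f_deriv_bound: "\<exists>C. \<forall>y. \<bar>f_deriv p n j y\<bar> \<le> C"
proof -
  obtain C where C: "\<And>y. \<bar>gauss_int p j y\<bar> \<le> C" using gauss_int_bound by blast
  have "\<bar>f_deriv p n j y\<bar> \<le> 2 * C" for y
  proof -
    have "norm (integral {0..1} (\<lambda>\<sigma>. \<sigma> ^ (2 * n - 2 + j) * gauss_int p j (y * \<sigma>))) \<le> C * (1 - 0)"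
    proof (rule integral_bound)
      show "norm (\<sigma> ^ (2 * n - 2 + j) * gauss_int p j (y * \<sigma>)) \<le> C" if "\<sigma> \<in> {0..1}" for \<sigma>
      proof -
        have "\<bar>\<sigma> ^ (2 * n - 2 + j)\<bar> * \<bar>gauss_int p j (y * \<sigma>)\<bar> \<le> 1 * C"
          using that C by (intro mult_mono) (auto simp: power_le_one)
        then show ?thesis by (simp add: abs_mult)
      qed
    qed (auto intro!: continuous_intros continuous_on_compose2[OF gauss_int_continuous[of UNIV]])
    then show ?thesis by (simp add: f_deriv_def)
  qed
  then show ?thesis by blast
qed

text \<open>This makes \<open>t\<^bsup>1/2-n\<^esup> f\<^sub>n (x / sqrt t)\<close> an antiderivative in \<open>t\<close> of \<open>t\<^bsup>-1/2-n\<^esup> h\<^sub>0\<^sub>n (x / sqrt t)\<close>.\<close>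

lemma f_deriv_euler:
  assumes "n \<ge> 1"
  shows "(2 * real n - 1) * f_deriv p n 0 y + y * f_deriv p n 1 y = - 2 * gauss_int p 0 y"
proof -
  obtain m where n: "n = Suc m" using assms not0_implies_Suc[of n] by auto
  have pow: "((\<lambda>\<sigma>. \<sigma> ^ (2 * n - 1)) has_real_derivative (2 * real n - 1) * \<sigma> ^ (2 * n - 2)) (at \<sigma>)" for \<sigma> :: real
    using DERIV_pow[of "2 * n - 1" \<sigma>] by (simp add: n)
  \<comment> \<open>This is the derivative in \<open>\<sigma>\<close> of
    \<open>\<sigma> ^ (2 * n - 1) * gauss_int p 0 (y * \<sigma>)\<close>, which is
    \<open>gauss_int p 0 y\<close> at 1 and vanishes at 0 since the exponent is positive.\<close>
  let ?d = "\<lambda>\<sigma>. (2 * real n - 1) * (\<sigma> ^ (2 * n - 2) * gauss_int p 0 (y * \<sigma>)) +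
      y * (\<sigma> ^ (2 * n - 2 + 1) * gauss_int p 1 (y * \<sigma>))"
  have D: "((\<lambda>\<sigma>. \<sigma> ^ (2 * n - 1) * gauss_int p 0 (y * \<sigma>)) has_real_derivative ?d \<sigma>) (at \<sigma>)" for \<sigma>
  proof -
    have "((\<lambda>\<sigma>. y * \<sigma>) has_real_derivative y) (at \<sigma>)" by (auto intro!: derivative_eq_intros)
    from DERIV_mult[OF pow DERIV_chain2[OF gauss_int_deriv this]]
    show ?thesis by (rule DERIV_cong) (simp add: n algebra_simps)
  qed
  have "(?d has_integral (1 ^ (2 * n - 1) * gauss_int p 0 (y * 1) - 0 ^ (2 * n - 1) * gauss_int p 0 (y * 0))) {0..1}"
    by (rule has_integral_FTC_real[OF zero_le_one D])
  then have "integral {0..1} ?d = gauss_int p 0 y" by (simp add: integral_unique n)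
  also have "integral {0..1} ?d = (2 * real n - 1) * integral {0..1} (\<lambda>\<sigma>. \<sigma> ^ (2 * n - 2) * gauss_int p 0 (y * \<sigma>))
      + y * integral {0..1} (\<lambda>\<sigma>. \<sigma> ^ (2 * n - 2 + 1) * gauss_int p 1 (y * \<sigma>))"
    by (subst Henstock_Kurzweil_Integration.integral_add)
       (auto intro!: integrable_continuous_real continuous_intros continuous_on_compose2[OF gauss_int_continuous[of UNIV]])
  finally show ?thesis by (simp add: f_deriv_def algebra_simps)
qed

text \<open>Instead of substituting, the two sides are compared through derivatives: by
  \<open>f_deriv_euler\<close>, \<open>\<rho> ^ (2 * n - 1) * f_deriv p n 0 \<rho>\<close> is an
  antiderivative of -2 times the integrand.\<close>

lemma f_integral:
  assumes "y > 0" "n \<ge> 1"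
  shows "- (2 / y ^ (2 * n - 1)) * integral {0..y} (\<lambda>\<rho>. \<rho> ^ (2 * n - 2) * gauss_int p 0 \<rho>) = f_deriv p n 0 y"
proof -
  obtain m where n: "n = Suc m" using assms not0_implies_Suc[of n] by auto
  have pow: "((\<lambda>\<sigma>. \<sigma> ^ (2 * n - 1)) has_real_derivative (2 * real n - 1) * \<sigma> ^ (2 * n - 2)) (at \<sigma>)" for \<sigma> :: real
    using DERIV_pow[of "2 * n - 1" \<sigma>] by (simp add: n)
  have D: "((\<lambda>\<rho>. \<rho> ^ (2 * n - 1) * f_deriv p n 0 \<rho>) has_real_derivative - 2 * (\<rho> ^ (2 * n - 2) * gauss_int p 0 \<rho>)) (at \<rho>)" for \<rho>
  proof -
    have "((\<lambda>\<rho>. \<rho> ^ (2 * n - 1) * f_deriv p n 0 \<rho>) has_real_derivative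
      \<rho> ^ (2 * n - 2) * ((2 * real n - 1) * f_deriv p n 0 \<rho> + \<rho> * f_deriv p n 1 \<rho>)) (at \<rho>)"
      using DERIV_mult[OF pow f_deriv_deriv]
      by (rule DERIV_cong) (simp add: n algebra_simps)
    then show ?thesis unfolding f_deriv_euler[OF assms(2)] by (simp add: mult_ac)
  qed
  have "((\<lambda>\<rho>. - 2 * (\<rho> ^ (2 * n - 2) * gauss_int p 0 \<rho>)) has_integral
     (y ^ (2 * n - 1) * f_deriv p n 0 y - 0 ^ (2 * n - 1) * f_deriv p n 0 0)) {0..y}"
    using assms by (intro has_integral_FTC_real D) simp
  from integral_unique[OF this]
  have "- 2 * integral {0..y} (\<lambda>\<rho>. \<rho> ^ (2 * n - 2) * gauss_int p 0 \<rho>) = y ^ (2 * n - 1) * f_deriv p n 0 y"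
    by (simp add: n)
  then show ?thesis using assms by (simp add: field_simps)
qed

lemma f_fun_eq: "y \<ge> 0 \<Longrightarrow> n \<ge> 1 \<Longrightarrow> f_fun N a n y = f_deriv (P_poly N a n) n 0 y"
  unfolding f_fun_def h0_fun_eq_gauss_int
  by (rule extend_at_0_eq, rule f_integral)
     (auto intro!: DERIV_continuous_on has_field_derivative_at_within[OF f_deriv_deriv])

lemma hderiv_f_fun: "y \<ge> 0 \<Longrightarrow> n \<ge> 1 \<Longrightarrow> hderiv j (f_fun N a n) y = f_deriv (P_poly N a n) n j y"
  by (rule hderiv_eq) (auto simp: f_fun_eq intro: has_field_derivative_at_within[OF f_deriv_deriv])

section \<open>Expansion of the rescaled kernel\<close>

text \<open>The factor \<open>exp (max w 0)\<close>, unlike \<open>exp \<bar>w\<bar>\<close>, does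
  not grow for negative \<open>w\<close>. This keeps its product with \<open>exp (- \<xi>^2)\<close>
  below a Gaussian later on.\<close>

lemma exp_remainder_bound:
  "\<bar>exp w - (\<Sum>m\<le>M. w ^ m / fact m)\<bar> \<le> exp (max w 0) * \<bar>w\<bar> ^ (M + 1)" for w :: real
proof -
  have "norm (exp w - (\<Sum>i\<le>M. exp 0 * (w - 0) ^ i / fact i)) \<le> exp (max w 0) * norm (w - 0) ^ Suc M / fact M"
    by (rule field_Taylor[where f = "\<lambda>_. exp" and S = "{min w 0..max w 0}"])
       (auto intro!: has_field_derivative_at_within[OF DERIV_exp])
  also have "\<dots> \<le> exp (max w 0) * norm (w - 0) ^ Suc M / 1"
    by (intro divide_left_mono) auto
  finally show ?thesis by simp
qed

context stencil
begin

lemma c_coeff_0: "c_coeff N a n 0 = (if n = 0 then 1 else 0)"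
  by (simp add: c_coeff_eq)

lemma poly_P_poly:
  assumes "n \<le> M"
  shows "poly (P_poly N a n) \<xi> = (\<Sum>m=1..M. c_coeff N a n m / fact m * \<xi> ^ (2 * (n + m)))"
proof -
  have "poly (P_poly N a n) \<xi> = (\<Sum>m\<in>{m. 1 \<le> m \<and> real m \<le> real n / real N}. c_coeff N a n m / fact m * \<xi> ^ (2 * (n + m)))"
    by (simp add: P_poly_def poly_sum poly_monom)
  also have "\<dots> = (\<Sum>m=1..M. c_coeff N a n m / fact m * \<xi> ^ (2 * (n + m)))"
  proof (rule sum.mono_neutral_left)
    show "{m. 1 \<le> m \<and> real m \<le> real n / real N} \<subseteq> {1..M}"
    proof safe
      fix m assume "1 \<le> m" "real m \<le> real n / real N"
      moreover have "real n / real N \<le> real n / 1" using N_pos by (intro divide_left_mono) auto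
      ultimately show "m \<in> {1..M}" using assms by auto
    qed
    show "\<forall>m\<in>{1..M} - {m. 1 \<le> m \<and> real m \<le> real n / real N}. c_coeff N a n m / fact m * \<xi> ^ (2 * (n + m)) = 0"
    proof
      fix m assume "m \<in> {1..M} - {m. 1 \<le> m \<and> real m \<le> real n / real N}"
      then have "real n < real m * real N" using N_pos by (auto simp: field_simps)
      then have "n < m * N" by (simp only: of_nat_less_iff flip: of_nat_mult)
      then show "c_coeff N a n m / fact m * \<xi> ^ (2 * (n + m)) = 0" by (simp add: c_coeff_eq_0)
    qed
  qed simp
  finally show ?thesis .
qed

lemma poly_P_poly_eq_0: "n < N \<Longrightarrow> poly (P_poly N a n) \<xi> = 0"
  unfolding poly_P_poly[OF order_refl]
  by (intro sum.neutral ballI) (auto intro!: c_coeff_eq_0 elim: less_le_trans)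

text \<open>The truncated double series is regrouped by powers of \<open>1 / t\<close>. The index
  \<open>m = 0\<close> contributes only the leading 1, and the powers with \<open>n < N\<close>
  vanish.\<close>

lemma double_expansion_eq:
  assumes "t \<noteq> 0"
  shows "(\<Sum>m\<le>M. \<Sum>n\<le>M. c_coeff N a n m * \<xi> ^ (2 * (n + m)) / (fact m * t ^ n))
    = 1 + (\<Sum>n=N..M. poly (P_poly N a n) \<xi> / t ^ n)"
proof -
  have "(\<Sum>m\<le>M. c_coeff N a n m * \<xi> ^ (2 * (n + m)) / (fact m * t ^ n))
     = (if n = 0 then 1 else 0) + poly (P_poly N a n) \<xi> / t ^ n" if "n \<le> M" for n
  proof -
    have "{..M} = insert 0 {1..M}" by auto
    then have "(\<Sum>m\<le>M. c_coeff N a n m * \<xi> ^ (2 * (n + m)) / (fact m * t ^ n))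
      = c_coeff N a n 0 * \<xi> ^ (2 * n) / t ^ n + (\<Sum>m=1..M. c_coeff N a n m * \<xi> ^ (2 * (n + m)) / (fact m * t ^ n))"
      by simp
    then show ?thesis
      by (auto simp: poly_P_poly[OF that] c_coeff_0 sum_divide_distrib)
  qed
  then have "(\<Sum>n\<le>M. \<Sum>m\<le>M. c_coeff N a n m * \<xi> ^ (2 * (n + m)) / (fact m * t ^ n))
    = (\<Sum>n\<le>M. (if n = 0 then 1 else 0) + poly (P_poly N a n) \<xi> / t ^ n)"
    by (intro sum.cong) auto
  also have "\<dots> = 1 + (\<Sum>n\<le>M. poly (P_poly N a n) \<xi> / t ^ n)"
    by (simp add: sum.distrib)
  also have "(\<Sum>n\<le>M. poly (P_poly N a n) \<xi> / t ^ n) = (\<Sum>n=N..M. poly (P_poly N a n) \<xi> / t ^ n)"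
    by (rule sum.mono_neutral_right) (auto simp: poly_P_poly_eq_0 not_le)
  finally show ?thesis by (subst sum.swap)
qed

text \<open>With E the series \<open>symb_fps\<close>, the exponent is \<open>- \<xi>^2 + w\<close>
  for \<open>w = \<xi>^2 * E(\<xi>^2 / t)\<close>. Two truncations are made: \<open>exp w\<close>
  after \<open>w ^ M\<close>, where \<open>\<bar>w\<bar> \<le> C * \<xi>^4 / t\<close>, and each
  power of E after \<open>(\<xi>^2 / t) ^ M\<close>. Both remainders are
  \<open>1 / t ^ (M + 1)\<close> times a polynomial in \<open>\<xi>\<close>, the two parts of
  \<open>D\<close>.\<close>

lemma kernel_symbol_expansion_core:
  "\<exists>c>0. \<exists>D::real poly. \<forall>t>0. \<forall>\<xi>. \<bar>\<xi>\<bar> \<le> pi * sqrt t \<longrightarrow>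
     \<bar>exp (- t * symb N a (\<xi> / sqrt t)) - exp (- \<xi>\<^sup>2) * (1 + (\<Sum>n=N..M. poly (P_poly N a n) \<xi> / t ^ n))\<bar>
       \<le> poly D \<xi> * exp (- c * \<xi>\<^sup>2) / t ^ (M + 1)"
proof -
  obtain c where c: "c > 0" "c \<le> 1" "\<And>\<theta>. \<bar>\<theta>\<bar> \<le> pi \<Longrightarrow> c * \<theta>\<^sup>2 \<le> symb N a \<theta>"
    using symb_lower_bound by blast
  obtain C where C: "C \<ge> 0" "\<And>\<theta>. \<bar>\<theta>\<bar> \<le> pi \<Longrightarrow> \<bar>eval_fps symb_fps (\<theta>\<^sup>2)\<bar> \<le> C * \<theta>\<^sup>2"
    using symb_near_0 by blast
  have rad: "fps_conv_radius (symb_fps ^ m) = \<infinity>" for m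
    using fps_conv_radius_power[of symb_fps m] by (simp add: fps_conv_radius_symb_fps)
  have "\<exists>B\<ge>0. \<forall>z. \<bar>z\<bar> \<le> pi\<^sup>2 \<longrightarrow>
      \<bar>eval_fps (symb_fps ^ m) z - (\<Sum>n<Suc M. fps_nth (symb_fps ^ m) n * z ^ n)\<bar> \<le> B * \<bar>z\<bar> ^ Suc M" for m
    using eval_fps_tail_bound[OF rad] by blast
  then obtain B where B: "\<And>m. B m \<ge> 0" "\<And>m z. \<bar>z\<bar> \<le> pi\<^sup>2 \<Longrightarrow>
      \<bar>eval_fps (symb_fps ^ m) z - (\<Sum>n<Suc M. fps_nth (symb_fps ^ m) n * z ^ n)\<bar> \<le> B m * \<bar>z\<bar> ^ Suc M"
    by metis
  define D :: "real poly" where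
    "D = monom (C ^ (M + 1)) (4 * (M + 1)) + (\<Sum>m\<le>M. monom (B m / fact m) (2 * m + 2 * (M + 1)))"
  have "\<bar>exp (- t * symb N a (\<xi> / sqrt t)) - exp (- \<xi>\<^sup>2) * (1 + (\<Sum>n=N..M. poly (P_poly N a n) \<xi> / t ^ n))\<bar>
       \<le> poly D \<xi> * exp (- c * \<xi>\<^sup>2) / t ^ (M + 1)" if t: "t > 0" and \<xi>: "\<bar>\<xi>\<bar> \<le> pi * sqrt t" for t \<xi>
  proof -
    define \<theta> where "\<theta> = \<xi> / sqrt t"
    have \<theta>: "\<bar>\<theta>\<bar> \<le> pi" using \<xi> t by (simp add: \<theta>_def field_simps)
    define z where "z = \<xi>\<^sup>2 / t"
    have z: "\<theta>\<^sup>2 = z" "0 \<le> z" "\<bar>z\<bar> \<le> pi\<^sup>2"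
      using t \<theta> abs_le_square_iff[of \<theta> pi] by (auto simp: \<theta>_def z_def power_divide)
    define E where "E = eval_fps symb_fps z"
    define w where "w = \<xi>\<^sup>2 * E"
    have A: "- t * symb N a \<theta> = - \<xi>\<^sup>2 + w"
      using t unfolding symb_eq z(1) w_def E_def z_def by (simp add: field_simps)
    have E: "\<bar>E\<bar> \<le> C * z" using C(2)[OF \<theta>] z by (simp add: E_def)
    have w: "\<bar>w\<bar> ^ (M + 1) \<le> C ^ (M + 1) * \<xi> ^ (4 * (M + 1)) / t ^ (M + 1)"
    proof -
      have "\<bar>w\<bar> \<le> \<xi>\<^sup>2 * (C * z)" using E by (simp add: w_def abs_mult mult_left_mono)
      also have "\<dots> = C * \<xi> ^ 4 / t" by (simp add: z_def power_numeral_reduce)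
      finally have "\<bar>w\<bar> ^ (M + 1) \<le> (C * \<xi> ^ 4 / t) ^ (M + 1)" by (intro power_mono) auto
      then show ?thesis by (simp only: power_divide power_mult_distrib power_mult)
    qed
    \<comment> \<open>For positive \<open>w\<close> the left side is the kernel itself and the lower
      bound of the symbol applies; for \<open>w \<le> 0\<close> it is
      \<open>exp (- \<xi>^2)\<close>, where \<open>c \<le> 1\<close> suffices.\<close>
    have gauss: "exp (- \<xi>\<^sup>2) * exp (max w 0) \<le> exp (- c * \<xi>\<^sup>2)"
    proof -
      have "c * \<theta>\<^sup>2 \<le> symb N a \<theta>" by (rule c(3)[OF \<theta>])
      then have "t * (c * \<theta>\<^sup>2) \<le> t * symb N a \<theta>" using t by (intro mult_left_mono) auto
      then have "- \<xi>\<^sup>2 + w \<le> - c * \<xi>\<^sup>2" using A t by (simp add: z(1) z_def)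
      moreover have "c * \<xi>\<^sup>2 \<le> 1 * \<xi>\<^sup>2" using c by (intro mult_right_mono) auto
      ultimately show ?thesis unfolding exp_add[symmetric] by (simp add: max_def)
    qed
    have "exp (- \<xi>\<^sup>2) * 1 \<le> exp (- \<xi>\<^sup>2) * exp (max w 0)" by (intro mult_left_mono) auto
    with gauss have gauss': "exp (- \<xi>\<^sup>2) \<le> exp (- c * \<xi>\<^sup>2)" by linarith
    let ?S = "\<Sum>m\<le>M. \<Sum>n\<le>M. c_coeff N a n m * \<xi> ^ (2 * (n + m)) / (fact m * t ^ n)"
    have "\<bar>(\<Sum>m\<le>M. w ^ m / fact m) - ?S\<bar> \<le> (\<Sum>m\<le>M. B m / fact m * \<xi> ^ (2 * m + 2 * (M + 1)) / t ^ (M + 1))"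
      unfolding sum_subtractf[symmetric]
    proof (rule order_trans[OF sum_abs sum_mono])
      fix m
      have "w ^ m / fact m - (\<Sum>n\<le>M. c_coeff N a n m * \<xi> ^ (2 * (n + m)) / (fact m * t ^ n))
        = \<xi> ^ (2 * m) / fact m * (eval_fps (symb_fps ^ m) z - (\<Sum>n<Suc M. fps_nth (symb_fps ^ m) n * z ^ n))"
      proof -
        have "w ^ m / fact m = \<xi> ^ (2 * m) / fact m * eval_fps (symb_fps ^ m) z"
          by (simp add: w_def E_def power_mult_distrib power_mult eval_fps_power fps_conv_radius_symb_fps)
        moreover have "(\<Sum>n\<le>M. c_coeff N a n m * \<xi> ^ (2 * (n + m)) / (fact m * t ^ n))
           = \<xi> ^ (2 * m) / fact m * (\<Sum>n<Suc M. fps_nth (symb_fps ^ m) n * z ^ n)"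
          unfolding lessThan_Suc_atMost sum_distrib_left
          by (intro sum.cong refl) (simp add: c_coeff_eq z_def power_divide power_add distrib_left mult_ac flip: power_mult)
        ultimately show ?thesis by (simp add: right_diff_distrib)
      qed
      then have "\<bar>w ^ m / fact m - (\<Sum>n\<le>M. c_coeff N a n m * \<xi> ^ (2 * (n + m)) / (fact m * t ^ n))\<bar>
        = \<xi> ^ (2 * m) / fact m * \<bar>eval_fps (symb_fps ^ m) z - (\<Sum>n<Suc M. fps_nth (symb_fps ^ m) n * z ^ n)\<bar>"
        by (simp add: abs_mult)
      also have "\<dots> \<le> \<xi> ^ (2 * m) / fact m * (B m * \<bar>z\<bar> ^ Suc M)"
        using z by (intro mult_left_mono B) auto
      also have "\<dots> = B m / fact m * \<xi> ^ (2 * m + 2 * (M + 1)) / t ^ (M + 1)"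
      proof -
        have "\<xi> ^ (2 * m + 2 * (M + 1)) = \<xi> ^ (2 * m) * (\<xi>\<^sup>2) ^ (M + 1)" by (simp only: power_add power_mult)
        moreover have "\<bar>z\<bar> ^ Suc M = (\<xi>\<^sup>2) ^ (M + 1) / t ^ (M + 1)"
          using z(2) by (simp only: z_def power_divide Suc_eq_plus1 abs_of_nonneg)
        ultimately show ?thesis by (simp del: power_Suc)
      qed
      finally show "\<bar>w ^ m / fact m - (\<Sum>n\<le>M. c_coeff N a n m * \<xi> ^ (2 * (n + m)) / (fact m * t ^ n))\<bar>
        \<le> B m / fact m * \<xi> ^ (2 * m + 2 * (M + 1)) / t ^ (M + 1)" .
    qed
    also have "\<dots> = (\<Sum>m\<le>M. B m / fact m * \<xi> ^ (2 * m + 2 * (M + 1))) / t ^ (M + 1)"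
      by (simp only: sum_divide_distrib)
    finally have S: "\<bar>(\<Sum>m\<le>M. w ^ m / fact m) - ?S\<bar> \<le> (\<Sum>m\<le>M. B m / fact m * \<xi> ^ (2 * m + 2 * (M + 1))) / t ^ (M + 1)" .
    have tri: "\<bar>e * x - e * z\<bar> \<le> e * \<bar>x - y\<bar> + e * \<bar>y - z\<bar>" if "e \<ge> 0" for e x y z :: real
    proof -
      have "\<bar>x - z\<bar> \<le> \<bar>x - y\<bar> + \<bar>y - z\<bar>" by simp
      then have "e * \<bar>x - z\<bar> \<le> e * (\<bar>x - y\<bar> + \<bar>y - z\<bar>)" using that by (rule mult_left_mono)
      then show ?thesis using that by (simp add: abs_mult distrib_left flip: right_diff_distrib)
    qed
    have "\<bar>exp (- t * symb N a \<theta>) - exp (- \<xi>\<^sup>2) * ?S\<bar>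
        \<le> exp (- \<xi>\<^sup>2) * \<bar>exp w - (\<Sum>m\<le>M. w ^ m / fact m)\<bar> + exp (- \<xi>\<^sup>2) * \<bar>(\<Sum>m\<le>M. w ^ m / fact m) - ?S\<bar>"
      unfolding A exp_add by (rule tri) simp
    also have "\<dots> \<le> exp (- \<xi>\<^sup>2) * (exp (max w 0) * \<bar>w\<bar> ^ (M + 1))
        + exp (- \<xi>\<^sup>2) * ((\<Sum>m\<le>M. B m / fact m * \<xi> ^ (2 * m + 2 * (M + 1))) / t ^ (M + 1))"
      by (rule add_mono[OF mult_left_mono[OF exp_remainder_bound] mult_left_mono[OF S]]) auto
    also have "\<dots> = (exp (- \<xi>\<^sup>2) * exp (max w 0)) * \<bar>w\<bar> ^ (M + 1)
        + exp (- \<xi>\<^sup>2) * ((\<Sum>m\<le>M. B m / fact m * \<xi> ^ (2 * m + 2 * (M + 1))) / t ^ (M + 1))"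
      by (simp only: mult.assoc)
    also have "\<dots> \<le> exp (- c * \<xi>\<^sup>2) * (C ^ (M + 1) * \<xi> ^ (4 * (M + 1)) / t ^ (M + 1))
        + exp (- c * \<xi>\<^sup>2) * ((\<Sum>m\<le>M. B m / fact m * \<xi> ^ (2 * m + 2 * (M + 1))) / t ^ (M + 1))"
      by (rule add_mono[OF mult_mono[OF gauss w] mult_right_mono[OF gauss' order_trans[OF abs_ge_zero S]]]) simp_all
    also have "\<dots> = poly D \<xi> * exp (- c * \<xi>\<^sup>2) / t ^ (M + 1)"
    proof -
      have "e * (p / T) + e * (q / T) = (p + q) * e / T" for e p q T :: real
        by (simp add: add_divide_distrib algebra_simps)
      moreover have "poly D \<xi> = C ^ (M + 1) * \<xi> ^ (4 * (M + 1)) + (\<Sum>m\<le>M. B m / fact m * \<xi> ^ (2 * m + 2 * (M + 1)))"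
        by (simp only: D_def poly_add poly_sum poly_monom)
      ultimately show ?thesis by (simp only:)
    qed
    finally show ?thesis
      using double_expansion_eq[of t, where M = M and \<xi> = \<xi>] t by (simp add: \<theta>_def)
  qed
  then show ?thesis using c(1) by blast
qed

text \<open>Beyond \<open>pi * sqrt t\<close> the kernel is cut off, and the expansion alone has to
  be small. There \<open>t \<le> \<xi>^2\<close>, so the factor
  \<open>\<xi> ^ (2 * (M + 1)) / t ^ (M + 1) \<ge> 1\<close> may be inserted, and the Gaussian
  absorbs the power of \<open>\<xi>\<close>. Bounding \<open>1 / t ^ n\<close> by
  \<open>1 / t0 ^ n\<close> makes the majorant independent of \<open>t\<close>.\<close>

lemma kernel_symbol_expansion:
  assumes "t0 > 0"
  shows "\<exists>D. integrable lborel D \<and> (\<forall>t\<ge>t0. \<forall>\<xi>.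
     \<bar>(if \<bar>\<xi>\<bar> \<le> pi * sqrt t then exp (- t * symb N a (\<xi> / sqrt t)) else 0)
       - exp (- \<xi>\<^sup>2) * (1 + (\<Sum>n=N..M. poly (P_poly N a n) \<xi> / t ^ n))\<bar> \<le> D \<xi> / t ^ (M + 1))"
proof -
  obtain c and D :: "real poly" where c: "c > 0" and D: "\<And>t \<xi>. t > 0 \<Longrightarrow> \<bar>\<xi>\<bar> \<le> pi * sqrt t \<Longrightarrow>
     \<bar>exp (- t * symb N a (\<xi> / sqrt t)) - exp (- \<xi>\<^sup>2) * (1 + (\<Sum>n=N..M. poly (P_poly N a n) \<xi> / t ^ n))\<bar>
       \<le> poly D \<xi> * exp (- c * \<xi>\<^sup>2) / t ^ (M + 1)"
    using kernel_symbol_expansion_core[of M] by blast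
  define G where "G \<xi> = \<bar>poly 1 \<xi> * \<xi> ^ (2 * (M + 1)) * exp (- \<xi>\<^sup>2)\<bar>
      + (\<Sum>n=N..M. \<bar>poly (P_poly N a n) \<xi> * \<xi> ^ (2 * (M + 1)) * exp (- \<xi>\<^sup>2)\<bar> / t0 ^ n)" for \<xi> :: real
  have G0: "G \<xi> \<ge> 0" for \<xi> using assms by (auto simp: G_def intro!: add_nonneg_nonneg sum_nonneg)
  have outer: "\<bar>exp (- \<xi>\<^sup>2) * (1 + (\<Sum>n=N..M. poly (P_poly N a n) \<xi> / t ^ n))\<bar> \<le> G \<xi> / t ^ (M + 1)"
    if t: "t \<ge> t0" and \<xi>: "pi * sqrt t < \<bar>\<xi>\<bar>" for t \<xi>
  proof -
    have t0: "t > 0" using t assms by simp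
    have "1 * sqrt t \<le> pi * sqrt t" using pi_gt3 t0 by (intro mult_right_mono) auto
    then have "sqrt t \<le> \<bar>\<xi>\<bar>" using \<xi> by simp
    then have "t \<le> \<xi>\<^sup>2" using t0 by (metis abs_ge_zero power2_abs real_sqrt_ge_zero real_sqrt_le_iff real_sqrt_abs)
    then have "t ^ (M + 1) \<le> \<xi> ^ (2 * (M + 1))"
      unfolding power_mult using t0 by (intro power_mono) auto
    then have one: "1 \<le> \<xi> ^ (2 * (M + 1)) / t ^ (M + 1)"
      by (subst le_divide_eq_1_pos) (use t0 in auto)
    have "\<bar>1 + (\<Sum>n=N..M. poly (P_poly N a n) \<xi> / t ^ n)\<bar> \<le> 1 + (\<Sum>n=N..M. \<bar>poly (P_poly N a n) \<xi>\<bar> / t0 ^ n)"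
    proof -
      have "\<bar>\<Sum>n=N..M. poly (P_poly N a n) \<xi> / t ^ n\<bar> \<le> (\<Sum>n=N..M. \<bar>poly (P_poly N a n) \<xi>\<bar> / t0 ^ n)"
        using t t0 assms by (intro order_trans[OF sum_abs] sum_mono) (auto intro!: divide_left_mono power_mono)
      then show ?thesis by linarith
    qed
    then have "\<bar>exp (- \<xi>\<^sup>2) * (1 + (\<Sum>n=N..M. poly (P_poly N a n) \<xi> / t ^ n))\<bar>
       \<le> exp (- \<xi>\<^sup>2) * (1 + (\<Sum>n=N..M. \<bar>poly (P_poly N a n) \<xi>\<bar> / t0 ^ n)) * 1"
      by (simp add: abs_mult)
    also have "\<dots> \<le> exp (- \<xi>\<^sup>2) * (1 + (\<Sum>n=N..M. \<bar>poly (P_poly N a n) \<xi>\<bar> / t0 ^ n)) * (\<xi> ^ (2 * (M + 1)) / t ^ (M + 1))"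
      using assms by (intro mult_left_mono one) (auto intro!: mult_nonneg_nonneg add_nonneg_nonneg sum_nonneg)
    also have "\<dots> = G \<xi> / t ^ (M + 1)"
    proof -
      define Q where "Q = \<xi> ^ (2 * (M + 1))"
      have Q: "\<bar>Q\<bar> = Q" unfolding Q_def power_mult by (rule abs_of_nonneg) simp
      have "G \<xi> = exp (- \<xi>\<^sup>2) * (1 + (\<Sum>n=N..M. \<bar>poly (P_poly N a n) \<xi>\<bar> / t0 ^ n)) * Q"
        unfolding G_def Q_def[symmetric]
        by (simp add: abs_mult Q distrib_left distrib_right sum_distrib_left mult_ac)
      then show ?thesis by (simp add: Q_def)
    qed
    finally show ?thesis .
  qed
  have "integrable lborel G"
    unfolding G_def
    by (intro Bochner_Integration.integrable_add Bochner_Integration.integrable_sum integrable_divide_zero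
        integrable_abs integrable_gauss_weight)
  then have int: "integrable lborel (\<lambda>\<xi>. \<bar>poly D \<xi> * exp (- c * \<xi>\<^sup>2)\<bar> + G \<xi>)"
    by (intro Bochner_Integration.integrable_add integrable_abs integrable_poly_gaussian c)
  show ?thesis
  proof (intro exI[of _ "\<lambda>\<xi>. \<bar>poly D \<xi> * exp (- c * \<xi>\<^sup>2)\<bar> + G \<xi>"] conjI allI impI int)
    fix t \<xi> assume t: "t0 \<le> t"
    then have t0: "t > 0" using assms by simp
    show "\<bar>(if \<bar>\<xi>\<bar> \<le> pi * sqrt t then exp (- t * symb N a (\<xi> / sqrt t)) else 0)
       - exp (- \<xi>\<^sup>2) * (1 + (\<Sum>n=N..M. poly (P_poly N a n) \<xi> / t ^ n))\<bar> \<le> (\<bar>poly D \<xi> * exp (- c * \<xi>\<^sup>2)\<bar> + G \<xi>) / t ^ (M + 1)"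
    proof (cases "\<bar>\<xi>\<bar> \<le> pi * sqrt t")
      case True
      have "poly D \<xi> * exp (- c * \<xi>\<^sup>2) / t ^ (M + 1) \<le> (\<bar>poly D \<xi> * exp (- c * \<xi>\<^sup>2)\<bar> + G \<xi>) / t ^ (M + 1)"
        using t0 G0[of \<xi>] by (intro divide_right_mono) auto
      with D[OF t0 True] True show ?thesis by simp
    next
      case False
      have "G \<xi> / t ^ (M + 1) \<le> (\<bar>poly D \<xi> * exp (- c * \<xi>\<^sup>2)\<bar> + G \<xi>) / t ^ (M + 1)"
        using t0 by (intro divide_right_mono) auto
      with outer[OF t, of \<xi>] False show ?thesis by (simp only: if_False not_le) simp
    qed
  qed
qed

end

section \<open>The lattice heat kernel and the Green function\<close>

abbreviation torus :: "real measure" where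
  "torus \<equiv> restrict_space lborel {- pi..pi}"

lemma finite_measure_torus: "finite_measure torus"
  by (rule finite_measureI) (simp add: emeasure_restrict_space space_restrict_space)

lemma integrable_torus_bounded:
  fixes f :: "real \<Rightarrow> real"
  assumes "f \<in> borel_measurable borel" "\<And>\<theta>. \<bar>\<theta>\<bar> \<le> pi \<Longrightarrow> \<bar>f \<theta>\<bar> \<le> B"
  shows "integrable torus f"
proof (rule finite_measure.integrable_const_bound[OF finite_measure_torus])
  show "AE \<theta> in torus. norm (f \<theta>) \<le> B"
    by (rule AE_I2) (auto simp: space_restrict_space intro!: assms(2))
  show "f \<in> borel_measurable torus" by (rule measurable_restrict_space1) (simp add: assms(1))
qed

lemma integrable_torus_continuous:
  fixes f :: "real \<Rightarrow> real"
  assumes "continuous_on UNIV f"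
  shows "integrable torus f"
proof -
  have "bounded (f ` {-pi..pi})"
    by (intro compact_imp_bounded compact_continuous_image continuous_on_subset[OF assms]) auto
  then obtain B where "\<forall>\<theta>\<in>{-pi..pi}. \<bar>f \<theta>\<bar> \<le> B" by (auto simp: bounded_pos)
  then have "\<bar>f \<theta>\<bar> \<le> B" if "\<bar>\<theta>\<bar> \<le> pi" for \<theta> using that by (auto simp: abs_le_iff)
  then show ?thesis
    by (rule integrable_torus_bounded[OF borel_measurable_continuous_onI[OF assms]])
qed

lemma integral_const_torus: "(\<integral>\<theta>. c \<partial>torus) = 2 * pi * c"
  by (simp add: measure_restrict_space space_restrict_space)

lemma integral_torus_eq_HK:
  fixes f :: "real \<Rightarrow> real"
  assumes "integrable torus f"
  shows "f integrable_on {-pi..pi}" "(\<integral>\<theta>. f \<theta> \<partial>torus) = integral {-pi..pi} f"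
proof -
  have "set_integrable lborel {-pi..pi} f"
    using assms by (simp add: integrable_restrict_space set_integrable_def)
  from set_borel_integral_eq_integral[OF this]
  show "f integrable_on {-pi..pi}" "(\<integral>\<theta>. f \<theta> \<partial>torus) = integral {-pi..pi} f"
    by (simp_all add: integral_restrict_space set_lebesgue_integral_def)
qed

lemma integral_cos_torus: "(\<integral>\<theta>. cos (real_of_int n * \<theta>) \<partial>torus) = (if n = 0 then 2 * pi else 0)"
proof (cases "n = 0")
  case True
  then show ?thesis using integral_const_torus[of 1] by simp
next
  case False
  have "((\<lambda>\<theta>. cos (real_of_int n * \<theta>)) has_integral
      (sin (real_of_int n * pi) / real_of_int n - sin (real_of_int n * (- pi)) / real_of_int n)) {-pi..pi}"
    by (rule has_integral_FTC_real) (use False in \<open>auto intro!: derivative_eq_intros simp: pi_ge_zero order_trans[OF _ pi_ge_zero]\<close>)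
  moreover have "sin (real_of_int n * pi) = 0" by (simp add: sin_zero_iff_int2)
  ultimately have "integral {-pi..pi} (\<lambda>\<theta>. cos (real_of_int n * \<theta>)) = 0" by (simp add: integral_unique)
  moreover have "integrable torus (\<lambda>\<theta>. cos (real_of_int n * \<theta>))"
    by (intro integrable_torus_continuous continuous_intros)
  ultimately show ?thesis using False by (simp add: integral_torus_eq_HK)
qed

lemma exp_quadratic_bound:
  fixes A :: real
  assumes "A \<ge> 0" "z \<ge> 0" "y \<ge> 0"
  shows "\<bar>exp (- z * A) - exp (- y * A) - (z - y) * (- A * exp (- y * A))\<bar> \<le> (z - y)\<^sup>2 * A\<^sup>2"
proof -
  have "norm ((- A) ^ 0 * exp (- z * A) - (\<Sum>i\<le>1. (- A) ^ i * exp (- y * A) * (z - y) ^ i / fact i))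
     \<le> A\<^sup>2 * norm (z - y) ^ Suc 1 / fact 1"
  proof (rule field_Taylor[where S = "{0..}" and f = "\<lambda>i t. (- A) ^ i * exp (- t * A)"])
    show "norm ((- A) ^ Suc 1 * exp (- x * A)) \<le> A\<^sup>2" if "x \<in> {0..}" for x
    proof -
      have "A * A * exp (- x * A) \<le> A * A * 1"
        using that assms by (intro mult_left_mono) auto
      then show ?thesis using assms by (simp add: power2_eq_square abs_mult)
    qed
  qed (use assms in \<open>auto intro!: derivative_eq_intros\<close>)
  then show ?thesis by (simp add: power2_eq_square algebra_simps)
qed

context stencil
begin

section \<open>The lattice heat kernel\<close>

lemma symb_nonneg: "\<bar>\<theta>\<bar> \<le> pi \<Longrightarrow> symb N a \<theta> \<ge> 0"
  using symb_lower_bound by (meson mult_nonneg_nonneg less_imp_le order_trans zero_le_power2)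

text \<open>The cosine replaces the complex exponential because the symbol is even.\<close>

definition lattice_heat :: "real \<Rightarrow> real \<Rightarrow> real" where
  "lattice_heat x t = 1 / (2 * pi) * (\<integral>\<theta>. exp (- t * symb N a \<theta>) * cos (x * \<theta>) \<partial>torus)"

lemma integrable_semigroup:
  assumes "integrable torus f" "t \<ge> 0"
  shows "integrable torus (\<lambda>\<theta>. exp (- t * symb N a \<theta>) * f \<theta>)"
proof (rule Bochner_Integration.integrable_bound[OF assms(1)])
  have "(\<lambda>\<theta>. exp (- t * symb N a \<theta>)) \<in> borel_measurable borel"
    by (intro borel_measurable_continuous_onI continuous_intros symb_continuous)
  then have "(\<lambda>\<theta>. exp (- t * symb N a \<theta>)) \<in> borel_measurable torus"
    by (intro measurable_restrict_space1) simp
  then show "(\<lambda>\<theta>. exp (- t * symb N a \<theta>) * f \<theta>) \<in> borel_measurable torus"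
    using assms(1) by simp
  show "AE \<theta> in torus. norm (exp (- t * symb N a \<theta>) * f \<theta>) \<le> norm (f \<theta>)"
  proof (rule AE_I2)
    fix \<theta> assume "\<theta> \<in> space torus"
    then have "symb N a \<theta> \<ge> 0" by (intro symb_nonneg) (auto simp: space_restrict_space)
    then have "exp (- t * symb N a \<theta>) \<le> 1" using assms(2) by simp
    then show "norm (exp (- t * symb N a \<theta>) * f \<theta>) \<le> norm (f \<theta>)"
      by (simp add: abs_mult mult_left_le_one_le)
  qed
qed

text \<open>A general weight \<open>f\<close> is kept because the lemma serves both the heat kernel,
  where \<open>f\<close> is a cosine, and the weight \<open>grad_kernel\<close>. Integrability of
  the squared symbol times \<open>f\<close> controls the quadratic remainder.\<close>

lemma semigroup_deriv:
  fixes f :: "real \<Rightarrow> real"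
  assumes f: "integrable torus f" "integrable torus (\<lambda>\<theta>. symb N a \<theta> * f \<theta>)" "integrable torus (\<lambda>\<theta>. (symb N a \<theta>)\<^sup>2 * f \<theta>)"
    and t: "t \<ge> 0"
  shows "((\<lambda>t. \<integral>\<theta>. exp (- t * symb N a \<theta>) * f \<theta> \<partial>torus) has_real_derivative
     - (\<integral>\<theta>. exp (- t * symb N a \<theta>) * (symb N a \<theta> * f \<theta>) \<partial>torus)) (at t within {0..})"
proof -
  have "((\<lambda>t. \<integral>\<theta>. exp (- t * symb N a \<theta>) * f \<theta> \<partial>torus) has_real_derivative
     (\<integral>\<theta>. - (exp (- t * symb N a \<theta>) * (symb N a \<theta> * f \<theta>)) \<partial>torus)) (at t within {0..})"
  proof (rule has_derivative_integral_quadratic)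
    show "integrable torus (\<lambda>\<theta>. \<bar>(symb N a \<theta>)\<^sup>2 * f \<theta>\<bar>)" using f(3) by simp
    fix z \<theta> :: real assume z: "z \<in> {0..}" and "\<theta> \<in> space torus"
    then have A: "symb N a \<theta> \<ge> 0" by (intro symb_nonneg) (auto simp: space_restrict_space)
    let ?A = "symb N a \<theta>"
    have "exp (- z * ?A) * f \<theta> - exp (- t * ?A) * f \<theta> - (z - t) * - (exp (- t * ?A) * (?A * f \<theta>))
       = (exp (- z * ?A) - exp (- t * ?A) - (z - t) * (- ?A * exp (- t * ?A))) * f \<theta>"
      by (simp add: algebra_simps)
    also have "\<bar>\<dots>\<bar> \<le> ((z - t)\<^sup>2 * ?A\<^sup>2) * \<bar>f \<theta>\<bar>"
      unfolding abs_mult by (intro mult_right_mono exp_quadratic_bound A) (use z t in auto)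
    finally show "\<bar>exp (- z * ?A) * f \<theta> - exp (- t * ?A) * f \<theta> - (z - t) * - (exp (- t * ?A) * (?A * f \<theta>))\<bar>
       \<le> (z - t)\<^sup>2 * \<bar>?A\<^sup>2 * f \<theta>\<bar>" by (simp add: abs_mult)
  next
    show "integrable torus (\<lambda>\<theta>. exp (- z * symb N a \<theta>) * f \<theta>)" if "z \<in> {0..}" for z
      by (rule integrable_semigroup) (use f that in auto)
    show "integrable torus (\<lambda>\<theta>. - (exp (- t * symb N a \<theta>) * (symb N a \<theta> * f \<theta>)))"
      by (intro Bochner_Integration.integrable_minus integrable_semigroup f t)
  qed (use t in simp)
  then show ?thesis by simp
qed

lemma lattice_heat_bound: "t \<ge> 0 \<Longrightarrow> \<bar>lattice_heat x t\<bar> \<le> 1"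
proof -
  assume t: "t \<ge> 0"
  have "\<bar>\<integral>\<theta>. exp (- t * symb N a \<theta>) * cos (x * \<theta>) \<partial>torus\<bar> \<le> (\<integral>\<theta>. 1 \<partial>torus)"
  proof (rule order_trans[OF integral_abs_bound integral_mono])
    show "integrable torus (\<lambda>\<theta>. \<bar>exp (- t * symb N a \<theta>) * cos (x * \<theta>)\<bar>)"
      by (intro integrable_abs integrable_torus_continuous continuous_intros symb_continuous)
    show "integrable torus (\<lambda>_. 1 :: real)" by (intro integrable_torus_continuous continuous_intros)
    fix \<theta> assume "\<theta> \<in> space torus"
    then have "symb N a \<theta> \<ge> 0" by (intro symb_nonneg) (auto simp: space_restrict_space)
    then have "exp (- t * symb N a \<theta>) * \<bar>cos (x * \<theta>)\<bar> \<le> 1 * 1" using t by (intro mult_mono) auto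
    then show "\<bar>exp (- t * symb N a \<theta>) * cos (x * \<theta>)\<bar> \<le> 1" by (simp add: abs_mult)
  qed
  then show ?thesis by (simp only: integral_const_torus) (simp add: lattice_heat_def abs_mult)
qed

lemma discrete_laplacian_cos:
  "discrete_laplacian N a (\<lambda>y. cos (real_of_int y * \<theta>)) x = - symb N a \<theta> * cos (real_of_int x * \<theta>)"
proof -
  have "cos (real_of_int (x - int \<nu>) * \<theta>) - 2 * cos (real_of_int x * \<theta>) + cos (real_of_int (x + int \<nu>) * \<theta>)
    = - 2 * (1 - cos (real \<nu> * \<theta>)) * cos (real_of_int x * \<theta>)" for \<nu>
    by (simp add: distrib_right left_diff_distrib cos_add cos_diff)
  then show ?thesis
    by (auto simp: discrete_laplacian_def symb_def sum_distrib_right sum_distrib_left algebra_simps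
        simp flip: sum_negf intro!: sum.cong)
qed

lemma discrete_laplacian_lattice_heat:
  assumes "t \<ge> 0"
  shows "discrete_laplacian N a (\<lambda>y. lattice_heat (real_of_int y) t) x
     = - (1 / (2 * pi) * (\<integral>\<theta>. exp (- t * symb N a \<theta>) * (symb N a \<theta> * cos (real_of_int x * \<theta>)) \<partial>torus))"
proof -
  define g where "g y \<theta> = exp (- t * symb N a \<theta>) * cos (real_of_int y * \<theta>)" for y \<theta>
  have int: "integrable torus (g y)" for y
    unfolding g_def[abs_def] by (intro integrable_torus_continuous continuous_intros symb_continuous)
  have heat: "lattice_heat (real_of_int y) t = 1 / (2 * pi) * (\<integral>\<theta>. g y \<theta> \<partial>torus)" for y
    by (simp add: lattice_heat_def g_def)
  have "(\<integral>\<theta>. discrete_laplacian N a (\<lambda>y. g y \<theta>) x \<partial>torus) = discrete_laplacian N a (\<lambda>y. \<integral>\<theta>. g y \<theta> \<partial>torus) x"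
    unfolding discrete_laplacian_def by (subst Bochner_Integration.integral_sum) (auto simp: int)
  then have "discrete_laplacian N a (\<lambda>y. lattice_heat (real_of_int y) t) x
     = 1 / (2 * pi) * (\<integral>\<theta>. discrete_laplacian N a (\<lambda>y. g y \<theta>) x \<partial>torus)"
    unfolding heat by (simp add: discrete_laplacian_def sum_divide_distrib diff_divide_distrib add_divide_distrib right_diff_distrib distrib_left)
  also have "(\<lambda>\<theta>. discrete_laplacian N a (\<lambda>y. g y \<theta>) x)
    = (\<lambda>\<theta>. exp (- t * symb N a \<theta>) * discrete_laplacian N a (\<lambda>y. cos (real_of_int y * \<theta>)) x)"
    by (auto simp: discrete_laplacian_def sum_distrib_left g_def fun_eq_iff algebra_simps intro!: sum.cong)
  finally show ?thesis by (simp add: discrete_laplacian_cos)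
qed

lemma lattice_heat_deriv:
  assumes "t \<ge> 0"
  shows "(lattice_heat (real_of_int x) has_real_derivative
     discrete_laplacian N a (\<lambda>y. lattice_heat (real_of_int y) t) x) (at t within {0..})"
proof -
  have "((\<lambda>t. \<integral>\<theta>. exp (- t * symb N a \<theta>) * cos (real_of_int x * \<theta>) \<partial>torus) has_real_derivative
     - (\<integral>\<theta>. exp (- t * symb N a \<theta>) * (symb N a \<theta> * cos (real_of_int x * \<theta>)) \<partial>torus)) (at t within {0..})"
    by (intro semigroup_deriv assms integrable_torus_continuous continuous_intros symb_continuous)
  from DERIV_cmult[OF this, of "1 / (2 * pi)"]
  show ?thesis
    unfolding discrete_laplacian_lattice_heat[OF assms] by (simp add: lattice_heat_def[abs_def])
qed

lemma lattice_heat_0: "lattice_heat (real_of_int x) 0 = discrete_delta x"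
  by (simp add: lattice_heat_def integral_cos_torus discrete_delta_def)

lemma lattice_heat_continuous: "continuous_on {0..} (lattice_heat (real_of_int x))"
  by (rule DERIV_continuous_on) (auto intro: lattice_heat_deriv)

section \<open>The Green function\<close>

definition green :: "int \<Rightarrow> real \<Rightarrow> real" where
  "green x t = integral {0..t} (lattice_heat (real_of_int x))"

lemma green_deriv:
  assumes "t \<ge> 0" shows "(green x has_real_derivative lattice_heat (real_of_int x) t) (at t within {0..})"
proof -
  have "(green x has_real_derivative lattice_heat (real_of_int x) t) (at t within {0..t + 1})"
    unfolding green_def[abs_def]
    by (rule integral_has_real_derivative) (auto intro: continuous_on_subset[OF lattice_heat_continuous] simp: assms)
  moreover have "at t within {0..t + 1} = at t within {0..}"
    by (rule at_within_nhd[of t "{..<t + 1}"]) auto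
  ultimately show ?thesis by simp
qed

text \<open>Laplacian of \<open>green\<close> and heat kernel have the same time derivative, so
  their difference keeps its value at time 0, where \<open>green\<close> vanishes and the kernel is
  the delta.\<close>

lemma discrete_laplacian_green:
  assumes "t \<ge> 0"
  shows "discrete_laplacian N a (\<lambda>y. green y t) x = lattice_heat (real_of_int x) t - discrete_delta x"
proof -
  have "((\<lambda>t. discrete_laplacian N a (\<lambda>y. green y t) x - lattice_heat (real_of_int x) t) has_real_derivative
      discrete_laplacian N a (\<lambda>y. lattice_heat (real_of_int y) s) x
      - discrete_laplacian N a (\<lambda>y. lattice_heat (real_of_int y) s) x) (at s within {0..})" if "s \<ge> 0" for s
    unfolding discrete_laplacian_def[of N a "\<lambda>y. green y _"] discrete_laplacian_def[of N a "\<lambda>y. lattice_heat (real_of_int y) s" x]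
    by (intro DERIV_diff DERIV_sum DERIV_cmult DERIV_add green_deriv that lattice_heat_deriv[OF that, unfolded discrete_laplacian_def])
  then obtain c where c: "\<And>s. s \<ge> 0 \<Longrightarrow> discrete_laplacian N a (\<lambda>y. green y s) x - lattice_heat (real_of_int x) s = c"
    using has_field_derivative_zero_constant[of "{0..}" "\<lambda>t. discrete_laplacian N a (\<lambda>y. green y t) x - lattice_heat (real_of_int x) t"]
    by auto
  have "c = - discrete_delta x"
    using c[of 0] by (simp add: green_def discrete_laplacian_def lattice_heat_0)
  then show ?thesis using c[OF assms] by simp
qed

lemma green_bound: "t \<ge> 0 \<Longrightarrow> \<bar>green x t\<bar> \<le> t"
proof -
  assume t: "t \<ge> 0"
  have "norm (integral {0..t} (lattice_heat (real_of_int x))) \<le> 1 * (t - 0)"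
    by (rule integral_bound) (use t lattice_heat_bound in \<open>auto intro: continuous_on_subset[OF lattice_heat_continuous]\<close>)
  then show ?thesis by (simp add: green_def)
qed

lemma green_minus: "green (- x) t = green x t"
  by (simp add: green_def lattice_heat_def[abs_def])

text \<open>The difference solves the homogeneous problem with zero initial values. Rapid decrease
  enters with exponent 0, as a bound at each time separately, while \<open>green\<close> is bounded
  by \<open>t\<close>.\<close>

lemma second_green_function_eq:
  assumes "second_green_function N a v" "t \<ge> 0"
  shows "v x t = green x t"
proof -
  have C1: "C1_on_halfline (v x)" for x using assms(1) by (simp add: second_green_function_def)
  then obtain D where D: "\<And>x t. t \<ge> 0 \<Longrightarrow> (v x has_real_derivative D x t) (at t within {0..})"
    unfolding C1_on_halfline_def by metis
  interpret w: homogeneous_solution N a "\<lambda>x t. v x t - green x t"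
  proof
    fix x
    show "continuous_on {0..} (\<lambda>t. v x t - green x t)"
      by (intro continuous_on_diff DERIV_continuous_on[OF D] DERIV_continuous_on[OF green_deriv]) auto
    show "v x 0 - green x 0 = 0" using assms(1) by (simp add: green_def second_green_function_def)
  next
    fix x and t :: real assume t: "t > 0"
    have within: "at t within {0..} = at t" using t by (intro at_within_open_subset[of _ "{0<..}"]) auto
    have v: "(v x has_real_derivative D x t) (at t)" using D[of t x] t by (simp add: within)
    then have "D x t - discrete_laplacian N a (\<lambda>y. v y t) x = discrete_delta x"
      using assms(1) t by (simp add: second_green_function_def DERIV_imp_deriv[OF v, symmetric])
    moreover have "((\<lambda>t. v x t - green x t) has_real_derivative D x t - lattice_heat (real_of_int x) t) (at t)"
      using green_deriv[of t x] t by (intro DERIV_diff v) (simp add: within)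
    moreover have "discrete_laplacian N a (\<lambda>y. v y t - green y t) x
       = discrete_laplacian N a (\<lambda>y. v y t) x - discrete_laplacian N a (\<lambda>y. green y t) x"
      unfolding discrete_laplacian_def sum_subtractf[symmetric] by (intro sum.cong) (auto simp: algebra_simps)
    ultimately have "((\<lambda>t. v x t - green x t) has_real_derivative D x t - lattice_heat (real_of_int x) t) (at t)"
      "D x t - lattice_heat (real_of_int x) t = discrete_laplacian N a (\<lambda>y. v y t - green y t) x"
      using discrete_laplacian_green[of t x] t by auto
    then show "((\<lambda>t. v x t - green x t) has_real_derivative discrete_laplacian N a (\<lambda>y. v y t - green y t) x) (at t)"
      by (simp only:)
  next
    fix t :: real assume t: "t \<ge> 0"
    then have "rapidly_decreasing (\<lambda>x. v x t)" using assms(1) by (simp add: second_green_function_def)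
    then obtain C where C: "\<And>x. \<bar>real_of_int x\<bar> ^ 0 * \<bar>v x t\<bar> \<le> C" unfolding rapidly_decreasing_def by metis
    then have "\<bar>v x t - green x t\<bar> \<le> C + t" for x
      using green_bound[OF t, of x] C[of x, unfolded power_0 mult_1] by linarith
    then show "\<exists>K. \<forall>x. \<bar>v x t - green x t\<bar> \<le> K" by blast
  qed
  show ?thesis using w.solution_zero[OF assms(2), of x] by simp
qed

section \<open>The heat kernel in self-similar variables\<close>

lemma lattice_heat_rescaled:
  assumes "t > 0"
  shows "lattice_heat x t = 1 / sqrt t * (1 / (2 * pi) *
     (\<integral>\<xi>. (if \<bar>\<xi>\<bar> \<le> pi * sqrt t then exp (- t * symb N a (\<xi> / sqrt t)) else 0) * cos (x / sqrt t * \<xi>) \<partial>lborel))"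
    and "integrable lborel (\<lambda>\<xi>. (if \<bar>\<xi>\<bar> \<le> pi * sqrt t then exp (- t * symb N a (\<xi> / sqrt t)) else 0) * cos (x / sqrt t * \<xi>))"
proof -
  let ?f = "\<lambda>\<theta>. indicator {-pi..pi} \<theta> *\<^sub>R (exp (- t * symb N a \<theta>) * cos (x * \<theta>))"
  have eq: "?f (0 + (1 / sqrt t) * \<xi>)
      = (if \<bar>\<xi>\<bar> \<le> pi * sqrt t then exp (- t * symb N a (\<xi> / sqrt t)) else 0) * cos (x / sqrt t * \<xi>)" for \<xi>
    using assms by (auto simp: indicator_def abs_le_iff field_simps)
  have "integrable torus (\<lambda>\<theta>. exp (- t * symb N a \<theta>) * cos (x * \<theta>))"
    by (intro integrable_torus_continuous continuous_intros symb_continuous)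
  then have "integrable lborel ?f" by (simp add: integrable_restrict_space)
  then have "integrable lborel (\<lambda>\<xi>. ?f (0 + (1 / sqrt t) * \<xi>))"
    using assms by (intro lborel_integrable_real_affine) auto
  then show "integrable lborel (\<lambda>\<xi>. (if \<bar>\<xi>\<bar> \<le> pi * sqrt t then exp (- t * symb N a (\<xi> / sqrt t)) else 0) * cos (x / sqrt t * \<xi>))"
    unfolding eq .
  have "(\<integral>\<theta>. exp (- t * symb N a \<theta>) * cos (x * \<theta>) \<partial>torus) = (\<integral>\<theta>. ?f \<theta> \<partial>lborel)"
    by (simp add: integral_restrict_space)
  also have "\<dots> = \<bar>1 / sqrt t\<bar> *\<^sub>R (\<integral>\<xi>. ?f (0 + (1 / sqrt t) * \<xi>) \<partial>lborel)"
    using assms by (intro lborel_integral_real_affine) simp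
  finally have "(\<integral>\<theta>. exp (- t * symb N a \<theta>) * cos (x * \<theta>) \<partial>torus) = 1 / sqrt t *
     (\<integral>\<xi>. (if \<bar>\<xi>\<bar> \<le> pi * sqrt t then exp (- t * symb N a (\<xi> / sqrt t)) else 0) * cos (x / sqrt t * \<xi>) \<partial>lborel)"
    unfolding eq using assms by (simp only: real_scaleR_def) simp
  then show "lattice_heat x t = 1 / sqrt t * (1 / (2 * pi) *
     (\<integral>\<xi>. (if \<bar>\<xi>\<bar> \<le> pi * sqrt t then exp (- t * symb N a (\<xi> / sqrt t)) else 0) * cos (x / sqrt t * \<xi>) \<partial>lborel))"
    unfolding lattice_heat_def by simp
qed

lemma profile_sum_eq_integral:
  "heat_profile y + (\<Sum>n=N..M. h0_fun N a n y / t ^ n) = 1 / (2 * pi) *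
     (\<integral>\<xi>. exp (- \<xi>\<^sup>2) * (1 + (\<Sum>n=N..M. poly (P_poly N a n) \<xi> / t ^ n)) * cos (y * \<xi>) \<partial>lborel)"
  "integrable lborel (\<lambda>\<xi>. exp (- \<xi>\<^sup>2) * (1 + (\<Sum>n=N..M. poly (P_poly N a n) \<xi> / t ^ n)) * cos (y * \<xi>))"
proof -
  define p where "p = 1 + (\<Sum>n=N..M. smult (1 / t ^ n) (P_poly N a n))"
  have p: "poly p \<xi> = 1 + (\<Sum>n=N..M. poly (P_poly N a n) \<xi> / t ^ n)" for \<xi>
    by (simp add: p_def poly_sum)
  have int: "integrable lborel (\<lambda>\<xi>. poly q \<xi> * exp (- \<xi>\<^sup>2) * cos (y * \<xi>))" for q
    using integrable_gauss_int[of q 0 y 0] by simp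
  have int': "integrable lborel (\<lambda>\<xi>. poly q \<xi> * exp (- \<xi>\<^sup>2) * cos (y * \<xi>) / t ^ n)" for q n
    using int[of q] by simp
  show "integrable lborel (\<lambda>\<xi>. exp (- \<xi>\<^sup>2) * (1 + (\<Sum>n=N..M. poly (P_poly N a n) \<xi> / t ^ n)) * cos (y * \<xi>))"
    using int[of p] unfolding p by (simp only: mult.commute[of "exp _"])
  have gauss: "gauss_int q 0 y = 1 / (2 * pi) * (\<integral>\<xi>. poly q \<xi> * exp (- \<xi>\<^sup>2) * cos (y * \<xi>) \<partial>lborel)" for q
    by (simp add: gauss_int_def)
  have "(\<integral>\<xi>. exp (- \<xi>\<^sup>2) * (1 + (\<Sum>n=N..M. poly (P_poly N a n) \<xi> / t ^ n)) * cos (y * \<xi>) \<partial>lborel)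
     = (\<integral>\<xi>. poly 1 \<xi> * exp (- \<xi>\<^sup>2) * cos (y * \<xi>) + (\<Sum>n=N..M. (poly (P_poly N a n) \<xi> * exp (- \<xi>\<^sup>2) * cos (y * \<xi>)) / t ^ n) \<partial>lborel)"
    by (rule Bochner_Integration.integral_cong) (simp_all add: algebra_simps sum_distrib_left)
  also have "\<dots> = (\<integral>\<xi>. poly 1 \<xi> * exp (- \<xi>\<^sup>2) * cos (y * \<xi>) \<partial>lborel) +
      (\<Sum>n=N..M. (\<integral>\<xi>. poly (P_poly N a n) \<xi> * exp (- \<xi>\<^sup>2) * cos (y * \<xi>) \<partial>lborel) / t ^ n)"
    by (subst Bochner_Integration.integral_add)
       (auto intro!: int int' Bochner_Integration.integrable_sum simp: Bochner_Integration.integral_sum[OF int'] simp del: poly_1)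
  finally show "heat_profile y + (\<Sum>n=N..M. h0_fun N a n y / t ^ n) = 1 / (2 * pi) *
     (\<integral>\<xi>. exp (- \<xi>\<^sup>2) * (1 + (\<Sum>n=N..M. poly (P_poly N a n) \<xi> / t ^ n)) * cos (y * \<xi>) \<partial>lborel)"
    by (simp add: heat_profile_eq_gauss_int h0_fun_eq_gauss_int gauss distrib_left sum_divide_distrib add_divide_distrib mult_ac)
qed

lemma lattice_heat_expansion:
  assumes "t0 > 0"
  shows "\<exists>C\<ge>0. \<forall>t\<ge>t0. \<forall>x. \<bar>lattice_heat x t - 1 / sqrt t *
     (heat_profile (x / sqrt t) + (\<Sum>n=N..M. h0_fun N a n (x / sqrt t) / t ^ n))\<bar> \<le> C / (sqrt t * t ^ (M + 1))"
proof -
  obtain D where D: "integrable lborel D" "\<And>t \<xi>. t \<ge> t0 \<Longrightarrow>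
     \<bar>(if \<bar>\<xi>\<bar> \<le> pi * sqrt t then exp (- t * symb N a (\<xi> / sqrt t)) else 0)
       - exp (- \<xi>\<^sup>2) * (1 + (\<Sum>n=N..M. poly (P_poly N a n) \<xi> / t ^ n))\<bar> \<le> D \<xi> / t ^ (M + 1)"
    using kernel_symbol_expansion[OF assms, of M] by blast
  define C where "C = 1 / (2 * pi) * (\<integral>\<xi>. D \<xi> \<partial>lborel)"
  have est: "\<bar>lattice_heat x t - 1 / sqrt t * (heat_profile (x / sqrt t) + (\<Sum>n=N..M. h0_fun N a n (x / sqrt t) / t ^ n))\<bar>
     \<le> C / (sqrt t * t ^ (M + 1))" if t: "t \<ge> t0" for t x
  proof -
    have t0: "t > 0" using t assms by simp
    define F where "F \<xi> = (if \<bar>\<xi>\<bar> \<le> pi * sqrt t then exp (- t * symb N a (\<xi> / sqrt t)) else 0)" for \<xi>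
    define H where "H \<xi> = exp (- \<xi>\<^sup>2) * (1 + (\<Sum>n=N..M. poly (P_poly N a n) \<xi> / t ^ n))" for \<xi>
    let ?y = "x / sqrt t"
    note F = lattice_heat_rescaled[OF t0, of x, folded F_def]
    note H = profile_sum_eq_integral[where y = ?y and M = M and t = t, folded H_def]
    have "\<bar>\<integral>\<xi>. F \<xi> * cos (?y * \<xi>) - H \<xi> * cos (?y * \<xi>) \<partial>lborel\<bar> \<le> (\<integral>\<xi>. D \<xi> / t ^ (M + 1) \<partial>lborel)"
    proof (rule order_trans[OF integral_abs_bound integral_mono])
      show "integrable lborel (\<lambda>\<xi>. \<bar>F \<xi> * cos (?y * \<xi>) - H \<xi> * cos (?y * \<xi>)\<bar>)"
        by (intro integrable_abs Bochner_Integration.integrable_diff F(2) H(2))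
      show "integrable lborel (\<lambda>\<xi>. D \<xi> / t ^ (M + 1))" using D(1) by simp
      fix \<xi>
      have "\<bar>F \<xi> * cos (?y * \<xi>) - H \<xi> * cos (?y * \<xi>)\<bar> = \<bar>F \<xi> - H \<xi>\<bar> * \<bar>cos (?y * \<xi>)\<bar>"
        by (simp add: abs_mult flip: left_diff_distrib)
      also have "\<dots> \<le> \<bar>F \<xi> - H \<xi>\<bar>" by (intro mult_left_le) auto
      also have "\<dots> \<le> D \<xi> / t ^ (M + 1)" using D(2)[OF t, of \<xi>] by (simp add: F_def H_def)
      finally show "\<bar>F \<xi> * cos (?y * \<xi>) - H \<xi> * cos (?y * \<xi>)\<bar> \<le> D \<xi> / t ^ (M + 1)" .
    qed
    then have le: "\<bar>(\<integral>\<xi>. F \<xi> * cos (?y * \<xi>) \<partial>lborel) - (\<integral>\<xi>. H \<xi> * cos (?y * \<xi>) \<partial>lborel)\<bar> \<le> (\<integral>\<xi>. D \<xi> \<partial>lborel) / t ^ (M + 1)"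
      using F(2) H(2) by simp
    have "lattice_heat x t - 1 / sqrt t * (heat_profile ?y + (\<Sum>n=N..M. h0_fun N a n ?y / t ^ n))
       = 1 / sqrt t * (1 / (2 * pi)) * ((\<integral>\<xi>. F \<xi> * cos (?y * \<xi>) \<partial>lborel) - (\<integral>\<xi>. H \<xi> * cos (?y * \<xi>) \<partial>lborel))"
      unfolding F(1) H(1) by (simp only: algebra_simps)
    also have "\<bar>\<dots>\<bar> \<le> 1 / sqrt t * (1 / (2 * pi)) * ((\<integral>\<xi>. D \<xi> \<partial>lborel) / t ^ (M + 1))"
      unfolding abs_mult[of "1 / sqrt t * (1 / (2 * pi))"] using le t0
      by (intro mult_mono) (auto simp: abs_mult)
    also have "\<dots> = C / (sqrt t * t ^ (M + 1))" by (simp add: C_def)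
    finally show ?thesis .
  qed
  \<comment> \<open>No sign of \<open>D\<close> is available, so that of \<open>C\<close> is read
    off from the estimate at \<open>t0\<close>.\<close>
  have "C / (sqrt t0 * t0 ^ (M + 1)) \<ge> 0" by (rule order_trans[OF abs_ge_zero est[OF order_refl]])
  moreover have "sqrt t0 * t0 ^ (M + 1) > 0" using assms by simp
  ultimately have "C \<ge> 0" by (simp only: pos_le_divide_eq mult_zero_left)
  then show ?thesis using est by blast
qed

section \<open>The limit of the gradient and its relation to \<open>Omega\<close>\<close>

text \<open>Fourier density of the limit of the gradient of \<open>green\<close> for large times. At
  0 it takes the value \<open>0 / 0 = 0\<close>, and \<open>symb_times_grad_kernel\<close> remains
  true there because the cosines cancel.\<close>

definition grad_kernel :: "int \<Rightarrow> real \<Rightarrow> real" where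
  "grad_kernel x \<theta> = (cos (real_of_int (x + 1) * \<theta>) - cos (real_of_int x * \<theta>)) / symb N a \<theta>"

lemma symb_pos: "\<bar>\<theta>\<bar> \<le> pi \<Longrightarrow> \<theta> \<noteq> 0 \<Longrightarrow> symb N a \<theta> > 0"
proof -
  assume \<theta>: "\<bar>\<theta>\<bar> \<le> pi" "\<theta> \<noteq> 0"
  obtain c where "c > 0" "\<And>\<theta>. \<bar>\<theta>\<bar> \<le> pi \<Longrightarrow> c * \<theta>\<^sup>2 \<le> symb N a \<theta>" using symb_lower_bound by blast
  moreover have "c * \<theta>\<^sup>2 > 0" using \<open>c > 0\<close> \<theta> by simp
  ultimately show ?thesis using \<theta>(1) less_le_trans by blast
qed

lemma symb_times_grad_kernel:
  "\<bar>\<theta>\<bar> \<le> pi \<Longrightarrow> symb N a \<theta> * grad_kernel x \<theta> = cos (real_of_int (x + 1) * \<theta>) - cos (real_of_int x * \<theta>)"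
  using symb_pos[of \<theta>] by (cases "\<theta> = 0") (auto simp: grad_kernel_def)

lemma abs_one_minus_cos_le: "\<bar>cos d - 1\<bar> \<le> d\<^sup>2" for d :: real
  using cos_quadratic_bound[of 0 d] by simp

lemma grad_kernel_bound: "\<exists>B. \<forall>\<theta>. \<bar>\<theta>\<bar> \<le> pi \<longrightarrow> \<bar>grad_kernel x \<theta>\<bar> \<le> B"
proof -
  obtain c where c: "c > 0" "\<And>\<theta>. \<bar>\<theta>\<bar> \<le> pi \<Longrightarrow> c * \<theta>\<^sup>2 \<le> symb N a \<theta>" using symb_lower_bound by blast
  define b where "b = (real_of_int (x + 1))\<^sup>2 + (real_of_int x)\<^sup>2"
  have "\<bar>grad_kernel x \<theta>\<bar> \<le> b / c" if \<theta>: "\<bar>\<theta>\<bar> \<le> pi" for \<theta>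
  proof (cases "\<theta> = 0")
    case True
    then show ?thesis using c by (simp add: grad_kernel_def b_def)
  next
    case False
    have "\<bar>cos (real_of_int (x + 1) * \<theta>) - cos (real_of_int x * \<theta>)\<bar> \<le> (real_of_int (x + 1) * \<theta>)\<^sup>2 + (real_of_int x * \<theta>)\<^sup>2"
      using abs_one_minus_cos_le[of "real_of_int (x + 1) * \<theta>"] abs_one_minus_cos_le[of "real_of_int x * \<theta>"] by linarith
    also have "\<dots> = b * \<theta>\<^sup>2" by (simp only: b_def power_mult_distrib distrib_right)
    finally have "\<bar>grad_kernel x \<theta>\<bar> \<le> b * \<theta>\<^sup>2 / symb N a \<theta>"
      using symb_pos[OF \<theta> False] unfolding grad_kernel_def by (simp add: divide_right_mono)
    also have "\<dots> \<le> b * \<theta>\<^sup>2 / (c * \<theta>\<^sup>2)"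
      using c(2)[OF \<theta>] False c(1) symb_pos[OF \<theta> False] by (intro divide_left_mono) (auto simp: b_def)
    finally show ?thesis using False by simp
  qed
  then show ?thesis by blast
qed

lemma integrable_grad_kernel: "integrable torus (\<lambda>\<theta>. (symb N a \<theta>) ^ k * grad_kernel x \<theta>)"
proof -
  obtain B where B: "\<And>\<theta>. \<bar>\<theta>\<bar> \<le> pi \<Longrightarrow> \<bar>grad_kernel x \<theta>\<bar> \<le> B" using grad_kernel_bound by blast
  have "bounded (symb N a ` {-pi..pi})"
    by (intro compact_imp_bounded compact_continuous_image symb_continuous) auto
  then obtain A where A: "A > 0" "\<forall>\<theta>\<in>{-pi..pi}. \<bar>symb N a \<theta>\<bar> \<le> A" by (auto simp: bounded_pos)
  show ?thesis
  proof (rule integrable_torus_bounded[where B = "A ^ k * B"])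
    have "symb N a \<in> borel_measurable borel"
      by (intro borel_measurable_continuous_onI symb_continuous)
    then show "(\<lambda>\<theta>. (symb N a \<theta>) ^ k * grad_kernel x \<theta>) \<in> borel_measurable borel"
      unfolding grad_kernel_def by measurable
    fix \<theta> :: real assume \<theta>: "\<bar>\<theta>\<bar> \<le> pi"
    have "\<bar>symb N a \<theta>\<bar> \<le> A" using A(2) \<theta> by (auto simp: abs_le_iff)
    then have "\<bar>symb N a \<theta>\<bar> ^ k * \<bar>grad_kernel x \<theta>\<bar> \<le> A ^ k * B"
      using B[OF \<theta>] A(1) by (intro mult_mono power_mono) auto
    then show "\<bar>(symb N a \<theta>) ^ k * grad_kernel x \<theta>\<bar> \<le> A ^ k * B" by (simp add: abs_mult power_abs)
  qed
qed

text \<open>No time and frequency integrals are exchanged: moving the exponential term to the left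
  gives a function of \<open>t\<close> with zero derivative, which equals the first term at
  \<open>t = 0\<close>.\<close>

lemma grad_green_eq:
  assumes "t \<ge> 0"
  shows "grad (\<lambda>y. green y t) x = 1 / (2 * pi) * (\<integral>\<theta>. grad_kernel x \<theta> \<partial>torus)
     - 1 / (2 * pi) * (\<integral>\<theta>. exp (- t * symb N a \<theta>) * grad_kernel x \<theta> \<partial>torus)"
proof -
  let ?Q = "\<lambda>t. \<integral>\<theta>. exp (- t * symb N a \<theta>) * grad_kernel x \<theta> \<partial>torus"
  have "((\<lambda>t. grad (\<lambda>y. green y t) x + 1 / (2 * pi) * ?Q t) has_real_derivative 0) (at s within {0..})" if s: "s \<in> {0..}" for s
  proof -
    have "(?Q has_real_derivative - (\<integral>\<theta>. exp (- s * symb N a \<theta>) * (symb N a \<theta> * grad_kernel x \<theta>) \<partial>torus)) (at s within {0..})"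
      using integrable_grad_kernel[of 0 x] integrable_grad_kernel[of 1 x] integrable_grad_kernel[of 2 x] s
      by (intro semigroup_deriv) auto
    also have "(\<integral>\<theta>. exp (- s * symb N a \<theta>) * (symb N a \<theta> * grad_kernel x \<theta>) \<partial>torus)
       = (\<integral>\<theta>. exp (- s * symb N a \<theta>) * cos (real_of_int (x + 1) * \<theta>) - exp (- s * symb N a \<theta>) * cos (real_of_int x * \<theta>) \<partial>torus)"
    proof (rule Bochner_Integration.integral_cong[OF refl])
      fix \<theta> assume "\<theta> \<in> space torus"
      then have "\<bar>\<theta>\<bar> \<le> pi" by (auto simp: space_restrict_space)
      then show "exp (- s * symb N a \<theta>) * (symb N a \<theta> * grad_kernel x \<theta>)
         = exp (- s * symb N a \<theta>) * cos (real_of_int (x + 1) * \<theta>) - exp (- s * symb N a \<theta>) * cos (real_of_int x * \<theta>)"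
        by (simp only: symb_times_grad_kernel right_diff_distrib)
    qed
    also have "\<dots> = (\<integral>\<theta>. exp (- s * symb N a \<theta>) * cos (real_of_int (x + 1) * \<theta>) \<partial>torus) - (\<integral>\<theta>. exp (- s * symb N a \<theta>) * cos (real_of_int x * \<theta>) \<partial>torus)"
      by (intro Bochner_Integration.integral_diff integrable_torus_continuous continuous_intros symb_continuous)
    also have "\<dots> = 2 * pi * (lattice_heat (real_of_int (x + 1)) s - lattice_heat (real_of_int x) s)"
      by (simp add: lattice_heat_def right_diff_distrib)
    finally have Q: "(?Q has_real_derivative - (2 * pi * (lattice_heat (real_of_int (x + 1)) s - lattice_heat (real_of_int x) s))) (at s within {0..})" .
    have "((\<lambda>t. (green (x + 1) t - green x t) + 1 / (2 * pi) * ?Q t) has_real_derivative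
      (lattice_heat (real_of_int (x + 1)) s - lattice_heat (real_of_int x) s)
       + 1 / (2 * pi) * - (2 * pi * (lattice_heat (real_of_int (x + 1)) s - lattice_heat (real_of_int x) s))) (at s within {0..})"
      using s by (intro DERIV_add DERIV_diff DERIV_cmult Q green_deriv) auto
    then show ?thesis unfolding grad_def by (rule DERIV_cong) simp
  qed
  then obtain c where c: "\<And>s. s \<in> {0..} \<Longrightarrow> grad (\<lambda>y. green y s) x + 1 / (2 * pi) * ?Q s = c"
    using has_field_derivative_zero_constant[of "{0..}" "\<lambda>t. grad (\<lambda>y. green y t) x + 1 / (2 * pi) * ?Q t"] by auto
  have "c = 1 / (2 * pi) * (\<integral>\<theta>. grad_kernel x \<theta> \<partial>torus)"
    using c[of 0] by (simp add: grad_def green_def)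
  then show ?thesis using c[of t] assms by simp
qed

lemma grad_green_tendsto:
  "((\<lambda>t. grad (\<lambda>y. green y t) x) \<longlongrightarrow> 1 / (2 * pi) * (\<integral>\<theta>. grad_kernel x \<theta> \<partial>torus)) at_top"
proof -
  have k: "integrable torus (grad_kernel x)" using integrable_grad_kernel[of 0 x] by simp
  have "((\<lambda>t. \<integral>\<theta>. exp (- t * symb N a \<theta>) * grad_kernel x \<theta> \<partial>torus) \<longlongrightarrow> (\<integral>\<theta>. 0 \<partial>torus)) at_top"
  proof (rule integral_dominated_convergence_at_top[where w = "\<lambda>\<theta>. \<bar>grad_kernel x \<theta>\<bar>"])
    show "(\<lambda>\<theta>. 0) \<in> borel_measurable torus" by simp
    have "(\<lambda>\<theta>. exp (- t * symb N a \<theta>)) \<in> borel_measurable borel" for t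
      by (intro borel_measurable_continuous_onI continuous_intros symb_continuous)
    then have "(\<lambda>\<theta>. exp (- t * symb N a \<theta>)) \<in> borel_measurable torus" for t
      by (intro measurable_restrict_space1) simp
    then show "(\<lambda>\<theta>. exp (- t * symb N a \<theta>) * grad_kernel x \<theta>) \<in> borel_measurable torus" for t
      using k by (intro borel_measurable_times) auto
    show "integrable torus (\<lambda>\<theta>. \<bar>grad_kernel x \<theta>\<bar>)" using k by simp
    show "\<forall>\<^sub>F t in at_top. AE \<theta> in torus. norm (exp (- t * symb N a \<theta>) * grad_kernel x \<theta>) \<le> \<bar>grad_kernel x \<theta>\<bar>"
      using eventually_ge_at_top[of 0]
    proof eventually_elim
      case (elim t)
      show ?case
      proof (rule AE_I2)
        fix \<theta> assume "\<theta> \<in> space torus"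
        then have "symb N a \<theta> \<ge> 0" by (intro symb_nonneg) (auto simp: space_restrict_space)
        then have "exp (- t * symb N a \<theta>) \<le> 1" using elim by simp
        then show "norm (exp (- t * symb N a \<theta>) * grad_kernel x \<theta>) \<le> \<bar>grad_kernel x \<theta>\<bar>"
          by (simp add: abs_mult mult_left_le_one_le)
      qed
    qed
    show "AE \<theta> in torus. ((\<lambda>t. exp (- t * symb N a \<theta>) * grad_kernel x \<theta>) \<longlongrightarrow> 0) at_top"
    proof (rule AE_I2)
      fix \<theta> assume "\<theta> \<in> space torus"
      then have \<theta>: "\<bar>\<theta>\<bar> \<le> pi" by (auto simp: space_restrict_space)
      show "((\<lambda>t. exp (- t * symb N a \<theta>) * grad_kernel x \<theta>) \<longlongrightarrow> 0) at_top"
      proof (cases "\<theta> = 0")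
        case True
        then show ?thesis by (simp add: grad_kernel_def)
      next
        case False
        have "symb N a \<theta> > 0" by (rule symb_pos[OF \<theta> False])
        moreover have "((\<lambda>t. exp (- t * A)) \<longlongrightarrow> 0) at_top" if "A > 0" for A :: real using that by real_asymp
        ultimately have "((\<lambda>t. exp (- t * symb N a \<theta>)) \<longlongrightarrow> 0) at_top" by blast
        from tendsto_mult_right[OF this, of "grad_kernel x \<theta>"] show ?thesis by simp
      qed
    qed
  qed
  then have "((\<lambda>t. 1 / (2 * pi) * (\<integral>\<theta>. grad_kernel x \<theta> \<partial>torus) - 1 / (2 * pi) * (\<integral>\<theta>. exp (- t * symb N a \<theta>) * grad_kernel x \<theta> \<partial>torus))
     \<longlongrightarrow> 1 / (2 * pi) * (\<integral>\<theta>. grad_kernel x \<theta> \<partial>torus) - 1 / (2 * pi) * (\<integral>\<theta>. 0 \<partial>torus)) at_top"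
    by (intro tendsto_diff tendsto_mult_left tendsto_const)
  then have "((\<lambda>t. 1 / (2 * pi) * (\<integral>\<theta>. grad_kernel x \<theta> \<partial>torus) - 1 / (2 * pi) * (\<integral>\<theta>. exp (- t * symb N a \<theta>) * grad_kernel x \<theta> \<partial>torus))
     \<longlongrightarrow> 1 / (2 * pi) * (\<integral>\<theta>. grad_kernel x \<theta> \<partial>torus)) at_top" by simp
  moreover have "\<forall>\<^sub>F t in at_top. 1 / (2 * pi) * (\<integral>\<theta>. grad_kernel x \<theta> \<partial>torus) - 1 / (2 * pi) * (\<integral>\<theta>. exp (- t * symb N a \<theta>) * grad_kernel x \<theta> \<partial>torus)
     = grad (\<lambda>y. green y t) x"
    using eventually_ge_at_top[of 0] by eventually_elim (simp only: grad_green_eq)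
  ultimately show ?thesis by (rule Lim_transform_eventually)
qed

text \<open>Over the common denominator the numerator
  \<open>\<theta>^2 * cos (x * \<theta>) - symb N a \<theta>\<close> is
  \<open>O(\<theta>^4)\<close>, since both terms agree with \<open>\<theta>^2\<close> to that order.
  The denominator is at least \<open>c * \<theta>^4\<close>.\<close>

lemma integrable_Omega_integrand: "integrable torus (\<lambda>\<xi>. cos (real_of_int x * \<xi>) / symb N a \<xi> - 1 / \<xi>\<^sup>2)"
proof -
  obtain c where c: "c > 0" "\<And>\<theta>. \<bar>\<theta>\<bar> \<le> pi \<Longrightarrow> c * \<theta>\<^sup>2 \<le> symb N a \<theta>" using symb_lower_bound by blast
  obtain C where C: "C \<ge> 0" "\<And>\<theta>. \<bar>\<theta>\<bar> \<le> pi \<Longrightarrow> \<bar>eval_fps symb_fps (\<theta>\<^sup>2)\<bar> \<le> C * \<theta>\<^sup>2" using symb_near_0 by blast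
  show ?thesis
  proof (rule integrable_torus_bounded[where B = "((real_of_int x)\<^sup>2 + C) / c"])
    have "symb N a \<in> borel_measurable borel"
      by (intro borel_measurable_continuous_onI symb_continuous)
    then show "(\<lambda>\<xi>. cos (real_of_int x * \<xi>) / symb N a \<xi> - 1 / \<xi>\<^sup>2) \<in> borel_measurable borel"
      by measurable
    fix \<theta> :: real assume \<theta>: "\<bar>\<theta>\<bar> \<le> pi"
    show "\<bar>cos (real_of_int x * \<theta>) / symb N a \<theta> - 1 / \<theta>\<^sup>2\<bar> \<le> ((real_of_int x)\<^sup>2 + C) / c"
    proof (cases "\<theta> = 0")
      case True
      then show ?thesis using c C by simp
    next
      case False
      note A = symb_pos[OF \<theta> False]
      have "\<bar>\<theta>\<^sup>2 * (cos (real_of_int x * \<theta>) - 1)\<bar> \<le> \<theta>\<^sup>2 * (real_of_int x * \<theta>)\<^sup>2"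
        unfolding abs_mult by (intro mult_mono abs_one_minus_cos_le) auto
      moreover have "\<bar>\<theta>\<^sup>2 * eval_fps symb_fps (\<theta>\<^sup>2)\<bar> \<le> \<theta>\<^sup>2 * (C * \<theta>\<^sup>2)"
        unfolding abs_mult by (intro mult_mono C \<theta>) auto
      moreover have "\<theta>\<^sup>2 * cos (real_of_int x * \<theta>) - symb N a \<theta> = \<theta>\<^sup>2 * (cos (real_of_int x * \<theta>) - 1) + \<theta>\<^sup>2 * eval_fps symb_fps (\<theta>\<^sup>2)"
        by (simp add: symb_eq algebra_simps)
      ultimately have num: "\<bar>\<theta>\<^sup>2 * cos (real_of_int x * \<theta>) - symb N a \<theta>\<bar> \<le> ((real_of_int x)\<^sup>2 + C) * (\<theta>\<^sup>2 * \<theta>\<^sup>2)"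
        by (simp add: power_mult_distrib algebra_simps)
      have "cos (real_of_int x * \<theta>) / symb N a \<theta> - 1 / \<theta>\<^sup>2 = (\<theta>\<^sup>2 * cos (real_of_int x * \<theta>) - symb N a \<theta>) / (symb N a \<theta> * \<theta>\<^sup>2)"
        using A False by (simp add: field_simps)
      then have "\<bar>cos (real_of_int x * \<theta>) / symb N a \<theta> - 1 / \<theta>\<^sup>2\<bar> = \<bar>\<theta>\<^sup>2 * cos (real_of_int x * \<theta>) - symb N a \<theta>\<bar> / (symb N a \<theta> * \<theta>\<^sup>2)"
        using A by (simp add: abs_mult)
      also have "\<dots> \<le> ((real_of_int x)\<^sup>2 + C) * (\<theta>\<^sup>2 * \<theta>\<^sup>2) / (c * \<theta>\<^sup>2 * \<theta>\<^sup>2)"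
        using num A c False \<theta> C(1) by (intro frac_le mult_right_mono mult_pos_pos mult_nonneg_nonneg add_nonneg_nonneg) auto
      also have "\<dots> = ((real_of_int x)\<^sup>2 + C) / c"
      proof -
        have "b * (q * q) / (c * q * q) = b / c" if "q \<noteq> 0" for b q :: real using that by simp
        then show ?thesis using False by (metis zero_eq_power2)
      qed
      finally show ?thesis .
    qed
  qed
qed

lemma grad_Omega: "grad (Omega N a) x = 1 / (2 * pi) * (\<integral>\<theta>. grad_kernel x \<theta> \<partial>torus) + 1 / 2"
proof -
  let ?w = "\<lambda>x \<xi>. cos (real_of_int x * \<xi>) / symb N a \<xi> - 1 / \<xi>\<^sup>2"
  have "(\<integral>\<theta>. grad_kernel x \<theta> \<partial>torus) = (\<integral>\<theta>. ?w (x + 1) \<theta> - ?w x \<theta> \<partial>torus)"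
    by (rule Bochner_Integration.integral_cong) (simp_all add: grad_kernel_def diff_divide_distrib)
  also have "\<dots> = (\<integral>\<theta>. ?w (x + 1) \<theta> \<partial>torus) - (\<integral>\<theta>. ?w x \<theta> \<partial>torus)"
    by (intro Bochner_Integration.integral_diff integrable_Omega_integrand)
  also have "\<dots> = integral {-pi..pi} (?w (x + 1)) - integral {-pi..pi} (?w x)"
    by (simp only: integral_torus_eq_HK(2)[OF integrable_Omega_integrand])
  finally have "(\<integral>\<theta>. grad_kernel x \<theta> \<partial>torus) = integral {-pi..pi} (?w (x + 1)) - integral {-pi..pi} (?w x)" .
  then show ?thesis by (simp add: grad_def Omega_def diff_divide_distrib add_divide_distrib)
qed

lemma AE_torus_nonzero: "AE \<theta> in torus. \<theta> \<noteq> 0"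
  by (subst AE_restrict_space_iff) (auto intro: AE_mp[OF AE_lborel_singleton[of 0]])

text \<open>For \<open>N = 1\<close> the symbol is \<open>2 * (1 - cos \<theta>)\<close>, so
  \<open>grad_kernel 0\<close> is -1/2 almost everywhere, with integral \<open>- pi\<close>. Passing
  from \<open>x\<close> to \<open>x + 1\<close> subtracts \<open>cos ((x + 1) * \<theta>)\<close>
  from the kernel, because the second difference of a cosine is minus the symbol times that cosine,
  and the integral of this term vanishes.\<close>

lemma grad_Omega_eq_0:
  assumes "N = 1" "x \<ge> 0"
  shows "grad (Omega N a) x = 0"
proof -
  have "a 1 = 1" using moment_2 assms(1) by simp
  then have A: "symb N a \<theta> = 2 * (1 - cos \<theta>)" for \<theta> by (simp add: symb_def assms(1))
  have k: "integrable torus (grad_kernel y)" for y using integrable_grad_kernel[of 0 y] by simp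
  have c: "integrable torus (\<lambda>\<theta>. cos (b * \<theta>))" for b :: real
    by (intro integrable_torus_continuous continuous_intros)
  have "(\<integral>\<theta>. grad_kernel x \<theta> \<partial>torus) = - pi"
    using assms(2)
  proof (induction x rule: int_ge_induct)
    case base
    have "AE \<theta> in torus. grad_kernel 0 \<theta> = - 1 / 2"
      using AE_torus_nonzero AE_space
    proof eventually_elim
      case (elim \<theta>)
      then have "symb N a \<theta> > 0" by (intro symb_pos) (auto simp: space_restrict_space)
      then show ?case by (simp add: grad_kernel_def A field_simps)
    qed
    then have "(\<integral>\<theta>. grad_kernel 0 \<theta> \<partial>torus) = (\<integral>\<theta>. - 1 / 2 \<partial>torus)"
      using integrable_grad_kernel[of 0 0] by (intro integral_cong_AE) auto
    then show ?case by (simp only: integral_const_torus)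
  next
    case (step x)
    have "AE \<theta> in torus. grad_kernel (x + 1) \<theta> = grad_kernel x \<theta> - cos (real_of_int (x + 1) * \<theta>)"
      using AE_torus_nonzero AE_space
    proof eventually_elim
      case (elim \<theta>)
      then have pos: "symb N a \<theta> > 0" by (intro symb_pos) (auto simp: space_restrict_space)
      let ?y = "real_of_int (x + 1) * \<theta>"
      have "cos (real_of_int (x + 1 + 1) * \<theta>) - cos ?y = cos ?y - cos (real_of_int x * \<theta>) - symb N a \<theta> * cos ?y"
      proof -
        have eqs: "real_of_int (x + 1 + 1) * \<theta> = ?y + \<theta>" "real_of_int x * \<theta> = ?y - \<theta>"
          by (simp_all add: algebra_simps)
        have "cos (y + \<theta>) - cos y = cos y - cos (y - \<theta>) - 2 * (1 - cos \<theta>) * cos y" for y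
          by (simp add: cos_add cos_diff algebra_simps)
        then show ?thesis unfolding A eqs .
      qed
      then show ?case using pos unfolding grad_kernel_def by (simp add: field_simps)
    qed
    then have "(\<integral>\<theta>. grad_kernel (x + 1) \<theta> \<partial>torus) = (\<integral>\<theta>. grad_kernel x \<theta> - cos (real_of_int (x + 1) * \<theta>) \<partial>torus)"
      by (intro integral_cong_AE borel_measurable_integrable Bochner_Integration.integrable_diff k c)
    also have "\<dots> = (\<integral>\<theta>. grad_kernel x \<theta> \<partial>torus) - (\<integral>\<theta>. cos (real_of_int (x + 1) * \<theta>) \<partial>torus)"
      by (intro Bochner_Integration.integral_diff k c)
    finally show ?case using step integral_cos_torus[of "x + 1"] by simp
  qed
  then show ?thesis by (simp add: grad_Omega)
qed

end

section \<open>The expansion of the gradient\<close>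

text \<open>The function is t^(1/2 - n) F(x / sqrt t). The case \<open>n = 0\<close> serves f0,
  positive \<open>n\<close> the correctors, and constant \<open>F\<close> the integrated error
  bound.\<close>

lemma has_derivative_self_similar:
  fixes F F' :: "real \<Rightarrow> real"
  assumes F: "\<And>y. (F has_real_derivative F' y) (at y)" and t: "t > 0"
  shows "((\<lambda>t. sqrt t / t ^ n * F (x / sqrt t)) has_real_derivative
     ((1 / 2 - real n) * F (x / sqrt t) - x / sqrt t / 2 * F' (x / sqrt t)) / (sqrt t * t ^ n)) (at t)"
proof -
  have s: "(sqrt has_real_derivative 1 / (2 * sqrt t)) (at t)"
    using t by (auto intro!: derivative_eq_intros simp: field_simps)
  have p: "((\<lambda>t. 1 / t ^ n) has_real_derivative - (real n / (t * t ^ n))) (at t)"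
  proof -
    have "t ^ n \<noteq> 0" using t by simp
    from DERIV_divide[OF DERIV_const DERIV_pow this, of 1] show ?thesis
      by (rule DERIV_cong) (use t in \<open>cases n; simp add: field_simps\<close>)
  qed
  have y: "((\<lambda>t. x / sqrt t) has_real_derivative - (x / sqrt t) / (2 * t)) (at t)"
    using t by (auto intro!: derivative_eq_intros s simp: field_simps)
  have D: "((\<lambda>t. (sqrt t * (1 / t ^ n)) * F (x / sqrt t)) has_real_derivative
     (1 / (2 * sqrt t) * (1 / t ^ n) + (- (real n / (t * t ^ n))) * sqrt t) * F (x / sqrt t)
      + (F' (x / sqrt t) * (- (x / sqrt t) / (2 * t))) * (sqrt t * (1 / t ^ n))) (at t)"
    by (intro DERIV_mult s p DERIV_chain2[OF F y])
  have E: "(1 / (2 * sqrt t) * (1 / t ^ n) + (- (real n / (t * t ^ n))) * sqrt t) * f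
      + (f' * (- z / (2 * t))) * (sqrt t * (1 / t ^ n))
     = ((1 / 2 - real n) * f - z / 2 * f') / (sqrt t * t ^ n)" for f f' z
  proof -
    define r where "r = sqrt t"
    have r: "r > 0" "sqrt t = r" "t = r * r" using t by (simp_all add: r_def)
    show ?thesis unfolding r(2) unfolding r(3) using r(1) by (simp add: field_simps)
  qed
  show ?thesis using DERIV_cong[OF D E] by (simp only: times_divide_eq_right mult_1_right)
qed

text \<open>Surplus powers of \<open>1 / r\<close> are absorbed into a constant depending on
  \<open>r0\<close>.\<close>

lemma inverse_power_le:
  fixes r r0 :: real
  assumes "0 < r0" "r0 \<le> r" "k \<le> e"
  shows "1 / r ^ e \<le> 1 / r0 ^ (e - k) / r ^ k"
proof -
  have "r ^ e = r ^ (e - k) * r ^ k" using assms(3) by (simp flip: power_add)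
  then show ?thesis
    using assms power_mono[of r0 r "e - k"] by (simp add: divide_simps mult_mono)
qed

lemma taylor_step_bound:
  fixes F :: "nat \<Rightarrow> real \<Rightarrow> real"
  assumes F: "\<And>j y. (F j has_real_derivative F (Suc j) y) (at y)"
    and B: "\<And>y. y \<ge> 0 \<Longrightarrow> \<bar>F (Suc J) y\<bar> \<le> B" and w: "w \<ge> 0" "d \<ge> 0"
  shows "\<bar>F 0 (w + d) - F 0 w - (\<Sum>j=1..J. F j w * d ^ j / fact j)\<bar> \<le> B * d ^ Suc J"
proof -
  have "norm (F 0 (w + d) - (\<Sum>i\<le>J. F i w * (w + d - w) ^ i / fact i)) \<le> B * norm (w + d - w) ^ Suc J / fact J"
    by (rule field_Taylor[where S = "{0..}"])
       (use w B F in \<open>auto intro: has_field_derivative_at_within\<close>)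
  also have "\<dots> \<le> B * norm (w + d - w) ^ Suc J / 1"
    using order_trans[OF abs_ge_zero B[OF w(1)]] by (intro divide_left_mono mult_nonneg_nonneg) auto
  also have "(\<Sum>i\<le>J. F i w * (w + d - w) ^ i / fact i) = F 0 w + (\<Sum>j=1..J. F j w * d ^ j / fact j)"
  proof -
    have "{..J} = insert 0 {1..J}" by auto
    then show ?thesis by simp
  qed
  finally show ?thesis using w by (simp add: algebra_simps)
qed

context stencil
begin

section \<open>The Green function minus its self-similar terms\<close>

definition corrector :: "nat \<Rightarrow> nat \<Rightarrow> real \<Rightarrow> real" where
  "corrector n = f_deriv (P_poly N a n) n"

lemma corrector_deriv: "(corrector n j has_real_derivative corrector n (Suc j) y) (at y)"
  unfolding corrector_def by (rule f_deriv_deriv)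

definition residual :: "nat \<Rightarrow> int \<Rightarrow> real \<Rightarrow> real" where
  "residual M x t = green x t - sqrt t * f0_deriv 0 (real_of_int x / sqrt t)
     - (\<Sum>n=N..M. sqrt t / t ^ n * corrector n 0 (real_of_int x / sqrt t))"

lemma residual_deriv:
  assumes "t > 0"
  shows "(residual M x has_real_derivative lattice_heat (real_of_int x) t - 1 / sqrt t *
     (heat_profile (real_of_int x / sqrt t) + (\<Sum>n=N..M. h0_fun N a n (real_of_int x / sqrt t) / t ^ n))) (at t)"
proof -
  let ?y = "real_of_int x / sqrt t"
  have within: "at t within {0..} = at t" using assms by (intro at_within_open_subset[of _ "{0<..}"]) auto
  have g: "(green x has_real_derivative lattice_heat (real_of_int x) t) (at t)"
    using green_deriv[of t x] assms by (simp add: within)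
  \<comment> \<open>The counterpart of \<open>f_deriv_euler\<close> for the leading profile: f0 - y
    f0' = 2 h.\<close>
  have eq0: "((1 / 2 - real 0) * f0_deriv 0 ?y - ?y / 2 * f0_deriv (Suc 0) ?y) / (sqrt t * t ^ 0) = heat_profile ?y / sqrt t"
    by (simp add: algebra_simps diff_divide_distrib)
  have f0: "((\<lambda>t. sqrt t * f0_deriv 0 (real_of_int x / sqrt t)) has_real_derivative heat_profile ?y / sqrt t) (at t)"
    using has_derivative_self_similar[OF f0_deriv_deriv assms, of 0 0 "real_of_int x"]
    unfolding eq0 by (simp only: power_0 div_by_1)
  have fn: "((\<lambda>t. sqrt t / t ^ n * corrector n 0 (real_of_int x / sqrt t)) has_real_derivative
      h0_fun N a n ?y / (sqrt t * t ^ n)) (at t)" if n: "n \<in> {N..M}" for n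
  proof -
    have "(1 / 2 - real n) * corrector n 0 ?y - ?y / 2 * corrector n 1 ?y
        = - 1 / 2 * ((2 * real n - 1) * corrector n 0 ?y + ?y * corrector n 1 ?y)"
      by (simp add: algebra_simps)
    also have "\<dots> = h0_fun N a n ?y"
      using f_deriv_euler[of n "P_poly N a n" ?y] n N_pos by (simp only: corrector_def h0_fun_eq_gauss_int) simp
    finally have "(1 / 2 - real n) * corrector n 0 ?y - ?y / 2 * corrector n 1 ?y = h0_fun N a n ?y" .
    moreover have "((\<lambda>t. sqrt t / t ^ n * corrector n 0 (real_of_int x / sqrt t)) has_real_derivative
      ((1 / 2 - real n) * corrector n 0 ?y - ?y / 2 * corrector n 1 ?y) / (sqrt t * t ^ n)) (at t)"
      by (rule has_derivative_self_similar[OF _ assms]) (simp add: corrector_deriv)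
    ultimately show ?thesis by (simp only:)
  qed
  have "(residual M x has_real_derivative lattice_heat (real_of_int x) t - heat_profile ?y / sqrt t
      - (\<Sum>n=N..M. h0_fun N a n ?y / (sqrt t * t ^ n))) (at t)"
    unfolding residual_def[abs_def] by (intro DERIV_diff DERIV_sum g f0 fn)
  then show ?thesis
    by (rule DERIV_cong) (simp add: distrib_left sum_distrib_left)
qed

text \<open>The function \<open>\<Psi>\<close> has minus the kernel error bound as derivative. Hence
  \<open>residual + \<Psi>\<close> decreases and \<open>residual - \<Psi>\<close> increases, which
  bounds all later changes of the residual by \<open>\<Psi> t\<close>.\<close>

lemma residual_cauchy:
  assumes "t0 > 0"
  shows "\<exists>C\<ge>0. \<forall>t\<ge>t0. \<forall>T\<ge>t. \<forall>x. \<bar>residual M x T - residual M x t\<bar> \<le> C * (sqrt t / t ^ (M + 1))"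
proof -
  obtain C where C: "C \<ge> 0" "\<And>t x. t \<ge> t0 \<Longrightarrow> \<bar>lattice_heat x t - 1 / sqrt t *
     (heat_profile (x / sqrt t) + (\<Sum>n=N..M. h0_fun N a n (x / sqrt t) / t ^ n))\<bar> \<le> C / (sqrt t * t ^ (M + 1))"
    using lattice_heat_expansion[OF assms, of M] by blast
  \<comment> \<open>Differentiating t^(1/2 - (M + 1)) produces the factor -(M + 1/2), which this
    cancels.\<close>
  define c where "c = C / (real M + 1 / 2)"
  have c0: "c \<ge> 0" using C(1) by (simp add: c_def)
  define \<Psi> where "\<Psi> t = c * (sqrt t / t ^ (M + 1))" for t
  have \<Psi>0: "\<Psi> t \<ge> 0" if "t > 0" for t using that c0 by (simp add: \<Psi>_def)
  have \<Psi>: "(\<Psi> has_real_derivative - C / (sqrt t * t ^ (M + 1))) (at t)" if "t > 0" for t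
  proof -
    have "((\<lambda>t. sqrt t / t ^ (M + 1) * 1) has_real_derivative
       ((1 / 2 - real (M + 1)) * 1 - 1 / sqrt t / 2 * 0) / (sqrt t * t ^ (M + 1))) (at t)"
      by (rule has_derivative_self_similar[OF DERIV_const that])
    then have "((\<lambda>t. c * (sqrt t / t ^ (M + 1) * 1)) has_real_derivative
       c * (((1 / 2 - real (M + 1)) * 1 - 1 / sqrt t / 2 * 0) / (sqrt t * t ^ (M + 1)))) (at t)"
      by (rule DERIV_cmult)
    moreover have "c * (((1 / 2 - real (M + 1)) * 1 - 1 / sqrt t / 2 * 0) / (sqrt t * t ^ (M + 1))) = - C / (sqrt t * t ^ (M + 1))"
    proof -
      have "c * (1 / 2 - real (M + 1)) = - C"
        unfolding c_def by (simp add: divide_simps) (simp add: algebra_simps)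
      then show ?thesis by (simp only: mult_1_right mult_zero_right diff_zero times_divide_eq_right)
    qed
    ultimately show ?thesis by (simp only: \<Psi>_def[abs_def] mult_1_right)
  qed
  have "\<bar>residual M x T - residual M x t\<bar> \<le> c * (sqrt t / t ^ (M + 1))" if t: "t \<ge> t0" "T \<ge> t" for t T x
  proof -
    define e where "e s = lattice_heat (real_of_int x) s - 1 / sqrt s *
       (heat_profile (real_of_int x / sqrt s) + (\<Sum>n=N..M. h0_fun N a n (real_of_int x / sqrt s) / s ^ n))" for s
    have e: "\<bar>e s\<bar> \<le> C / (sqrt s * s ^ (M + 1))" if "s \<ge> t" for s
      using C(2)[of s "real_of_int x"] that t by (simp add: e_def)
    have res: "(residual M x has_real_derivative e s) (at s)" if "s \<ge> t" for s
      using residual_deriv[of s M x] that t assms by (simp add: e_def)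
    have \<Psi>': "(\<Psi> has_real_derivative - C / (sqrt s * s ^ (M + 1))) (at s)" if "s \<ge> t" for s
      using \<Psi>[of s] that t assms by simp
    have "residual M x T + \<Psi> T \<le> residual M x t + \<Psi> t"
    proof (rule DERIV_nonpos_imp_nonincreasing[OF t(2)])
      fix s assume s: "t \<le> s" "s \<le> T"
      have "((\<lambda>s. residual M x s + \<Psi> s) has_real_derivative e s + - C / (sqrt s * s ^ (M + 1))) (at s)"
        using s by (intro DERIV_add res \<Psi>')
      moreover have "e s + - C / (sqrt s * s ^ (M + 1)) \<le> 0" using e[OF s(1)] by (simp add: abs_le_iff)
      ultimately show "\<exists>d. ((\<lambda>s. residual M x s + \<Psi> s) has_real_derivative d) (at s) \<and> d \<le> 0" by blast
    qed
    moreover have "residual M x t - \<Psi> t \<le> residual M x T - \<Psi> T"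
    proof (rule DERIV_nonneg_imp_nondecreasing[OF t(2)])
      fix s assume s: "t \<le> s" "s \<le> T"
      have "((\<lambda>s. residual M x s - \<Psi> s) has_real_derivative e s - - C / (sqrt s * s ^ (M + 1))) (at s)"
        using s by (intro DERIV_diff res \<Psi>')
      moreover have "e s - - C / (sqrt s * s ^ (M + 1)) \<ge> 0" using e[OF s(1)] by (simp add: abs_le_iff)
      ultimately show "\<exists>d. ((\<lambda>s. residual M x s - \<Psi> s) has_real_derivative d) (at s) \<and> d \<ge> 0" by blast
    qed
    moreover have "\<Psi> T \<ge> 0" using t assms by (intro \<Psi>0) simp
    ultimately have "\<bar>residual M x T - residual M x t\<bar> \<le> \<Psi> t" by (simp add: abs_le_iff)
    then show ?thesis by (simp add: \<Psi>_def)
  qed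
  then show ?thesis using c0 by blast
qed

text \<open>The correctors are bounded and carry the factor T^(1/2 - n) with n at least 1, so they
  disappear. The f0 term does not: over a step of length \<open>1 / sqrt T\<close> near 0 its scaled
  difference tends to f0'(0) = -1/2, which turns the limit of the gradient of \<open>green\<close>
  into that of \<open>Omega\<close>.\<close>

lemma grad_residual_tendsto:
  assumes "x \<ge> 0"
  shows "((\<lambda>T. grad (\<lambda>y. residual M y T) x) \<longlongrightarrow> grad (Omega N a) x) at_top"
proof -
  let ?x = "real_of_int x"
  obtain B0 where B0: "\<And>y. \<bar>gauss_int 1 0 y\<bar> \<le> B0" using gauss_int_bound by blast
  have eq: "grad (\<lambda>y. residual M y T) x = grad (\<lambda>y. green y T) x
     - sqrt T * (f0_deriv 0 ((?x + 1) / sqrt T) - f0_deriv 0 (?x / sqrt T))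
     - (\<Sum>n=N..M. sqrt T / T ^ n * (corrector n 0 ((?x + 1) / sqrt T) - corrector n 0 (?x / sqrt T)))" for T
    by (simp add: grad_def residual_def algebra_simps sum_subtractf del: f0_deriv.simps)
  have f0: "((\<lambda>T. sqrt T * (f0_deriv 0 ((?x + 1) / sqrt T) - f0_deriv 0 (?x / sqrt T))) \<longlongrightarrow> - 1 / 2) at_top"
  proof (rule LIM_zero_cancel, rule Lim_null_comparison)
    have "((\<lambda>T::real. inverse (sqrt T)) \<longlongrightarrow> 0) at_top"
      by (intro tendsto_inverse_0_at_top sqrt_at_top)
    from tendsto_mult_right[OF this, of "B0 * (?x + 1)"]
    show "((\<lambda>T. inverse (sqrt T) * (B0 * (?x + 1))) \<longlongrightarrow> 0) at_top" by simp
    show "\<forall>\<^sub>F T in at_top. norm (sqrt T * (f0_deriv 0 ((?x + 1) / sqrt T) - f0_deriv 0 (?x / sqrt T)) - - 1 / 2)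
       \<le> inverse (sqrt T) * (B0 * (?x + 1))"
      using eventually_gt_at_top[of 0]
    proof eventually_elim
      case (elim T)
      have lt: "?x / sqrt T < (?x + 1) / sqrt T" using elim by (simp add: divide_strict_right_mono)
      \<comment> \<open>A first mean value step expresses the difference by f0' at a point
        \<open>z\<close> of order \<open>1 / sqrt T\<close>; a second one compares that slope with
        the slope at 0. Nonnegative \<open>x\<close> ensures \<open>z > 0\<close>.\<close>
      obtain z where z: "?x / sqrt T < z" "z < (?x + 1) / sqrt T"
        "f0_deriv 0 ((?x + 1) / sqrt T) - f0_deriv 0 (?x / sqrt T) = ((?x + 1) / sqrt T - ?x / sqrt T) * f0_deriv 1 z"
        using MVT2[OF lt, of "f0_deriv 0" "f0_deriv 1"] f0_deriv_deriv[of 0] by auto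
      have z0: "z > 0" using z(1) assms elim by (meson divide_nonneg_nonneg le_less_trans of_int_0_le_iff real_sqrt_ge_zero less_imp_le)
      obtain u where u: "0 < u" "u < z" "f0_deriv 1 z - f0_deriv 1 0 = (z - 0) * f0_deriv 2 u"
        using MVT2[OF z0, of "f0_deriv 1" "f0_deriv 2"] f0_deriv_deriv[of 1] by (auto simp: numeral_2_eq_2)
      have "f0_deriv 1 0 = - 1 / 2" by (simp add: heat_tail_def zero_ereal_def)
      then have "sqrt T * (f0_deriv 0 ((?x + 1) / sqrt T) - f0_deriv 0 (?x / sqrt T)) - - 1 / 2 = z * gauss_int 1 0 u"
        using z(3) u(3) elim by (simp add: numeral_2_eq_2 flip: diff_divide_distrib)
      also have "norm \<dots> \<le> (?x + 1) / sqrt T * B0"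
        unfolding real_norm_def abs_mult using z z0 B0[of u] by (intro mult_mono) auto
      finally show ?case by (simp add: field_simps)
    qed
  qed
  have fn: "((\<lambda>T. sqrt T / T ^ n * (corrector n 0 ((?x + 1) / sqrt T) - corrector n 0 (?x / sqrt T))) \<longlongrightarrow> 0) at_top"
    if n: "n \<in> {N..M}" for n
  proof -
    obtain B where B: "\<And>y. \<bar>corrector n 0 y\<bar> \<le> B" unfolding corrector_def using f_deriv_bound by blast
    show ?thesis
    proof (rule Lim_null_comparison)
      have "((\<lambda>T::real. inverse (sqrt T)) \<longlongrightarrow> 0) at_top"
        by (intro tendsto_inverse_0_at_top sqrt_at_top)
      from tendsto_mult_right[OF this, of "2 * B"]
      show "((\<lambda>T. inverse (sqrt T) * (2 * B)) \<longlongrightarrow> 0) at_top" by simp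
      show "\<forall>\<^sub>F T in at_top. norm (sqrt T / T ^ n * (corrector n 0 ((?x + 1) / sqrt T) - corrector n 0 (?x / sqrt T)))
         \<le> inverse (sqrt T) * (2 * B)"
        using eventually_ge_at_top[of 1]
      proof eventually_elim
        case (elim T)
        have "T ^ 1 \<le> T ^ n" using elim n N_pos by (intro power_increasing) auto
        then have "sqrt T / T ^ n \<le> sqrt T / T" using elim by (intro divide_left_mono) auto
        also have "\<dots> = inverse (sqrt T)" using elim by (simp add: real_div_sqrt field_simps)
        finally have "sqrt T / T ^ n \<le> inverse (sqrt T)" .
        moreover have "\<bar>corrector n 0 ((?x + 1) / sqrt T) - corrector n 0 (?x / sqrt T)\<bar> \<le> 2 * B"
          using B[of "(?x + 1) / sqrt T"] B[of "?x / sqrt T"] by linarith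
        ultimately have "\<bar>sqrt T / T ^ n\<bar> * \<bar>corrector n 0 ((?x + 1) / sqrt T) - corrector n 0 (?x / sqrt T)\<bar> \<le> inverse (sqrt T) * (2 * B)"
          using elim by (intro mult_mono) auto
        then show ?case by (simp add: abs_mult)
      qed
    qed
  qed
  have "((\<lambda>T. grad (\<lambda>y. residual M y T) x) \<longlongrightarrow> 1 / (2 * pi) * (\<integral>\<theta>. grad_kernel x \<theta> \<partial>torus) - (- 1 / 2) - (\<Sum>n=N..M. 0)) at_top"
    unfolding eq by (intro tendsto_diff tendsto_sum grad_green_tendsto f0 fn)
  then show ?thesis by (simp add: grad_Omega)
qed

text \<open>The Cauchy estimate with the later time \<open>T\<close> sent to infinity; the factor 2
  accounts for the two lattice points of the gradient.\<close>

lemma grad_residual_bound: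
  assumes "t0 > 0"
  shows "\<exists>C\<ge>0. \<forall>t\<ge>t0. \<forall>x\<ge>0. \<bar>grad (\<lambda>y. residual M y t) x - grad (Omega N a) x\<bar> \<le> C * (sqrt t / t ^ (M + 1))"
proof -
  obtain C where C: "C \<ge> 0" "\<And>t T x. t \<ge> t0 \<Longrightarrow> T \<ge> t \<Longrightarrow> \<bar>residual M x T - residual M x t\<bar> \<le> C * (sqrt t / t ^ (M + 1))"
    using residual_cauchy[OF assms, of M] by blast
  have "\<bar>grad (\<lambda>y. residual M y t) x - grad (Omega N a) x\<bar> \<le> 2 * C * (sqrt t / t ^ (M + 1))" if t: "t \<ge> t0" and x: "x \<ge> 0" for t x
  proof (rule tendsto_upperbound)
    show "((\<lambda>T. \<bar>grad (\<lambda>y. residual M y t) x - grad (\<lambda>y. residual M y T) x\<bar>) \<longlongrightarrow> \<bar>grad (\<lambda>y. residual M y t) x - grad (Omega N a) x\<bar>) at_top"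
      by (intro tendsto_intros grad_residual_tendsto x)
    show "\<forall>\<^sub>F T in at_top. \<bar>grad (\<lambda>y. residual M y t) x - grad (\<lambda>y. residual M y T) x\<bar> \<le> 2 * C * (sqrt t / t ^ (M + 1))"
      using eventually_ge_at_top[of t]
    proof eventually_elim
      case (elim T)
      show ?case using C(2)[OF t elim, of x] C(2)[OF t elim, of "x + 1"] unfolding grad_def by linarith
    qed
  qed simp
  then show ?thesis using C(1) by (intro exI[of _ "2 * C"]) auto
qed

lemma hderiv_corrector: "y \<ge> 0 \<Longrightarrow> s \<ge> N \<Longrightarrow> hderiv j (f_fun N a s) y = corrector s j y"
  using N_pos by (simp add: corrector_def hderiv_f_fun)

section \<open>Taylor expansion in the step 1 / sqrt t and regrouping by powers\<close>

lemma g_fun_eq: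
  assumes "y \<ge> 0"
  shows "g_fun N a n y = f0_deriv (n + 1) y / fact (n + 1) +
     (\<Sum>(s, j)\<in>{(s, j). s \<ge> N \<and> j \<ge> 1 \<and> 2 * s + j - 1 = n}. corrector s j y / fact j)"
  unfolding g_fun_def hderiv_f0_fun[OF assms]
  by (auto simp: hderiv_corrector assms simp del: f0_deriv.simps fact_Suc intro!: sum.cong)

text \<open>With \<open>r = sqrt t\<close>, the \<open>j\<close>-th Taylor term of f0 has order
  \<open>j - 1\<close> in \<open>1 / r\<close>, that of the corrector \<open>s\<close> has order
  \<open>2 * s + j - 1\<close>. Correctors start at order 2, so orders 0 and 1 come from f0 alone
  and give g and h / 2. The upper limit \<open>K + 1 - 2 * s\<close> cuts at order \<open>K\<close>,
  truncated subtraction emptying the range when \<open>2 * s > K\<close>. The condition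
  \<open>K \<le> M\<close> ensures that every pair in \<open>g_fun\<close> occurs.\<close>

lemma taylor_sums_eq_profiles:
  assumes r: "r > 0" and y: "y \<ge> 0" and K: "K \<ge> 2" "K \<le> M"
  shows "(\<Sum>j=1..K + 1. r * (f0_deriv j y * (1 / r) ^ j / fact j))
     + (\<Sum>s=N..M. \<Sum>j=1..K + 1 - 2 * s. r / r ^ (2 * s) * (corrector s j y * (1 / r) ^ j / fact j))
     = g0_fun y + 1 / (2 * r) * heat_profile y + (\<Sum>n=2..K. 1 / r ^ n * g_fun N a n y)"
proof -
  define Z where "Z = (SIGMA s:{N..M}. {1..K + 1 - 2 * s})"
  have finZ: "finite Z" by (simp add: Z_def)
  have power: "r / r ^ (2 * s) * (c * (1 / r) ^ j / fact j) = 1 / r ^ (2 * s + j - 1) * (c / fact j)"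
    if pos: "1 \<le> 2 * s + j" for s j c
  proof -
    obtain k where k: "2 * s + j = Suc k" using pos by (cases "2 * s + j") auto
    then have "r ^ (2 * s) * r ^ j = r * r ^ k" by (simp flip: power_add)
    then have "r / (r ^ (2 * s) * r ^ j) = 1 / r ^ k" using r by simp
    moreover have "r / r ^ (2 * s) * (c * (1 / r) ^ j / fact j) = r / (r ^ (2 * s) * r ^ j) * (c / fact j)"
      by (simp add: power_one_over)
    ultimately show ?thesis using k by simp
  qed
  have "(\<Sum>j=1..K + 1. r * (f0_deriv j y * (1 / r) ^ j / fact j))
     = (\<Sum>n=0..K. 1 / r ^ n * (f0_deriv (n + 1) y / fact (n + 1)))"
  proof -
    have "(\<Sum>j=1..K + 1. r * (f0_deriv j y * (1 / r) ^ j / fact j))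
       = (\<Sum>n=0..K. r * (f0_deriv (n + 1) y * (1 / r) ^ (n + 1) / fact (n + 1)))"
      using sum.shift_bounds_cl_nat_ivl[of "\<lambda>j. r * (f0_deriv j y * (1 / r) ^ j / fact j)" 0 1 K] by simp
    also have "\<dots> = (\<Sum>n=0..K. 1 / r ^ n * (f0_deriv (n + 1) y / fact (n + 1)))"
    proof (intro sum.cong refl)
      fix n
      show "r * (f0_deriv (n + 1) y * (1 / r) ^ (n + 1) / fact (n + 1)) = 1 / r ^ n * (f0_deriv (n + 1) y / fact (n + 1))"
        using power[of 0 "n + 1" "f0_deriv (n + 1) y"]
        by (simp only: mult_0_right power_0 div_by_1 add_0 add_diff_cancel_right')
    qed
    finally show ?thesis .
  qed
  also have "{0..K} = insert 0 (insert 1 {2..K})" using K by auto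
  finally have f0: "(\<Sum>j=1..K + 1. r * (f0_deriv j y * (1 / r) ^ j / fact j))
     = g0_fun y + 1 / (2 * r) * heat_profile y + (\<Sum>n=2..K. 1 / r ^ n * (f0_deriv (n + 1) y / fact (n + 1)))"
    using y by (simp add: g0_fun_eq heat_profile_eq_gauss_int numeral_2_eq_2)
  have "(\<Sum>s=N..M. \<Sum>j=1..K + 1 - 2 * s. r / r ^ (2 * s) * (corrector s j y * (1 / r) ^ j / fact j))
     = (\<Sum>(s, j)\<in>Z. r / r ^ (2 * s) * (corrector s j y * (1 / r) ^ j / fact j))"
    unfolding Z_def by (intro sum.Sigma) auto
  also have "\<dots> = (\<Sum>(s, j)\<in>Z. 1 / r ^ (2 * s + j - 1) * (corrector s j y / fact j))"
    unfolding split_def by (intro sum.cong refl power) (auto simp: Z_def)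
  also have "\<dots> = (\<Sum>n=2..K. \<Sum>p\<in>{p \<in> Z. (case p of (s, j) \<Rightarrow> 2 * s + j - 1) = n}.
      (case p of (s, j) \<Rightarrow> 1 / r ^ (2 * s + j - 1) * (corrector s j y / fact j)))"
    using N_pos by (intro sum.group[symmetric] finZ) (auto simp: Z_def)
  also have "\<dots> = (\<Sum>n=2..K. 1 / r ^ n * (\<Sum>(s, j)\<in>{(s, j). s \<ge> N \<and> j \<ge> 1 \<and> 2 * s + j - 1 = n}. corrector s j y / fact j))"
  proof (intro sum.cong refl)
    fix n assume n: "n \<in> {2..K}"
    have set: "{p \<in> Z. (case p of (s, j) \<Rightarrow> 2 * s + j - 1) = n} = {(s, j). s \<ge> N \<and> j \<ge> 1 \<and> 2 * s + j - 1 = n}"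
      using n K by (auto simp: Z_def)
    show "(\<Sum>p\<in>{p \<in> Z. (case p of (s, j) \<Rightarrow> 2 * s + j - 1) = n}.
        (case p of (s, j) \<Rightarrow> 1 / r ^ (2 * s + j - 1) * (corrector s j y / fact j)))
      = 1 / r ^ n * (\<Sum>(s, j)\<in>{(s, j). s \<ge> N \<and> j \<ge> 1 \<and> 2 * s + j - 1 = n}. corrector s j y / fact j)"
      unfolding set sum_distrib_left by (intro sum.cong refl) auto
  qed
  finally show ?thesis
    unfolding f0 g_fun_eq[OF y] by (simp add: distrib_left sum.distrib del: f0_deriv.simps fact_Suc)
qed

lemma grad_green_expansion:
  assumes t0: "t0 > 0" and K: "K \<ge> 2"
  shows "\<exists>R\<ge>0. \<forall>x\<ge>0. \<forall>t\<ge>t0. \<bar>grad (\<lambda>y. green y t) x - (grad (Omega N a) x + g0_fun (real_of_int x / sqrt t)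
     + 1 / (2 * sqrt t) * heat_profile (real_of_int x / sqrt t)
     + (\<Sum>n=2..K. 1 / sqrt t ^ n * g_fun N a n (real_of_int x / sqrt t)))\<bar> \<le> R / sqrt t ^ (K + 1)"
proof -
  \<comment> \<open>Large enough both for \<open>K \<le> M\<close> and for the integrated kernel
    error, of order \<open>1 / r ^ (2 * M + 1)\<close> with \<open>r = sqrt t\<close>, to be
    absorbed by the claimed remainder.\<close>
  define M where "M = K + N"
  define r0 where "r0 = sqrt t0"
  have r0: "r0 > 0" using t0 by (simp add: r0_def)
  obtain C where C: "C \<ge> 0" "\<And>t x. t \<ge> t0 \<Longrightarrow> x \<ge> 0 \<Longrightarrow>
      \<bar>grad (\<lambda>y. residual M y t) x - grad (Omega N a) x\<bar> \<le> C * (sqrt t / t ^ (M + 1))"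
    using grad_residual_bound[OF t0, of M] by blast
  \<comment> \<open>\<open>gauss_int 1 K\<close> is \<open>f0_deriv (K + 2)\<close>, the derivative
    in the remainder after \<open>K + 1\<close> Taylor terms of f0.\<close>
  obtain B0 where B0: "\<And>y. \<bar>gauss_int 1 K y\<bar> \<le> B0" using gauss_int_bound by blast
  \<comment> \<open>With \<open>J n\<close> Taylor terms the remainder of corrector \<open>n\<close>
    has order \<open>2 * n + J n\<close>, which is at least \<open>K + 1\<close>. For large
    \<open>n\<close> truncation gives \<open>J n = 0\<close>: no Taylor terms remain, and the whole
    difference counts as remainder.\<close>
  define J where "J n = K + 1 - 2 * n" for n
  have "\<exists>B. \<forall>y. \<bar>corrector n (Suc (J n)) y\<bar> \<le> B" for n
    unfolding corrector_def by (rule f_deriv_bound)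
  then obtain B where B: "\<And>n y. \<bar>corrector n (Suc (J n)) y\<bar> \<le> B n" by metis
  have B_nonneg: "B0 \<ge> 0" "B n \<ge> 0" for n
    using B0[of 0] B[of n 0] by linarith+
  define R where "R = C / r0 ^ (2 * M + 1 - (K + 1)) + B0 + (\<Sum>n=N..M. B n / r0 ^ (2 * n + J n - (K + 1)))"
  have "R \<ge> 0" unfolding R_def using C(1) B_nonneg r0 by (intro add_nonneg_nonneg sum_nonneg) auto
  moreover have "\<bar>grad (\<lambda>y. green y t) x - (grad (Omega N a) x + g0_fun (real_of_int x / sqrt t)
     + 1 / (2 * sqrt t) * heat_profile (real_of_int x / sqrt t)
     + (\<Sum>n=2..K. 1 / sqrt t ^ n * g_fun N a n (real_of_int x / sqrt t)))\<bar> \<le> R / sqrt t ^ (K + 1)"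
    if x: "x \<ge> 0" and t: "t \<ge> t0" for x t
  proof -
    define r where "r = sqrt t"
    have r: "r0 \<le> r" "r > 0" using t r0 by (auto simp: r_def r0_def)
    have rt: "sqrt t = r" "t = r\<^sup>2" using t t0 by (simp_all add: r_def)
    define y where "y = real_of_int x / r"
    have y: "y \<ge> 0" using x r by (simp add: y_def)
    have y1: "real_of_int (x + 1) / r = y + 1 / r" by (simp add: y_def add_divide_distrib)
    let ?A = "f0_deriv 0 (y + 1 / r) - f0_deriv 0 y"
    let ?B = "\<lambda>n. corrector n 0 (y + 1 / r) - corrector n 0 y"
    have split: "grad (\<lambda>y. green y t) x = grad (\<lambda>y. residual M y t) x + r * ?A + (\<Sum>n=N..M. r / r ^ (2 * n) * ?B n)"
      unfolding grad_def residual_def rt(1) y1 unfolding rt(2) power_mult[symmetric]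
      by (simp add: y_def[symmetric] right_diff_distrib sum_subtractf del: f0_deriv.simps)
    define S0 where "S0 = (\<Sum>j=1..K + 1. r * (f0_deriv j y * (1 / r) ^ j / fact j))"
    define S where "S n = (\<Sum>j=1..J n. r / r ^ (2 * n) * (corrector n j y * (1 / r) ^ j / fact j))" for n
    have main: "g0_fun y + 1 / (2 * r) * heat_profile y + (\<Sum>n=2..K. 1 / r ^ n * g_fun N a n y) = S0 + (\<Sum>n=N..M. S n)"
      using taylor_sums_eq_profiles[OF r(2) y K, of M] by (simp add: S0_def S_def J_def M_def del: f0_deriv.simps sum.cl_ivl_Suc)
    have e1: "\<bar>grad (\<lambda>y. residual M y t) x - grad (Omega N a) x\<bar> \<le> C / r0 ^ (2 * M + 1 - (K + 1)) / r ^ (K + 1)"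
    proof -
      have "sqrt t / t ^ (M + 1) = 1 / r ^ (2 * M + 1)"
        using r(2) unfolding rt(1) unfolding rt(2) power_mult[symmetric] by (simp add: field_simps)
      also have "\<dots> \<le> 1 / r0 ^ (2 * M + 1 - (K + 1)) / r ^ (K + 1)"
        by (rule inverse_power_le[OF r0 r(1)]) (simp add: M_def)
      finally have "C * (sqrt t / t ^ (M + 1)) \<le> C * (1 / r0 ^ (2 * M + 1 - (K + 1)) / r ^ (K + 1))"
        by (rule mult_left_mono[OF _ C(1)])
      then show ?thesis using C(2)[OF t x] by simp
    qed
    have e2: "\<bar>r * ?A - S0\<bar> \<le> B0 / r ^ (K + 1)"
    proof -
      have "\<bar>?A - (\<Sum>j=1..K + 1. f0_deriv j y * (1 / r) ^ j / fact j)\<bar> \<le> B0 * (1 / r) ^ Suc (K + 1)"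
        using r y B0 by (intro taylor_step_bound[where F = f0_deriv, OF f0_deriv_deriv]) auto
      then have "r * \<bar>?A - (\<Sum>j=1..K + 1. f0_deriv j y * (1 / r) ^ j / fact j)\<bar> \<le> r * (B0 * (1 / r) ^ Suc (K + 1))"
        using r by (intro mult_left_mono) auto
      also have "r * (B0 * (1 / r) ^ Suc (K + 1)) = B0 / r ^ (K + 1)"
        using r by (simp add: power_one_over field_simps)
      also have "r * \<bar>?A - (\<Sum>j=1..K + 1. f0_deriv j y * (1 / r) ^ j / fact j)\<bar> = \<bar>r * ?A - S0\<bar>"
      proof -
        have "r * ?A - S0 = r * (?A - (\<Sum>j=1..K + 1. f0_deriv j y * (1 / r) ^ j / fact j))"
          by (simp only: S0_def right_diff_distrib sum_distrib_left)
        then show ?thesis using r by (simp only: abs_mult abs_of_pos)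
      qed
      finally show ?thesis .
    qed
    have e3: "\<bar>r / r ^ (2 * n) * ?B n - S n\<bar> \<le> B n / r0 ^ (2 * n + J n - (K + 1)) / r ^ (K + 1)" for n
    proof -
      let ?q = "r / r ^ (2 * n)"
      have q: "?q > 0" using r by simp
      have "\<bar>?B n - (\<Sum>j=1..J n. corrector n j y * (1 / r) ^ j / fact j)\<bar> \<le> B n * (1 / r) ^ Suc (J n)"
        using r y B by (intro taylor_step_bound[where F = "corrector n", OF corrector_deriv]) auto
      then have "?q * \<bar>?B n - (\<Sum>j=1..J n. corrector n j y * (1 / r) ^ j / fact j)\<bar> \<le> ?q * (B n * (1 / r) ^ Suc (J n))"
        using q by (intro mult_left_mono) auto
      moreover have "?q * (B n * (1 / r) ^ Suc (J n)) = B n * (1 / r ^ (2 * n + J n))"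
        using r by (simp add: power_one_over power_add field_simps)
      moreover have "\<dots> \<le> B n * (1 / r0 ^ (2 * n + J n - (K + 1)) / r ^ (K + 1))"
        by (intro mult_left_mono B_nonneg inverse_power_le[OF r0 r(1)]) (simp add: J_def)
      moreover have "?q * ?B n - S n = ?q * (?B n - (\<Sum>j=1..J n. corrector n j y * (1 / r) ^ j / fact j))"
        by (simp only: S_def right_diff_distrib[of ?q] sum_distrib_left)
      then have "\<bar>?q * ?B n - S n\<bar> = ?q * \<bar>?B n - (\<Sum>j=1..J n. corrector n j y * (1 / r) ^ j / fact j)\<bar>"
        using q by (simp only: abs_mult abs_of_pos)
      ultimately show ?thesis by simp
    qed
    have e3': "\<bar>(\<Sum>n=N..M. r / r ^ (2 * n) * ?B n) - (\<Sum>n=N..M. S n)\<bar>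
        \<le> (\<Sum>n=N..M. B n / r0 ^ (2 * n + J n - (K + 1)) / r ^ (K + 1))"
      unfolding sum_subtractf[symmetric] by (rule order_trans[OF sum_abs sum_mono[OF e3]])
    have "R / r ^ (K + 1) = C / r0 ^ (2 * M + 1 - (K + 1)) / r ^ (K + 1) + B0 / r ^ (K + 1)
        + (\<Sum>n=N..M. B n / r0 ^ (2 * n + J n - (K + 1)) / r ^ (K + 1))"
      by (simp only: R_def add_divide_distrib sum_divide_distrib)
    then have "\<bar>grad (\<lambda>y. green y t) x - (grad (Omega N a) x + (S0 + (\<Sum>n=N..M. S n)))\<bar> \<le> R / r ^ (K + 1)"
      using e1 e2 e3' unfolding split by linarith
    then show ?thesis
      unfolding main[symmetric] unfolding rt(1) y_def[symmetric] by (simp only: add.assoc)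
  qed
  ultimately show ?thesis by blast
qed

end

lemma powr_half_eq_sqrt_power: "t > 0 \<Longrightarrow> t powr (real n / 2) = sqrt t ^ n"
  by (simp add: powr_half_sqrt[symmetric] powr_powr flip: powr_realpow)

theorem theorem6p3:
  fixes N :: nat and a :: "nat \<Rightarrow> real" and v :: "int \<Rightarrow> real \<Rightarrow> real"
    and t0 :: real and K1 :: nat
  assumes "N \<ge> 1"
    and "stencil_coeffs N a"
    and "second_green_function N a v"
    and "t0 > 0"
    and "K1 \<ge> 2"
  shows "(\<exists>(r :: int \<Rightarrow> real \<Rightarrow> real) (R :: real). R \<ge> 0 \<and>
           (\<forall>x\<ge>0. \<forall>t\<ge>t0.
              grad (\<lambda>y. v y t) x =
                grad (Omega N a) x + g0_fun (real_of_int x / sqrt t)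
                + 1 / (2 * sqrt t) * heat_profile (real_of_int x / sqrt t)
                + (\<Sum>n=2..K1. 1 / t powr (real n / 2) * g_fun N a n (real_of_int x / sqrt t))
                + r x t
              \<and> \<bar>r x t\<bar> \<le> R / t powr ((real K1 + 1) / 2)))
       \<and> (\<forall>x\<le>-1. \<forall>t\<ge>t0. grad (\<lambda>y. v y t) x = - grad (\<lambda>y. v y t) (- (x + 1)))
       \<and> (N = 1 \<longrightarrow> (\<forall>x\<ge>0. grad (Omega N a) x = 0))"
proof -
  interpret stencil N a using assms by unfold_locales
  have v: "v x t = green x t" if "t \<ge> t0" for x t
    using second_green_function_eq[OF assms(3)] that assms(4) by simp
  obtain R where R: "R \<ge> 0" "\<And>x t. x \<ge> 0 \<Longrightarrow> t \<ge> t0 \<Longrightarrow>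
     \<bar>grad (\<lambda>y. green y t) x - (grad (Omega N a) x + g0_fun (real_of_int x / sqrt t)
     + 1 / (2 * sqrt t) * heat_profile (real_of_int x / sqrt t)
     + (\<Sum>n=2..K1. 1 / sqrt t ^ n * g_fun N a n (real_of_int x / sqrt t)))\<bar> \<le> R / sqrt t ^ (K1 + 1)"
    using grad_green_expansion[OF assms(4,5)] by blast
  \<comment> \<open>The remainder is the difference itself, so the expansion holds by definition and
    only the bound has content.\<close>
  define r where "r x t = grad (\<lambda>y. v y t) x - (grad (Omega N a) x + g0_fun (real_of_int x / sqrt t)
     + 1 / (2 * sqrt t) * heat_profile (real_of_int x / sqrt t)
     + (\<Sum>n=2..K1. 1 / t powr (real n / 2) * g_fun N a n (real_of_int x / sqrt t)))" for x t
  have "\<bar>r x t\<bar> \<le> R / t powr ((real K1 + 1) / 2)" if "x \<ge> 0" "t \<ge> t0" for x t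
  proof -
    have t: "t > 0" using that assms(4) by simp
    have "t powr ((real K1 + 1) / 2) = sqrt t ^ (K1 + 1)"
      using powr_half_eq_sqrt_power[OF t, of "K1 + 1"] by (simp add: add.commute)
    then show ?thesis
      using R(2)[OF that] that by (simp only: r_def v powr_half_eq_sqrt_power[OF t])
  qed
  then have "\<exists>r R. R \<ge> 0 \<and> (\<forall>x\<ge>0. \<forall>t\<ge>t0.
              grad (\<lambda>y. v y t) x =
                grad (Omega N a) x + g0_fun (real_of_int x / sqrt t)
                + 1 / (2 * sqrt t) * heat_profile (real_of_int x / sqrt t)
                + (\<Sum>n=2..K1. 1 / t powr (real n / 2) * g_fun N a n (real_of_int x / sqrt t))
                + r x t
              \<and> \<bar>r x t\<bar> \<le> R / t powr ((real K1 + 1) / 2))"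
    using R(1) by (intro exI[of _ r] exI[of _ R]) (auto simp: r_def)
  \<comment> \<open>Evenness of \<open>green\<close> exchanges the two lattice points of the
    gradient under the reflection of \<open>x\<close> to \<open>- (x + 1)\<close>.\<close>
  moreover have "grad (\<lambda>y. v y t) x = - grad (\<lambda>y. v y t) (- (x + 1))" if "t \<ge> t0" for x t
    using that green_minus[of x t] green_minus[of "x + 1" t] by (simp add: grad_def v)
  ultimately show ?thesis using grad_Omega_eq_0 by blast
qed

end
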